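(* Let $\mathbb X$ and $\mathbb X'$ be tangent categories, where $\mathbb X$ has a terminal object $*$. Consider the assignment $$\mathrm{Eval}:\mathrm{DObj}_{\mathrm{add}}(\mathbb X)\times\mathrm{DiffFun}_\bullet(\mathbb X,\mathbb X')\to\mathrm{DBun}_{\mathrm{add}}(\mathbb X'),$$ where $\mathrm{DiffFun}_\bullet$ stands for $\mathrm{DiffFun}$ or $\mathrm{DiffFun}_{\mathrm{lin}}$, given as follows. On objects, a differential object $(A,\zeta,\sigma,\lambda)$ and a differential functor $(F,\hat\alpha)$ are sent to the differential bundle with total space $F(A)$, base $F( * )$, projection $F(!)$, addition $F(\sigma)$, zero section $F(\zeta)$ and lift $\hat\alpha_{W,A}\circ F(\lambda)$. On morphisms, an additive morphism of differential objects $f:A\to A'$ and a morphism $\varphi:F\Rightarrow F'$ are sent to $(\varphi_{A'}\circ F(f),\varphi_* )$. Then $\mathrm{Eval}$ is a functor, and the following diagrams commute: $$t\circ\mathrm{Eval}=\mathrm{eval}\circ(u\times U):\mathrm{DObj}_{\mathrm{add}}(\mathbb X)\times\mathrm{DiffFun}_\bullet(\mathbb X,\mathbb X')\to\mathbb X',$$ $$u'\circ\mathrm{Eval}=\mathrm{eval}\circ(u\times U):\mathrm{DObj}_{\mathrm{add}}(\mathbb X)\times\mathrm{DiffFun}^{\mathrm{strong}}_\bullet(\mathbb X,\mathbb X')\to\mathbb X',$$ where in the second diagram $\mathrm{Eval}$ is restricted to strong differential functors and takes values in $\mathrm{DObj}_{\mathrm{add}}(\mathbb X')$. Here $u,u'$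 send a differential object to its underlying object, $U$ sends a differential functor to its underlying functor, $t$ sends a differential bundle to its total space, and $\mathrm{eval}:\mathbb X\times\mathrm{Fun}(\mathbb X,\mathbb X')\to\mathbb X'$ is the usual evaluation functor.
   Context: **Weil algebras and tangent actegories.** $\mathrm{Weil}$ is the category whose objects are the commutative $\mathbb N$-algebras (semirings) $\mathbb N[x_1,\dots,x_n]/\langle x_ix_j\mid i\sim j\rangle$ for an equivalence relation $\sim$ on $\{1,\dots,n\}$, with unital $\mathbb N$-linear semiring homomorphisms as morphisms. It is monoidal under the coproduct $\otimes$ with unit $\mathbb N$ (also terminal). $W=\mathbb N[x]/\langle x^2\rangle$; $W^n=\mathbb N[x_1,\dots,x_n]/\langle x_ix_j \mid \text{all } i,j\rangle$ is the $n$-fold product in $\mathrm{Weil}$; every object has the form $W^{n_1}\otimes\cdots\otimes W^{n_k}$. Distinguished morphisms: $p:W\to\mathbb N$, $ax+b\mapsto b$; $0:\mathbb N\to W$ the inclusion; $+:W\times W\to W$, $ax_1+bx_2+c\mapsto (a+b)x+c$; $\ell:W\to W\otimes W$, $ax+b\mapsto ax_1x_2+b$; $c:W\otimes W\to W\otimes W$ swapping $x_1,x_2$. A $\mathrm{Weil}$-actegory $(\mathbb X,T_\bullet)$ is a category with a functor $T_\bullet:\mathrm{Weil}\times\mathbb X\to\mathbb X$ and natural isomorphisms $X\cong T_\bullet(\mathbb N,X)$, $T_\bullet(A,T_\bullet(B,X))\cong T_\bullet(A\otimes B,X)$ satisfying the usual associativity and unit coherences. Write $T_A=T_\bullet(A,-)$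 and $T_\theta$ for the natural transformation given by a morphism $\theta$ of $\mathrm{Weil}$. It is a tangent actegory if for each object $X$ the functor $T_{(-)}(X)$ sends to pullbacks: (i) the squares exhibiting $A\otimes(B\times C)$ as the pullback of $A\otimes B\to A\leftarrow A\otimes C$, whenever $B\times C$ exists in $\mathrm{Weil}$; (ii) the squares obtained by applying $W^{\otimes n}\otimes-$, $n\ge0$, to the pullback square with top $\nu:W\times W\to W\otimes W$, $\nu(ax_1+bx_2+c)=ax_1x_2+bx_2+c$, right side $1_W\otimes p:W\otimes W\to W$, left side the unique map $W\times W\to\mathbb N$ and bottom $0:\mathbb N\to W$. Tangent categories are identified with tangent actegories, with tangent functor $T:=T_W$ and structure maps $p:=T_p,\ 0:=T_0,\ +:=T_+,\ \ell:=T_\ell,\ c:=T_c$, under the identifications $T_{W\otimes W}=T\circ T$, $T_n:=T_{W^n}$. **Differential bundles.** An additive bundle $(X,A,p,+,0)$: a morphism $p:X\to A$ with pullback powers $X_n$ of $p$ over $A$, and $+:X_2\to X$, $0:A\to X$ with $p\circ +=p\circ\pi_0=p\circ\pi_1$, $p\circ0=1_A$, and $+$ associative, commutative and with unit $0$. An additive bundle morphism $(f,g)$ is a pair $f:X\to Y$, $g:A\to B$ with $p'f=gp$, $f\circ+=+'\circ f_2$, $f\circ0=0'\circ g$. A differential bundle $(E,M,q,\zeta,\sigma,\lambda)$ in $(\mathbb X,T)$ consists of $q:E\to M$ whose finite pullback powers $E_n$ exist and are preserved by all $T^k$; $\zeta:M\to E$, $\sigma:E_2\to E$ making $(E,M,q,\sigma,\zeta)$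 an additive bundle; and $\lambda:E\to TE$ such that $(\lambda,0_M)$ is an additive bundle morphism to $(TE,TM,Tq,T\sigma,T\zeta)$, $(\lambda,\zeta)$ is an additive bundle morphism to $(TE,E,p_E,+_E,0_E)$, $\ell_E\circ\lambda=T(\lambda)\circ\lambda$, and the square with top $T(\sigma)\circ\langle\lambda\pi_0,0\pi_1\rangle:E_2\to TE$, left $q\pi_0:E_2\to M$, bottom $0_M:M\to TM$, right $T(q)$ is a pullback. A differential object is a differential bundle over a terminal object $*$. A morphism of differential bundles $(f,g)$ is a pair $f:E\to E'$, $g:M\to M'$ with $q'f=gq$; it is additive if $f\sigma=\sigma'f_2$ and $f\zeta=\zeta'g$. $\mathrm{DBun}_{\mathrm{add}}$ is the category of differential bundles and additive morphisms, $\mathrm{DObj}_{\mathrm{add}}$ its full subcategory on differential objects (a morphism is $(f,1_* )$). **Differential functors.** An oplax $\mathrm{Weil}$-linear functor $(F,\hat\alpha):(\mathbb X,T_\bullet)\to(\mathbb X',T'_\bullet)$ is a functor $F$ with a natural transformation $\hat\alpha:F\circ T_\bullet\Rightarrow T'_\bullet\circ(1\times F)$, components $\hat\alpha_{A,X}:F(T_AX)\to T'_A(FX)$, satisfying (modulo the structure isomorphisms) $\hat\alpha_{A\otimes B,X}=T'_A(\hat\alpha_{B,X})\circ\hat\alpha_{A,T_BX}$ and $\hat\alpha_{\mathbb N,X}=1_{FX}$. Suppose $\mathbb X$ has a terminal object $*$. $(F,\hat\alpha)$ is a lax differential functor if for all $A\in\mathrm{Weil}$: (a) $T'_A\circ F$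 preserves pullbacks over $*$, and (b) all naturality squares of $\hat\alpha_{A,-}:F\circ T_A\Rightarrow T'_A\circ F$ are pullbacks; it is strong if moreover $F( * )$ is terminal. $\mathrm{DiffFun}(\mathbb X,\mathbb X')$ has lax differential functors as objects and all natural transformations of underlying functors as morphisms; $\mathrm{DiffFun}_{\mathrm{lin}}$ has the same objects and only the linear natural transformations, i.e. $\varphi$ with $\hat\alpha'_{A,X}\circ\varphi_{T_AX}=T'_A(\varphi_X)\circ\hat\alpha_{A,X}$ for all $A,X$. $\mathrm{DiffFun}^{\mathrm{strong}}$ and $\mathrm{DiffFun}^{\mathrm{strong}}_{\mathrm{lin}}$ are the full subcategories of these on strong differential functors.
   Formalization: It is additionally assumed that T( * ) is terminal in X; without this the claim fails, e.g. for X = Weil acting on itself, X' = Set with trivial tangent structure, F(A) = V^n on linear coefficients (V a non-trivial commutative monoid), and the differential object W. *)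

theory Defs
  imports Main "HOL-Library.FuncSet"
begin

section \<open>Categories, functors, limits\<close>

record ('o, 'm) cat =
  Obj :: "'o set"
  Arr :: "'m set"
  Dom :: "'m \<Rightarrow> 'o"
  Cod :: "'m \<Rightarrow> 'o"
  Ide :: "'o \<Rightarrow> 'm"
  Cmp :: "'m \<Rightarrow> 'm \<Rightarrow> 'm"

definition hom :: "('o, 'm) cat \<Rightarrow> 'o \<Rightarrow> 'o \<Rightarrow> 'm set" where
  "hom C a b = {f \<in> Arr C. Dom C f = a \<and> Cod C f = b}"

locale category =
  fixes C :: "('o, 'm) cat"
  assumes Dom_in: "f \<in> Arr C \<Longrightarrow> Dom C f \<in> Obj C"
    and Cod_in: "f \<in> Arr C \<Longrightarrow> Cod C f \<in> Obj C"
    and Ide_in: "a \<in> Obj C \<Longrightarrow> Ide C a \<in> hom C a a"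
    and Cmp_in: "f \<in> hom C a b \<Longrightarrow> g \<in> hom C b c \<Longrightarrow> Cmp C g f \<in> hom C a c"
    and Cmp_assoc: "f \<in> hom C a b \<Longrightarrow> g \<in> hom C b c \<Longrightarrow> h \<in> hom C c d \<Longrightarrow>
           Cmp C h (Cmp C g f) = Cmp C (Cmp C h g) f"
    and Cmp_Ide: "f \<in> hom C a b \<Longrightarrow> Cmp C f (Ide C a) = f"
    and Ide_Cmp: "f \<in> hom C a b \<Longrightarrow> Cmp C (Ide C b) f = f"

definition inverse_arrows :: "('o, 'm) cat \<Rightarrow> 'm \<Rightarrow> 'm \<Rightarrow> bool" where
  "inverse_arrows C f g \<longleftrightarrow>
     f \<in> Arr C \<and> g \<in> hom C (Cod C f) (Dom C f) \<and>
     Cmp C g f = Ide C (Dom C f) \<and> Cmp C f g = Ide C (Cod C f)"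

definition is_iso :: "('o, 'm) cat \<Rightarrow> 'm \<Rightarrow> bool" where
  "is_iso C f \<longleftrightarrow> (\<exists>g. inverse_arrows C f g)"

definition inv_arr :: "('o, 'm) cat \<Rightarrow> 'm \<Rightarrow> 'm" where
  "inv_arr C f = (THE g. inverse_arrows C f g)"

definition terminal :: "('o, 'm) cat \<Rightarrow> 'o \<Rightarrow> bool" where
  "terminal C t \<longleftrightarrow> t \<in> Obj C \<and> (\<forall>a\<in>Obj C. \<exists>!f. f \<in> hom C a t)"

definition is_product :: "('o, 'm) cat \<Rightarrow> 'o \<Rightarrow> 'o \<Rightarrow> 'o \<Rightarrow> 'm \<Rightarrow> 'm \<Rightarrow> bool" where
  "is_product C a b p r s \<longleftrightarrow>
     r \<in> hom C p a \<and> s \<in> hom C p b \<and>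
     (\<forall>z u v. u \<in> hom C z a \<and> v \<in> hom C z b \<longrightarrow>
        (\<exists>!h. h \<in> hom C z p \<and> Cmp C r h = u \<and> Cmp C s h = v))"

text \<open>\<open>is_pullback C p r s f g\<close>: the square \<open>f \<circ> r = g \<circ> s\<close> with apex \<open>p\<close> is a pullback.\<close>

definition is_pullback :: "('o, 'm) cat \<Rightarrow> 'o \<Rightarrow> 'm \<Rightarrow> 'm \<Rightarrow> 'm \<Rightarrow> 'm \<Rightarrow> bool" where
  "is_pullback C p r s f g \<longleftrightarrow>
     f \<in> Arr C \<and> g \<in> Arr C \<and> Cod C f = Cod C g \<and>
     r \<in> hom C p (Dom C f) \<and> s \<in> hom C p (Dom C g) \<and> Cmp C f r = Cmp C g s \<and>
     (\<forall>z u v. u \<in> hom C z (Dom C f) \<and> v \<in> hom C z (Dom C g) \<and> Cmp C f u = Cmp C g v \<longrightarrow>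
        (\<exists>!h. h \<in> hom C z p \<and> Cmp C r h = u \<and> Cmp C s h = v))"

text \<open>The \<open>n\<close>-fold pullback power of \<open>q : e \<rightarrow> m\<close> over \<open>m\<close>, with structure map \<open>b\<close> to \<open>m\<close> and
  projections \<open>r i\<close>, \<open>i < n\<close>; for \<open>n = 0\<close> this is \<open>m\<close> itself.\<close>

definition pullback_power ::
  "('o, 'm) cat \<Rightarrow> 'm \<Rightarrow> nat \<Rightarrow> 'o \<Rightarrow> 'm \<Rightarrow> (nat \<Rightarrow> 'm) \<Rightarrow> bool" where
  "pullback_power C q n p b r \<longleftrightarrow>
     q \<in> Arr C \<and> b \<in> hom C p (Cod C q) \<and>
     (\<forall>i<n. r i \<in> hom C p (Dom C q) \<and> Cmp C q (r i) = b) \<and>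
     (\<forall>z c u. c \<in> hom C z (Cod C q) \<and> (\<forall>i<n. u i \<in> hom C z (Dom C q) \<and> Cmp C q (u i) = c) \<longrightarrow>
        (\<exists>!h. h \<in> hom C z p \<and> Cmp C b h = c \<and> (\<forall>i<n. Cmp C (r i) h = u i)))"

definition cat_prod :: "('o, 'm) cat \<Rightarrow> ('p, 'q) cat \<Rightarrow> ('o \<times> 'p, 'm \<times> 'q) cat" where
  "cat_prod C D =
     \<lparr>Obj = Obj C \<times> Obj D, Arr = Arr C \<times> Arr D,
      Dom = map_prod (Dom C) (Dom D), Cod = map_prod (Cod C) (Cod D),
      Ide = map_prod (Ide C) (Ide D),
      Cmp = (\<lambda>(g, g') (f, f'). (Cmp C g f, Cmp D g' f'))\<rparr>"

definition full_subcat :: "('o, 'm) cat \<Rightarrow> 'o set \<Rightarrow> ('o, 'm) cat" where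
  "full_subcat C S =
     C\<lparr>Obj := Obj C \<inter> S, Arr := {f \<in> Arr C. Dom C f \<in> S \<and> Cod C f \<in> S}\<rparr>"

text \<open>Functors and natural transformations are normalised to be \<^const>\<open>undefined\<close> off their domain,
  so that HOL equality is equality of functors and of natural transformations.\<close>

record ('o, 'm, 'p, 'q) ftor =
  fobj :: "'o \<Rightarrow> 'p"
  farr :: "'m \<Rightarrow> 'q"

definition is_functor :: "('o, 'm) cat \<Rightarrow> ('p, 'q) cat \<Rightarrow> ('o, 'm, 'p, 'q) ftor \<Rightarrow> bool" where
  "is_functor C D F \<longleftrightarrow>
     category C \<and> category D \<and>
     fobj F \<in> Obj C \<rightarrow>\<^sub>E Obj D \<and> farr F \<in> Arr C \<rightarrow>\<^sub>E Arr D \<and>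
     (\<forall>a b f. f \<in> hom C a b \<longrightarrow> farr F f \<in> hom D (fobj F a) (fobj F b)) \<and>
     (\<forall>a\<in>Obj C. farr F (Ide C a) = Ide D (fobj F a)) \<and>
     (\<forall>a b c f g. f \<in> hom C a b \<and> g \<in> hom C b c \<longrightarrow>
        farr F (Cmp C g f) = Cmp D (farr F g) (farr F f))"

definition mk_ftor ::
  "('o, 'm) cat \<Rightarrow> ('o \<Rightarrow> 'p) \<Rightarrow> ('m \<Rightarrow> 'q) \<Rightarrow> ('o, 'm, 'p, 'q) ftor" where
  "mk_ftor C F G = \<lparr>fobj = restrict F (Obj C), farr = restrict G (Arr C)\<rparr>"

definition ftor_comp ::
  "('o, 'm) cat \<Rightarrow> ('p, 'q, 'r, 's) ftor \<Rightarrow> ('o, 'm, 'p, 'q) ftor \<Rightarrow> ('o, 'm, 'r, 's) ftor" where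
  "ftor_comp C G F = mk_ftor C (fobj G \<circ> fobj F) (farr G \<circ> farr F)"

definition ftor_prod ::
  "('o, 'm) cat \<Rightarrow> ('p, 'q) cat \<Rightarrow> ('o, 'm, 'a, 'b) ftor \<Rightarrow> ('p, 'q, 'c, 'd) ftor \<Rightarrow>
   ('o \<times> 'p, 'm \<times> 'q, 'a \<times> 'c, 'b \<times> 'd) ftor" where
  "ftor_prod C D F G =
     mk_ftor (cat_prod C D) (map_prod (fobj F) (fobj G)) (map_prod (farr F) (farr G))"

definition nat_trans ::
  "('o, 'm) cat \<Rightarrow> ('p, 'q) cat \<Rightarrow> ('o, 'm, 'p, 'q) ftor \<Rightarrow> ('o, 'm, 'p, 'q) ftor \<Rightarrow> ('o \<Rightarrow> 'q) \<Rightarrow> bool" where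
  "nat_trans C D F G \<phi> \<longleftrightarrow>
     \<phi> \<in> extensional (Obj C) \<and>
     (\<forall>a\<in>Obj C. \<phi> a \<in> hom D (fobj F a) (fobj G a)) \<and>
     (\<forall>a b f. f \<in> hom C a b \<longrightarrow> Cmp D (\<phi> b) (farr F f) = Cmp D (farr G f) (\<phi> a))"

definition Fun_cat ::
  "('o, 'm) cat \<Rightarrow> ('p, 'q) cat \<Rightarrow>
   (('o, 'm, 'p, 'q) ftor, ('o, 'm, 'p, 'q) ftor \<times> ('o, 'm, 'p, 'q) ftor \<times> ('o \<Rightarrow> 'q)) cat" where
  "Fun_cat C D =
     \<lparr>Obj = {F. is_functor C D F},
      Arr = {(F, G, \<phi>). is_functor C D F \<and> is_functor C D G \<and> nat_trans C D F G \<phi>},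
      Dom = (\<lambda>(F, G, \<phi>). F), Cod = (\<lambda>(F, G, \<phi>). G),
      Ide = (\<lambda>F. (F, F, \<lambda>a\<in>Obj C. Ide D (fobj F a))),
      Cmp = (\<lambda>(G', H, \<psi>) (F, G, \<phi>). (F, H, \<lambda>a\<in>Obj C. Cmp D (\<psi> a) (\<phi> a)))\<rparr>"

definition eval_ftor ::
  "('o, 'm) cat \<Rightarrow> ('p, 'q) cat \<Rightarrow>
   ('o \<times> ('o, 'm, 'p, 'q) ftor,
    'm \<times> (('o, 'm, 'p, 'q) ftor \<times> ('o, 'm, 'p, 'q) ftor \<times> ('o \<Rightarrow> 'q)), 'p, 'q) ftor" where
  "eval_ftor C D =
     mk_ftor (cat_prod C (Fun_cat C D))
       (\<lambda>(a, F). fobj F a)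
       (\<lambda>(f, (F, G, \<phi>)). Cmp D (\<phi> (Cod C f)) (farr F f))"


section \<open>Weil algebras over the natural numbers\<close>

text \<open>The pair \<open>(n, R)\<close> stands for \<open>\<nat>[x\<^sub>0,\<dots>,x\<^sub>n\<^sub>-\<^sub>1] / \<langle>x\<^sub>i x\<^sub>j | (i,j) \<in> R\<rangle>\<close>. As the relations are
  monomials and \<open>x\<^sub>i\<^sup>2 = 0\<close>, this quotient is free over \<open>\<nat>\<close> on the monomials \<open>x\<^sub>S = (\<Prod>i\<in>S. x\<^sub>i)\<close>,
  where \<open>S\<close> is a set of variables no two distinct members of which are related. An element is
  represented by its coefficient function \<open>a\<close>, with \<open>a S\<close> the coefficient of \<open>x\<^sub>S\<close>.\<close>

type_synonym weil_obj = "nat \<times> (nat \<times> nat) set"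
type_synonym weil_elt = "nat set \<Rightarrow> nat"
type_synonym weil_arr = "weil_obj \<times> weil_obj \<times> (weil_elt \<Rightarrow> weil_elt)"

definition is_weil :: "weil_obj \<Rightarrow> bool" where
  "is_weil A \<longleftrightarrow> equiv {..<fst A} (snd A)"

definition weil_basis :: "weil_obj \<Rightarrow> nat set set" where
  "weil_basis A = {S. S \<subseteq> {..<fst A} \<and> (\<forall>i\<in>S. \<forall>j\<in>S. i \<noteq> j \<longrightarrow> (i, j) \<notin> snd A)}"

definition weil_carrier :: "weil_obj \<Rightarrow> weil_elt set" where
  "weil_carrier A = {a. \<forall>S. S \<notin> weil_basis A \<longrightarrow> a S = 0}"

definition weil_monom :: "nat set \<Rightarrow> weil_elt" where
  "weil_monom S = (\<lambda>U. if U = S then 1 else 0)"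

definition weil_add :: "weil_elt \<Rightarrow> weil_elt \<Rightarrow> weil_elt" where
  "weil_add a b = (\<lambda>S. a S + b S)"

definition weil_mult :: "weil_obj \<Rightarrow> weil_elt \<Rightarrow> weil_elt \<Rightarrow> weil_elt" where
  "weil_mult A a b = (\<lambda>S. if S \<in> weil_basis A then \<Sum>U\<in>Pow S. a U * b (S - U) else 0)"

text \<open>\<open>\<nat>\<close>-linearity is preservation of sums and zero; the unit is the monomial of \<open>{}\<close>.\<close>

definition weil_hom :: "weil_obj \<Rightarrow> weil_obj \<Rightarrow> (weil_elt \<Rightarrow> weil_elt) \<Rightarrow> bool" where
  "weil_hom A B f \<longleftrightarrow>
     f \<in> weil_carrier A \<rightarrow>\<^sub>E weil_carrier B \<and>
     f (\<lambda>S. 0) = (\<lambda>S. 0) \<and> f (weil_monom {}) = weil_monom {} \<and>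
     (\<forall>a\<in>weil_carrier A. \<forall>b\<in>weil_carrier A.
        f (weil_add a b) = weil_add (f a) (f b) \<and> f (weil_mult A a b) = weil_mult B (f a) (f b))"

definition mk_weil_arr :: "weil_obj \<Rightarrow> weil_obj \<Rightarrow> (weil_elt \<Rightarrow> weil_elt) \<Rightarrow> weil_arr" where
  "mk_weil_arr A B f = (A, B, restrict f (weil_carrier A))"

definition Weil :: "(weil_obj, weil_arr) cat" where
  "Weil =
     \<lparr>Obj = {A. is_weil A},
      Arr = {(A, B, f). is_weil A \<and> is_weil B \<and> weil_hom A B f},
      Dom = (\<lambda>(A, B, f). A), Cod = (\<lambda>(A, B, f). B),
      Ide = (\<lambda>A. mk_weil_arr A A (\<lambda>a. a)),
      Cmp = (\<lambda>(B', C, g) (A, B, f). mk_weil_arr A C (g \<circ> f))\<rparr>"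

text \<open>The coproduct \<open>A \<otimes> B\<close> places the variables of \<open>B\<close> after those of \<open>A\<close>. With this choice of
  coproducts \<open>\<otimes>\<close> is strictly associative and strictly unital, so that the associativity and unit
  isomorphisms of \<open>Weil\<close> are identities and do not appear below.\<close>

definition tensor_obj :: "weil_obj \<Rightarrow> weil_obj \<Rightarrow> weil_obj" where
  "tensor_obj A B = (fst A + fst B, snd A \<union> map_prod ((+) (fst A)) ((+) (fst A)) ` snd B)"

lemma tensor_obj_assoc: "tensor_obj (tensor_obj A B) C = tensor_obj A (tensor_obj B C)"
  by (simp add: tensor_obj_def image_Un image_image map_prod_def split_def add.assoc Un_assoc)

definition pure_tensor :: "weil_obj \<Rightarrow> weil_elt \<Rightarrow> weil_elt \<Rightarrow> weil_elt" where
  "pure_tensor A a b = (\<lambda>S. a (S \<inter> {..<fst A}) * b {i. fst A + i \<in> S})"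

text \<open>\<open>f \<otimes> g\<close> is the \<open>\<nat>\<close>-linear map sending \<open>x\<^sub>S \<otimes> x\<^sub>U\<close> to \<open>f x\<^sub>S \<otimes> g x\<^sub>U\<close>.\<close>

definition tensor_arr :: "weil_arr \<Rightarrow> weil_arr \<Rightarrow> weil_arr" where
  "tensor_arr = (\<lambda>(A, A', f) (B, B', g).
     mk_weil_arr (tensor_obj A B) (tensor_obj A' B')
       (\<lambda>c V. \<Sum>S\<in>weil_basis A. \<Sum>U\<in>weil_basis B.
          c (S \<union> (+) (fst A) ` U) * pure_tensor A' (f (weil_monom S)) (g (weil_monom U)) V))"

definition W_pow :: "nat \<Rightarrow> weil_obj" where
  "W_pow n = (n, {..<n} \<times> {..<n})"

definition N_obj :: weil_obj where "N_obj = W_pow 0"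

lemma tensor_obj_N: "tensor_obj A N_obj = A" "tensor_obj N_obj A = A"
  by (auto simp: tensor_obj_def N_obj_def W_pow_def map_prod_def split_def)

definition W :: weil_obj where "W = W_pow 1"

primrec W_tensor :: "nat \<Rightarrow> weil_obj" where
  "W_tensor 0 = N_obj"
| "W_tensor (Suc n) = tensor_obj W (W_tensor n)"

text \<open>The unique morphism \<open>A \<rightarrow> \<nat>\<close>, which takes the constant term; for \<open>A = W\<close> it is \<open>p\<close>.\<close>

definition weil_bang :: "weil_obj \<Rightarrow> weil_arr" where
  "weil_bang A = mk_weil_arr A N_obj (\<lambda>a S. if S = {} then a {} else 0)"

definition weil_p :: weil_arr where "weil_p = weil_bang W"

definition weil_0 :: weil_arr where "weil_0 = mk_weil_arr N_obj W (\<lambda>a. a)"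

definition weil_plus :: weil_arr where
  "weil_plus = mk_weil_arr (W_pow 2) W
     (\<lambda>a S. if S = {} then a {} else if S = {0} then a {0} + a {1} else 0)"

definition weil_proj :: "nat \<Rightarrow> weil_arr" where
  "weil_proj i = mk_weil_arr (W_pow 2) W
     (\<lambda>a S. if S = {} then a {} else if S = {0} then a {i} else 0)"

definition weil_l :: weil_arr where
  "weil_l = mk_weil_arr W (tensor_obj W W)
     (\<lambda>a S. if S = {} then a {} else if S = {0, 1} then a {0} else 0)"

definition weil_nu :: weil_arr where
  "weil_nu = mk_weil_arr (W_pow 2) (tensor_obj W W)
     (\<lambda>a S. if S = {} then a {} else if S = {0, 1} then a {0} else if S = {1} then a {1} else 0)"


section \<open>Tangent actegories\<close>

text \<open>\<open>act_unit x : x \<rightarrow> T\<^bsub>\<nat>\<^esub> x\<close> and \<open>act_mult A B x : T\<^bsub>A\<^esub> (T\<^bsub>B\<^esub> x) \<rightarrow> T\<^bsub>A \<otimes> B\<^esub> x\<close>.\<close>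

record ('o, 'm) actegory =
  und :: "('o, 'm) cat"
  act :: "(weil_obj \<times> 'o, weil_arr \<times> 'm, 'o, 'm) ftor"
  act_unit :: "'o \<Rightarrow> 'm"
  act_mult :: "weil_obj \<Rightarrow> weil_obj \<Rightarrow> 'o \<Rightarrow> 'm"

definition Tobj :: "('o, 'm) actegory \<Rightarrow> weil_obj \<Rightarrow> 'o \<Rightarrow> 'o" where
  "Tobj X A x = fobj (act X) (A, x)"

definition Tact :: "('o, 'm) actegory \<Rightarrow> weil_arr \<Rightarrow> 'm \<Rightarrow> 'm" where
  "Tact X \<theta> f = farr (act X) (\<theta>, f)"

definition Tarr :: "('o, 'm) actegory \<Rightarrow> weil_obj \<Rightarrow> 'm \<Rightarrow> 'm" where
  "Tarr X A f = Tact X (Ide Weil A) f"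

definition Tnat :: "('o, 'm) actegory \<Rightarrow> weil_arr \<Rightarrow> 'o \<Rightarrow> 'm" where
  "Tnat X \<theta> x = Tact X \<theta> (Ide (und X) x)"

definition weil_actegory :: "('o, 'm) actegory \<Rightarrow> bool" where
  "weil_actegory X \<longleftrightarrow>
     (let C = und X; \<eta> = act_unit X; \<mu> = act_mult X in
       is_functor (cat_prod Weil C) C (act X) \<and>
       (\<forall>x\<in>Obj C. \<eta> x \<in> hom C x (Tobj X N_obj x) \<and> is_iso C (\<eta> x)) \<and>
       (\<forall>x y f. f \<in> hom C x y \<longrightarrow> Cmp C (Tarr X N_obj f) (\<eta> x) = Cmp C (\<eta> y) f) \<and>
       (\<forall>A\<in>Obj Weil. \<forall>B\<in>Obj Weil. \<forall>x\<in>Obj C.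
          \<mu> A B x \<in> hom C (Tobj X A (Tobj X B x)) (Tobj X (tensor_obj A B) x) \<and>
          is_iso C (\<mu> A B x)) \<and>
       (\<forall>A A' \<theta> B B' \<theta>' x y f.
          \<theta> \<in> hom Weil A A' \<and> \<theta>' \<in> hom Weil B B' \<and> f \<in> hom C x y \<longrightarrow>
          Cmp C (\<mu> A' B' y) (Tact X \<theta> (Tact X \<theta>' f)) =
          Cmp C (Tact X (tensor_arr \<theta> \<theta>') f) (\<mu> A B x)) \<and>
       (\<forall>A\<in>Obj Weil. \<forall>B\<in>Obj Weil. \<forall>D\<in>Obj Weil. \<forall>x\<in>Obj C.
          Cmp C (\<mu> (tensor_obj A B) D x) (\<mu> A B (Tobj X D x)) =
          Cmp C (\<mu> A (tensor_obj B D) x) (Tarr X A (\<mu> B D x))) \<and>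
       (\<forall>A\<in>Obj Weil. \<forall>x\<in>Obj C.
          Cmp C (\<mu> N_obj A x) (\<eta> (Tobj X A x)) = Ide C (Tobj X A x) \<and>
          Cmp C (\<mu> A N_obj x) (Tarr X A (\<eta> x)) = Ide C (Tobj X A x)))"

definition tangent_actegory :: "('o, 'm) actegory \<Rightarrow> bool" where
  "tangent_actegory X \<longleftrightarrow>
     weil_actegory X \<and>
     (\<forall>x\<in>Obj (und X).
        (\<forall>A\<in>Obj Weil. \<forall>B\<in>Obj Weil. \<forall>C\<in>Obj Weil. \<forall>P r s. is_product Weil B C P r s \<longrightarrow>
           is_pullback (und X) (Tobj X (tensor_obj A P) x)
             (Tnat X (tensor_arr (Ide Weil A) r) x)
             (Tnat X (tensor_arr (Ide Weil A) s) x)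
             (Tnat X (tensor_arr (Ide Weil A) (weil_bang B)) x)
             (Tnat X (tensor_arr (Ide Weil A) (weil_bang C)) x)) \<and>
        (\<forall>n. let I = Ide Weil (W_tensor n) in
           is_pullback (und X) (Tobj X (tensor_obj (W_tensor n) (W_pow 2)) x)
             (Tnat X (tensor_arr I weil_nu) x)
             (Tnat X (tensor_arr I (weil_bang (W_pow 2))) x)
             (Tnat X (tensor_arr I (tensor_arr (Ide Weil W) weil_p)) x)
             (Tnat X (tensor_arr I weil_0) x)))"

text \<open>The induced tangent structure: projection \<open>T x \<rightarrow> x\<close>, zero \<open>x \<rightarrow> T x\<close>, addition
  \<open>T\<^sub>2 x \<rightarrow> T x\<close> and vertical lift \<open>T x \<rightarrow> T (T x)\<close>, where \<open>T = T\<^bsub>W\<^esub>\<close> and \<open>T\<^sub>2 = T\<^bsub>W\<^sup>2\<^esub>\<close>.\<close>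

definition tan_p :: "('o, 'm) actegory \<Rightarrow> 'o \<Rightarrow> 'm" where
  "tan_p X x = Cmp (und X) (inv_arr (und X) (act_unit X x)) (Tnat X weil_p x)"

definition tan_0 :: "('o, 'm) actegory \<Rightarrow> 'o \<Rightarrow> 'm" where
  "tan_0 X x = Cmp (und X) (Tnat X weil_0 x) (act_unit X x)"

definition tan_plus :: "('o, 'm) actegory \<Rightarrow> 'o \<Rightarrow> 'm" where
  "tan_plus X x = Tnat X weil_plus x"

definition tan_l :: "('o, 'm) actegory \<Rightarrow> 'o \<Rightarrow> 'm" where
  "tan_l X x = Cmp (und X) (inv_arr (und X) (act_mult X W W x)) (Tnat X weil_l x)"


section \<open>Differential bundles\<close>

text \<open>The pullback \<open>E\<^sub>2\<close> on which the addition is defined is recorded, with its projections, as part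
  of the data.\<close>

record ('o, 'm) add_bundle =
  tot :: 'o
  base :: 'o
  proj :: 'm
  tot2 :: 'o
  pr0 :: 'm
  pr1 :: 'm
  bplus :: 'm
  bzero :: 'm

record ('o, 'm) dbundle = "('o, 'm) add_bundle" +
  lift :: 'm

text \<open>\<open>\<langle>u, v\<rangle>\<close> into the pullback \<open>E\<^sub>2\<close> of \<open>B\<close>.\<close>

definition pair2 :: "('o, 'm) cat \<Rightarrow> ('o, 'm, 'z) add_bundle_scheme \<Rightarrow> 'm \<Rightarrow> 'm \<Rightarrow> 'm" where
  "pair2 C B u v =
     (THE h. h \<in> hom C (Dom C u) (tot2 B) \<and> Cmp C (pr0 B) h = u \<and> Cmp C (pr1 B) h = v)"

text \<open>Associativity, commutativity and unitality are stated on generalised elements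
  \<open>u, v, w : z \<rightarrow> E\<close> of a common fibre.\<close>

definition additive_bundle :: "('o, 'm) cat \<Rightarrow> ('o, 'm, 'z) add_bundle_scheme \<Rightarrow> bool" where
  "additive_bundle C B \<longleftrightarrow>
     proj B \<in> hom C (tot B) (base B) \<and>
     (\<forall>n. \<exists>P b r. pullback_power C (proj B) n P b r) \<and>
     is_pullback C (tot2 B) (pr0 B) (pr1 B) (proj B) (proj B) \<and>
     bplus B \<in> hom C (tot2 B) (tot B) \<and> bzero B \<in> hom C (base B) (tot B) \<and>
     Cmp C (proj B) (bplus B) = Cmp C (proj B) (pr0 B) \<and>
     Cmp C (proj B) (bplus B) = Cmp C (proj B) (pr1 B) \<and>
     Cmp C (proj B) (bzero B) = Ide C (base B) \<and>
     (let s = (\<lambda>u v. Cmp C (bplus B) (pair2 C B u v)) in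
       (\<forall>z u v w. u \<in> hom C z (tot B) \<and> v \<in> hom C z (tot B) \<and> w \<in> hom C z (tot B) \<and>
          Cmp C (proj B) u = Cmp C (proj B) v \<and> Cmp C (proj B) v = Cmp C (proj B) w \<longrightarrow>
          s (s u v) w = s u (s v w)) \<and>
       (\<forall>z u v. u \<in> hom C z (tot B) \<and> v \<in> hom C z (tot B) \<and>
          Cmp C (proj B) u = Cmp C (proj B) v \<longrightarrow> s u v = s v u) \<and>
       (\<forall>z u. u \<in> hom C z (tot B) \<longrightarrow> s u (Cmp C (bzero B) (Cmp C (proj B) u)) = u))"

definition additive_bundle_hom ::
  "('o, 'm) cat \<Rightarrow> ('o, 'm, 'y) add_bundle_scheme \<Rightarrow> ('o, 'm, 'z) add_bundle_scheme \<Rightarrow>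
   'm \<Rightarrow> 'm \<Rightarrow> bool" where
  "additive_bundle_hom C B B' f g \<longleftrightarrow>
     f \<in> hom C (tot B) (tot B') \<and> g \<in> hom C (base B) (base B') \<and>
     Cmp C (proj B') f = Cmp C g (proj B) \<and>
     Cmp C f (bplus B) = Cmp C (bplus B') (pair2 C B' (Cmp C f (pr0 B)) (Cmp C f (pr1 B))) \<and>
     Cmp C f (bzero B) = Cmp C (bzero B') g"

definition T_bundle ::
  "('o, 'm) actegory \<Rightarrow> ('o, 'm, 'z) add_bundle_scheme \<Rightarrow> ('o, 'm) add_bundle" where
  "T_bundle X B =
     \<lparr>tot = Tobj X W (tot B), base = Tobj X W (base B), proj = Tarr X W (proj B),
      tot2 = Tobj X W (tot2 B), pr0 = Tarr X W (pr0 B), pr1 = Tarr X W (pr1 B),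
      bplus = Tarr X W (bplus B), bzero = Tarr X W (bzero B)\<rparr>"

definition tangent_bundle :: "('o, 'm) actegory \<Rightarrow> 'o \<Rightarrow> ('o, 'm) add_bundle" where
  "tangent_bundle X x =
     \<lparr>tot = Tobj X W x, base = x, proj = tan_p X x,
      tot2 = Tobj X (W_pow 2) x, pr0 = Tnat X (weil_proj 0) x, pr1 = Tnat X (weil_proj 1) x,
      bplus = tan_plus X x, bzero = tan_0 X x\<rparr>"

definition differential_bundle :: "('o, 'm) actegory \<Rightarrow> ('o, 'm) dbundle \<Rightarrow> bool" where
  "differential_bundle X E \<longleftrightarrow>
     (let C = und X in
       additive_bundle C E \<and>
       (\<forall>k n P b r. pullback_power C (proj E) n P b r \<longrightarrow>
          pullback_power C ((Tarr X W ^^ k) (proj E)) n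
            ((Tobj X W ^^ k) P) ((Tarr X W ^^ k) b) (\<lambda>i. (Tarr X W ^^ k) (r i))) \<and>
       additive_bundle_hom C E (T_bundle X E) (lift E) (tan_0 X (base E)) \<and>
       additive_bundle_hom C E (tangent_bundle X (tot E)) (lift E) (bzero E) \<and>
       Cmp C (tan_l X (tot E)) (lift E) = Cmp C (Tarr X W (lift E)) (lift E) \<and>
       is_pullback C (tot2 E)
         (Cmp C (Tarr X W (bplus E))
            (pair2 C (T_bundle X E)
               (Cmp C (lift E) (pr0 E)) (Cmp C (tan_0 X (tot E)) (pr1 E))))
         (Cmp C (proj E) (pr0 E))
         (Tarr X W (proj E))
         (tan_0 X (base E)))"

text \<open>A morphism is \<open>(E, E', f, g)\<close> with \<open>f : tot E \<rightarrow> tot E'\<close> and \<open>g : base E \<rightarrow> base E'\<close>.\<close>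

definition DBun_add ::
  "('o, 'm) actegory \<Rightarrow>
   (('o, 'm) dbundle, ('o, 'm) dbundle \<times> ('o, 'm) dbundle \<times> 'm \<times> 'm) cat" where
  "DBun_add X =
     \<lparr>Obj = {E. differential_bundle X E},
      Arr = {(E, E', f, g). differential_bundle X E \<and> differential_bundle X E' \<and>
               additive_bundle_hom (und X) E E' f g},
      Dom = (\<lambda>(E, E', f, g). E), Cod = (\<lambda>(E, E', f, g). E'),
      Ide = (\<lambda>E. (E, E, Ide (und X) (tot E), Ide (und X) (base E))),
      Cmp = (\<lambda>(E', E'', f', g') (E, E1, f, g). (E, E'', Cmp (und X) f' f, Cmp (und X) g' g))\<rparr>"

text \<open>The base of a differential object may be any terminal object: no terminal object is singled out
  in the target of \<open>Eval\<close>, where the bases \<open>F *\<close> vary with \<open>F\<close>.\<close>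

definition DObj_add ::
  "('o, 'm) actegory \<Rightarrow>
   (('o, 'm) dbundle, ('o, 'm) dbundle \<times> ('o, 'm) dbundle \<times> 'm \<times> 'm) cat" where
  "DObj_add X = full_subcat (DBun_add X) {E. terminal (und X) (base E)}"

definition total_DBun ::
  "('o, 'm) actegory \<Rightarrow>
   (('o, 'm) dbundle, ('o, 'm) dbundle \<times> ('o, 'm) dbundle \<times> 'm \<times> 'm, 'o, 'm) ftor" where
  "total_DBun X = mk_ftor (DBun_add X) tot (\<lambda>(E, E', f, g). f)"

definition und_DObj ::
  "('o, 'm) actegory \<Rightarrow>
   (('o, 'm) dbundle, ('o, 'm) dbundle \<times> ('o, 'm) dbundle \<times> 'm \<times> 'm, 'o, 'm) ftor" where
  "und_DObj X = mk_ftor (DObj_add X) tot (\<lambda>(E, E', f, g). f)"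


section \<open>Differential functors\<close>

text \<open>A pair \<open>(F, \<alpha>)\<close> with \<open>\<alpha> (A, x) : F (T\<^bsub>A\<^esub> x) \<rightarrow> T'\<^bsub>A\<^esub> (F x)\<close>.\<close>

type_synonym ('o, 'm, 'p, 'q) dfun =
  "('o, 'm, 'p, 'q) ftor \<times> (weil_obj \<times> 'o \<Rightarrow> 'q)"

definition oplax_linear ::
  "('o, 'm) actegory \<Rightarrow> ('p, 'q) actegory \<Rightarrow> ('o, 'm, 'p, 'q) dfun \<Rightarrow> bool" where
  "oplax_linear X X' = (\<lambda>(F, \<alpha>).
     let C = und X; C' = und X'; WC = cat_prod Weil C; I = mk_ftor Weil (\<lambda>A. A) (\<lambda>\<theta>. \<theta>) in
       is_functor C C' F \<and>
       nat_trans WC C' (ftor_comp WC F (act X)) (ftor_comp WC (act X') (ftor_prod Weil C I F)) \<alpha> \<and>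
       (\<forall>A\<in>Obj Weil. \<forall>B\<in>Obj Weil. \<forall>x\<in>Obj C.
          Cmp C' (\<alpha> (tensor_obj A B, x)) (farr F (act_mult X A B x)) =
          Cmp C' (act_mult X' A B (fobj F x))
            (Cmp C' (Tarr X' A (\<alpha> (B, x))) (\<alpha> (A, Tobj X B x)))) \<and>
       (\<forall>x\<in>Obj C. Cmp C' (\<alpha> (N_obj, x)) (farr F (act_unit X x)) = act_unit X' (fobj F x)))"

definition lax_differential ::
  "('o, 'm) actegory \<Rightarrow> 'o \<Rightarrow> ('p, 'q) actegory \<Rightarrow> ('o, 'm, 'p, 'q) dfun \<Rightarrow> bool" where
  "lax_differential X star X' = (\<lambda>(F, \<alpha>).
     oplax_linear X X' (F, \<alpha>) \<and>
     (\<forall>A\<in>Obj Weil. \<forall>P r s f g.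
        is_pullback (und X) P r s f g \<and> Cod (und X) f = star \<longrightarrow>
        is_pullback (und X') (Tobj X' A (fobj F P))
          (Tarr X' A (farr F r)) (Tarr X' A (farr F s))
          (Tarr X' A (farr F f)) (Tarr X' A (farr F g))) \<and>
     (\<forall>A\<in>Obj Weil. \<forall>x y f. f \<in> hom (und X) x y \<longrightarrow>
        is_pullback (und X') (fobj F (Tobj X A x))
          (\<alpha> (A, x)) (farr F (Tarr X A f))
          (Tarr X' A (farr F f)) (\<alpha> (A, y))))"

definition strong_differential ::
  "('o, 'm) actegory \<Rightarrow> 'o \<Rightarrow> ('p, 'q) actegory \<Rightarrow> ('o, 'm, 'p, 'q) dfun \<Rightarrow> bool" where
  "strong_differential X star X' = (\<lambda>(F, \<alpha>).
     lax_differential X star X' (F, \<alpha>) \<and> terminal (und X') (fobj F star))"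

type_synonym ('o, 'm, 'p, 'q) dfun_cat =
  "(('o, 'm, 'p, 'q) dfun,
    ('o, 'm, 'p, 'q) dfun \<times> ('o, 'm, 'p, 'q) dfun \<times> ('o \<Rightarrow> 'q)) cat"

definition DiffFun ::
  "('o, 'm) actegory \<Rightarrow> 'o \<Rightarrow> ('p, 'q) actegory \<Rightarrow> ('o, 'm, 'p, 'q) dfun_cat" where
  "DiffFun X star X' =
     \<lparr>Obj = {\<FF>. lax_differential X star X' \<FF>},
      Arr = {(\<FF>, \<GG>, \<phi>). lax_differential X star X' \<FF> \<and> lax_differential X star X' \<GG> \<and>
               nat_trans (und X) (und X') (fst \<FF>) (fst \<GG>) \<phi>},
      Dom = (\<lambda>(\<FF>, \<GG>, \<phi>). \<FF>), Cod = (\<lambda>(\<FF>, \<GG>, \<phi>). \<GG>),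
      Ide = (\<lambda>\<FF>. (\<FF>, \<FF>, \<lambda>x\<in>Obj (und X). Ide (und X') (fobj (fst \<FF>) x))),
      Cmp = (\<lambda>(\<GG>', \<HH>, \<psi>) (\<FF>, \<GG>, \<phi>). (\<FF>, \<HH>, \<lambda>x\<in>Obj (und X). Cmp (und X') (\<psi> x) (\<phi> x)))\<rparr>"

definition linear_trans ::
  "('o, 'm) actegory \<Rightarrow> ('p, 'q) actegory \<Rightarrow>
   ('o, 'm, 'p, 'q) dfun \<times> ('o, 'm, 'p, 'q) dfun \<times> ('o \<Rightarrow> 'q) \<Rightarrow> bool" where
  "linear_trans X X' = (\<lambda>((F, \<alpha>), (G, \<beta>), \<phi>).
     \<forall>A\<in>Obj Weil. \<forall>x\<in>Obj (und X).
       Cmp (und X') (\<beta> (A, x)) (\<phi> (Tobj X A x)) = Cmp (und X') (Tarr X' A (\<phi> x)) (\<alpha> (A, x)))"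

definition DiffFun_lin ::
  "('o, 'm) actegory \<Rightarrow> 'o \<Rightarrow> ('p, 'q) actegory \<Rightarrow> ('o, 'm, 'p, 'q) dfun_cat" where
  "DiffFun_lin X star X' =
     (DiffFun X star X')\<lparr>Arr := {t \<in> Arr (DiffFun X star X'). linear_trans X X' t}\<rparr>"

definition DiffFun_strong ::
  "('o, 'm) actegory \<Rightarrow> 'o \<Rightarrow> ('p, 'q) actegory \<Rightarrow> ('o, 'm, 'p, 'q) dfun_cat" where
  "DiffFun_strong X star X' =
     full_subcat (DiffFun X star X') {\<FF>. strong_differential X star X' \<FF>}"

definition DiffFun_strong_lin ::
  "('o, 'm) actegory \<Rightarrow> 'o \<Rightarrow> ('p, 'q) actegory \<Rightarrow> ('o, 'm, 'p, 'q) dfun_cat" where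
  "DiffFun_strong_lin X star X' =
     full_subcat (DiffFun_lin X star X') {\<FF>. strong_differential X star X' \<FF>}"

text \<open>The forgetful functor from a category \<open>D\<close> of differential functors.\<close>

definition und_DiffFun ::
  "('o, 'm, 'p, 'q) dfun_cat \<Rightarrow>
   (('o, 'm, 'p, 'q) dfun,
    ('o, 'm, 'p, 'q) dfun \<times> ('o, 'm, 'p, 'q) dfun \<times> ('o \<Rightarrow> 'q),
    ('o, 'm, 'p, 'q) ftor,
    ('o, 'm, 'p, 'q) ftor \<times> ('o, 'm, 'p, 'q) ftor \<times> ('o \<Rightarrow> 'q)) ftor" where
  "und_DiffFun D = mk_ftor D fst (\<lambda>(\<FF>, \<GG>, \<phi>). (fst \<FF>, fst \<GG>, \<phi>))"


section \<open>The evaluation functor\<close>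

definition Eval_obj ::
  "('p, 'q) actegory \<Rightarrow> ('o, 'm) dbundle \<times> ('o, 'm, 'p, 'q) dfun \<Rightarrow> ('p, 'q) dbundle" where
  "Eval_obj X' = (\<lambda>(E, (F, \<alpha>)).
     \<lparr>tot = fobj F (tot E), base = fobj F (base E), proj = farr F (proj E),
      tot2 = fobj F (tot2 E), pr0 = farr F (pr0 E), pr1 = farr F (pr1 E),
      bplus = farr F (bplus E), bzero = farr F (bzero E),
      lift = Cmp (und X') (\<alpha> (W, tot E)) (farr F (lift E))\<rparr>)"

text \<open>For differential objects over the same terminal object \<open>*\<close> one has \<open>g = 1\<^sub>*\<close>, and the second
  component is just \<open>\<phi>\<^sub>*\<close>.\<close>

definition Eval_arr ::
  "('p, 'q) actegory \<Rightarrow>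
   (('o, 'm) dbundle \<times> ('o, 'm) dbundle \<times> 'm \<times> 'm) \<times>
   (('o, 'm, 'p, 'q) dfun \<times> ('o, 'm, 'p, 'q) dfun \<times> ('o \<Rightarrow> 'q)) \<Rightarrow>
   ('p, 'q) dbundle \<times> ('p, 'q) dbundle \<times> 'q \<times> 'q" where
  "Eval_arr X' = (\<lambda>((E, E', f, g), (\<FF>, \<GG>, \<phi>)).
     (Eval_obj X' (E, \<FF>), Eval_obj X' (E', \<GG>),
      Cmp (und X') (\<phi> (tot E')) (farr (fst \<FF>) f),
      Cmp (und X') (\<phi> (base E')) (farr (fst \<FF>) g)))"

definition Eval ::
  "('o, 'm) actegory \<Rightarrow> ('p, 'q) actegory \<Rightarrow> ('o, 'm, 'p, 'q) dfun_cat \<Rightarrow>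
   (('o, 'm) dbundle \<times> ('o, 'm, 'p, 'q) dfun,
    (('o, 'm) dbundle \<times> ('o, 'm) dbundle \<times> 'm \<times> 'm) \<times>
    (('o, 'm, 'p, 'q) dfun \<times> ('o, 'm, 'p, 'q) dfun \<times> ('o \<Rightarrow> 'q)),
    ('p, 'q) dbundle,
    ('p, 'q) dbundle \<times> ('p, 'q) dbundle \<times> 'q \<times> 'q) ftor" where
  "Eval X X' D = mk_ftor (cat_prod (DObj_add X) D) (Eval_obj X') (Eval_arr X')"

end

theory Submission
  imports Defs
begin

text \<open>Let \<open>E\<close> be a differential object over a terminal object \<open>b\<close> and \<open>(F, \<alpha>)\<close> a lax differential
  functor. Everything in the definition of a differential bundle is either a diagram of pullbacks or
  an equation, and \<open>F\<close> can transport both, for the following reasons.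

  \<^item> Limits. The pullback powers of \<open>q : E \<rightarrow> b\<close> are iterated pullbacks over a terminal object. The
    functors \<open>T'\<^bsub>A\<^esub> F\<close> preserve these by definition for one terminal object, hence for all, and \<open>T'\<^sup>k F\<close> is isomorphic to the one with
    \<open>A = W \<otimes> \<dots> \<otimes> W\<close> (\<open>preserves_pullbacks_over_T_pow\<close>); so the powers of \<open>F q\<close> exist, are the
    images of those of \<open>q\<close>, and are preserved by \<open>T'\<^sup>k\<close> (\<open>preserves_powers\<close>, \<open>T_pow_FE\<close>).

  \<^item> Additive structure. Its laws hold on the universal tuples of generalised elements, since they
    are images under \<open>F\<close> of laws of \<open>E\<close>, and hence on all tuples (\<open>additive_FE\<close>).

  \<^item> The lift \<open>\<alpha> \<circ> F \<lambda>\<close>. Naturality of \<open>\<alpha>\<close> in the Weil algebra, together with its compatibility with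
    unit and multiplication, carries \<open>F 0\<close>, \<open>F p\<close>, \<open>F +\<close> and \<open>F \<ell>\<close> to the corresponding structure
    maps of \<open>T'\<close> (\<open>\<alpha>_0\<close>, \<open>\<alpha>_p\<close>, \<open>\<alpha>_Tnat\<close>, \<open>\<alpha>_l\<close>). The equations for the lift of \<open>E\<close> therefore
    become those for the lift of \<open>F E\<close>. The additions are defined on \<open>T\<^bsub>W\<^sup>2\<^esub>\<close>, which is a fibre
    product of two copies of \<open>T\<close> because \<open>W\<^sup>2\<close> is the product \<open>W \<times> W\<close> in \<open>Weil\<close>
    (\<open>product_W_W\<close>).

  \<^item> Universality. The square for \<open>E\<close> is a pullback over \<open>T b\<close>. This object is terminal, so \<open>F\<close>
    preserves the square; pasting it with the naturality square of \<open>\<alpha>\<^bsub>W\<^esub>\<close> at \<open>q\<close>, a pullback by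
    definition of a differential functor, gives the square for \<open>F E\<close> (\<open>universality_FE\<close>).

  On morphisms, naturality of \<open>\<phi>\<close> at the structure maps of a differential object makes \<open>\<phi> \<circ> F f\<close>
  additive (\<open>Eval_arr_additive\<close>), and functoriality is the interchange law. If \<open>F\<close> is strong, the
  base \<open>F b\<close> is isomorphic to the terminal object \<open>F *\<close>. Both diagrams commute by definition once
  \<open>Eval\<close> is known to land in the stated categories.\<close>

section \<open>Categories, pullbacks and functors\<close>

context category
begin

lemma Ide_arr [simp]:
  assumes "a \<in> Obj C"
  shows "Ide C a \<in> Arr C" "Dom C (Ide C a) = a" "Cod C (Ide C a) = a"
  using Ide_in[OF assms] by (auto simp: hom_def)

lemma Cmp_arr [simp]:
  assumes "f \<in> Arr C" "g \<in> Arr C" "Dom C g = Cod C f"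
  shows "Cmp C g f \<in> Arr C" "Dom C (Cmp C g f) = Dom C f" "Cod C (Cmp C g f) = Cod C g"
  using Cmp_in[of f "Dom C f" "Cod C f" g "Cod C g"] assms by (auto simp: hom_def)

lemma Cmp_Ide_right [simp]: "f \<in> Arr C \<Longrightarrow> Dom C f = a \<Longrightarrow> Cmp C f (Ide C a) = f"
  using Cmp_Ide[of f a "Cod C f"] by (auto simp: hom_def)

lemma Cmp_Ide_left [simp]: "f \<in> Arr C \<Longrightarrow> Cod C f = a \<Longrightarrow> Cmp C (Ide C a) f = f"
  using Ide_Cmp[of f "Dom C f" a] by (auto simp: hom_def)

lemma assoc [simp]:
  assumes "f \<in> Arr C" "g \<in> Arr C" "h \<in> Arr C" "Dom C g = Cod C f" "Dom C h = Cod C g"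
  shows "Cmp C (Cmp C h g) f = Cmp C h (Cmp C g f)"
  using Cmp_assoc[of f "Dom C f" "Cod C f" g "Cod C g" h "Cod C h"] assms by (auto simp: hom_def)

lemma Dom_Cod_obj [simp]: "f \<in> Arr C \<Longrightarrow> Dom C f \<in> Obj C" "f \<in> Arr C \<Longrightarrow> Cod C f \<in> Obj C"
  by (auto intro: Dom_in Cod_in)

text \<open>Composites are kept bracketed to the right, so an equation between two composites is
  used inside a longer one in this form.\<close>

lemma Cmp_cong_right:
  assumes "Cmp C g f = Cmp C g' f'"
    and "f \<in> Arr C" "g \<in> Arr C" "Dom C g = Cod C f" "f' \<in> Arr C" "g' \<in> Arr C" "Dom C g' = Cod C f'"
    and "x \<in> Arr C" "Cod C x = Dom C f"
  shows "Cmp C g (Cmp C f x) = Cmp C g' (Cmp C f' x)"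
proof -
  have "Dom C f' = Dom C f" using Cmp_arr(2) assms by metis
  then have "Cmp C g' (Cmp C f' x) = Cmp C (Cmp C g' f') x"
    using assms by simp
  also have "\<dots> = Cmp C g (Cmp C f x)" using assms by (simp flip: assms(1))
  finally show ?thesis by simp
qed

lemma Cmp_cong_right1:
  assumes "Cmp C g f = k"
    and "f \<in> Arr C" "g \<in> Arr C" "Dom C g = Cod C f" "x \<in> Arr C" "Cod C x = Dom C f"
  shows "Cmp C g (Cmp C f x) = Cmp C k x"
  using assms by auto

lemma inverse_arrowsD:
  assumes "inverse_arrows C f g"
  shows "f \<in> Arr C" "g \<in> Arr C" "Dom C g = Cod C f" "Cod C g = Dom C f"
    "Cmp C g f = Ide C (Dom C f)" "Cmp C f g = Ide C (Cod C f)"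
  using assms by (auto simp: inverse_arrows_def hom_def)

lemma inverse_arrowsD_right:
  assumes "inverse_arrows C f g"
  shows "x \<in> Arr C \<Longrightarrow> Cod C x = Dom C f \<Longrightarrow> Cmp C g (Cmp C f x) = x"
    and "x \<in> Arr C \<Longrightarrow> Cod C x = Cod C f \<Longrightarrow> Cmp C f (Cmp C g x) = x"
  using inverse_arrowsD[OF assms] by (metis Cmp_Ide_left assoc)+

lemma iso_cancel:
  assumes "inverse_arrows C f g" "Cmp C f x = Cmp C f y"
    and "x \<in> Arr C" "y \<in> Arr C" "Cod C x = Dom C f" "Cod C y = Dom C f"
  shows "x = y"
  using inverse_arrowsD_right(1)[OF assms(1)] assms by metis

lemma inv_arr:
  assumes "is_iso C f"
  shows "inverse_arrows C f (inv_arr C f)"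
proof -
  obtain g where g: "inverse_arrows C f g" using assms by (auto simp: is_iso_def)
  have "h = g" if h: "inverse_arrows C f h" for h
    using inverse_arrowsD_right(1)[OF h, of g] inverse_arrowsD[OF g] inverse_arrowsD[OF h] by auto
  with g have "\<exists>!g. inverse_arrows C f g" by blast
  then show ?thesis unfolding inv_arr_def by (rule theI')
qed

lemma terminal_arrow:
  assumes "terminal C t" "a \<in> Obj C"
  obtains f where "f \<in> Arr C" "Dom C f = a" "Cod C f = t"
  using assms by (auto simp: terminal_def hom_def)

lemma terminal_arrow_unique:
  assumes "terminal C t" "f \<in> Arr C" "g \<in> Arr C" "Dom C f = Dom C g" "Cod C f = t" "Cod C g = t"
  shows "f = g"
proof -
  have "\<exists>!h. h \<in> hom C (Dom C f) t" using assms by (auto simp: terminal_def)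
  moreover have "f \<in> hom C (Dom C f) t" "g \<in> hom C (Dom C f) t" using assms by (auto simp: hom_def)
  ultimately show ?thesis by blast
qed

lemma terminal_arrow_iso:
  assumes "terminal C s" "terminal C t" "f \<in> Arr C" "Dom C f = s" "Cod C f = t"
  shows "is_iso C f"
proof -
  obtain g where g: "g \<in> Arr C" "Dom C g = t" "Cod C g = s"
    using assms by (metis terminal_arrow Dom_Cod_obj(2))
  have "Cmp C g f = Ide C s" "Cmp C f g = Ide C t"
    using terminal_arrow_unique[OF assms(1), of "Cmp C g f" "Ide C s"]
      terminal_arrow_unique[OF assms(2), of "Cmp C f g" "Ide C t"] assms g
    by (auto simp: terminal_def)
  then show ?thesis using g assms unfolding is_iso_def inverse_arrows_def by (auto simp: hom_def)
qed

lemma terminal_if_iso: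
  assumes t: "terminal C t" and i: "inverse_arrows C i j" and "Cod C i = t"
  shows "terminal C (Dom C i)"
  unfolding terminal_def
proof (intro conjI ballI)
  note i' = inverse_arrowsD[OF i] inverse_arrowsD_right[OF i]
  show "Dom C i \<in> Obj C" using i' by auto
  fix a assume a: "a \<in> Obj C"
  obtain f where f: "f \<in> Arr C" "Dom C f = a" "Cod C f = t" using terminal_arrow[OF t a] .
  show "\<exists>!f. f \<in> hom C a (Dom C i)"
  proof
    show "Cmp C j f \<in> hom C a (Dom C i)" using f i' assms(3) by (auto simp: hom_def)
    fix g assume g: "g \<in> hom C a (Dom C i)"
    then have "Cmp C i g = f"
      using f i' assms(3) terminal_arrow_unique[OF t, of "Cmp C i g" f] by (simp add: hom_def)
    then show "g = Cmp C j f" using g i' by (auto simp: hom_def)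
  qed
qed


subsection \<open>Pullbacks\<close>

lemma pullbackD:
  assumes "is_pullback C p r s f g"
  shows "f \<in> Arr C" "g \<in> Arr C" "Cod C g = Cod C f" "r \<in> Arr C" "s \<in> Arr C"
    "Dom C r = p" "Dom C s = p" "Cod C r = Dom C f" "Cod C s = Dom C g" "Cmp C f r = Cmp C g s"
  using assms by (auto simp: is_pullback_def hom_def)

lemma pullback_exists:
  assumes "is_pullback C p r s f g" "u \<in> Arr C" "v \<in> Arr C" "Dom C v = Dom C u"
    "Cod C u = Dom C f" "Cod C v = Dom C g" "Cmp C f u = Cmp C g v"
  obtains h where "h \<in> Arr C" "Dom C h = Dom C u" "Cod C h = p" "Cmp C r h = u" "Cmp C s h = v"
proof -
  have "u \<in> hom C (Dom C u) (Dom C f) \<and> v \<in> hom C (Dom C u) (Dom C g) \<and> Cmp C f u = Cmp C g v"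
    using assms by (auto simp: hom_def)
  then have "\<exists>!h. h \<in> hom C (Dom C u) p \<and> Cmp C r h = u \<and> Cmp C s h = v"
    using assms(1) by (simp add: is_pullback_def)
  then show ?thesis using that by (auto simp: hom_def)
qed

lemma pullback_unique:
  assumes P: "is_pullback C p r s f g" and "h \<in> Arr C" "k \<in> Arr C" "Dom C h = Dom C k"
    "Cod C h = p" "Cod C k = p" "Cmp C r h = Cmp C r k" "Cmp C s h = Cmp C s k"
  shows "h = k"
proof -
  note P' = pullbackD[OF P]
  let ?u = "Cmp C r h" and ?v = "Cmp C s h"
  have "Cmp C f ?u = Cmp C g ?v" by (rule Cmp_cong_right) (auto simp: P' assms)
  then have "?u \<in> hom C (Dom C h) (Dom C f) \<and> ?v \<in> hom C (Dom C h) (Dom C g) \<and> Cmp C f ?u = Cmp C g ?v"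
    using P' assms by (auto simp: hom_def)
  then have "\<exists>!h'. h' \<in> hom C (Dom C h) p \<and> Cmp C r h' = ?u \<and> Cmp C s h' = ?v"
    using P by (auto simp: is_pullback_def)
  moreover have "h \<in> hom C (Dom C h) p" "k \<in> hom C (Dom C h) p" using assms by (auto simp: hom_def)
  ultimately show ?thesis using assms by metis
qed

text \<open>The universal property is easier to verify as existence together with joint monicity of the
  projections: the uniqueness part then needs no reference to the cone.\<close>

lemma pullbackI:
  assumes "f \<in> Arr C" "g \<in> Arr C" "Cod C g = Cod C f" "r \<in> Arr C" "s \<in> Arr C"
    "Dom C r = p" "Dom C s = p" "Cod C r = Dom C f" "Cod C s = Dom C g" "Cmp C f r = Cmp C g s"
    and ex: "\<And>u v. u \<in> Arr C \<Longrightarrow> v \<in> Arr C \<Longrightarrow> Dom C v = Dom C u \<Longrightarrow> Cod C u = Dom C f \<Longrightarrow>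
      Cod C v = Dom C g \<Longrightarrow> Cmp C f u = Cmp C g v \<Longrightarrow>
      \<exists>h\<in>Arr C. Dom C h = Dom C u \<and> Cod C h = p \<and> Cmp C r h = u \<and> Cmp C s h = v"
    and un: "\<And>h k. h \<in> Arr C \<Longrightarrow> k \<in> Arr C \<Longrightarrow> Dom C h = Dom C k \<Longrightarrow> Cod C h = p \<Longrightarrow>
      Cod C k = p \<Longrightarrow> Cmp C r h = Cmp C r k \<Longrightarrow> Cmp C s h = Cmp C s k \<Longrightarrow> h = k"
  shows "is_pullback C p r s f g"
proof -
  have "\<exists>!h. h \<in> hom C z p \<and> Cmp C r h = u \<and> Cmp C s h = v"
    if "u \<in> hom C z (Dom C f) \<and> v \<in> hom C z (Dom C g) \<and> Cmp C f u = Cmp C g v" for z u v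
  proof -
    have "\<exists>h\<in>Arr C. Dom C h = Dom C u \<and> Cod C h = p \<and> Cmp C r h = u \<and> Cmp C s h = v"
      using that by (intro ex) (auto simp: hom_def)
    then have "\<exists>h. h \<in> hom C z p \<and> Cmp C r h = u \<and> Cmp C s h = v"
      using that by (auto simp: hom_def)
    then obtain h where h: "h \<in> hom C z p \<and> Cmp C r h = u \<and> Cmp C s h = v" ..
    moreover have "k = h" if "k \<in> hom C z p \<and> Cmp C r k = u \<and> Cmp C s k = v" for k
      using that h un[of k h] by (auto simp: hom_def)
    ultimately show ?thesis by blast
  qed
  then show ?thesis using assms(1-10) unfolding is_pullback_def by (auto simp: hom_def)
qed

text \<open>Pasting along the common edge \<open>f\<close>, which is the first leg of the cospan of the first square and
  the second projection of the second.\<close>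

lemma pullback_paste:
  assumes P: "is_pullback C p r s f g" and Q: "is_pullback C q t f k l"
  shows "is_pullback C p (Cmp C t r) s k (Cmp C l g)"
proof (rule pullbackI)
  note PD = pullbackD[OF P] and QD = pullbackD[OF Q]
  have q: "Dom C f = q" using QD by simp
  show "k \<in> Arr C" "Cmp C l g \<in> Arr C" "Cod C (Cmp C l g) = Cod C k" "Cmp C t r \<in> Arr C"
    "s \<in> Arr C" "Dom C (Cmp C t r) = p" "Dom C s = p" "Cod C (Cmp C t r) = Dom C k"
    "Cod C s = Dom C (Cmp C l g)"
    by (auto simp: PD QD q)
  have kt: "Cmp C k (Cmp C t r) = Cmp C l (Cmp C f r)"
    by (rule Cmp_cong_right) (auto simp: PD QD q)
  then show "Cmp C k (Cmp C t r) = Cmp C (Cmp C l g) s" by (auto simp: PD QD q)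
  show "\<exists>h\<in>Arr C. Dom C h = Dom C u \<and> Cod C h = p \<and> Cmp C (Cmp C t r) h = u \<and> Cmp C s h = v"
    if uv: "u \<in> Arr C" "v \<in> Arr C" "Dom C v = Dom C u" "Cod C u = Dom C k"
      "Cod C v = Dom C (Cmp C l g)" "Cmp C k u = Cmp C (Cmp C l g) v" for u v
  proof -
    have v: "Cod C v = Dom C g" using uv PD QD by simp
    have e: "Cmp C k u = Cmp C l (Cmp C g v)" by (auto simp: uv v PD QD)
    obtain w where w: "w \<in> Arr C" "Dom C w = Dom C u" "Cod C w = q" "Cmp C t w = u"
      "Cmp C f w = Cmp C g v"
      by (rule pullback_exists[OF Q, of u "Cmp C g v"]) (auto simp: e uv v PD QD)
    obtain h where "h \<in> Arr C" "Dom C h = Dom C u" "Cod C h = p" "Cmp C r h = w" "Cmp C s h = v"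
      by (rule pullback_exists[OF P, of w v]) (auto simp: w uv v PD QD q)
    then show ?thesis by (intro bexI[of _ h]) (auto simp: w PD QD)
  qed
  show "h = h'"
    if h: "h \<in> Arr C" "h' \<in> Arr C" "Dom C h = Dom C h'" "Cod C h = p" "Cod C h' = p"
      "Cmp C (Cmp C t r) h = Cmp C (Cmp C t r) h'" "Cmp C s h = Cmp C s h'" for h h'
  proof (rule pullback_unique[OF P])
    have *: "Cmp C f (Cmp C r x) = Cmp C g (Cmp C s x)" if "x \<in> Arr C" "Cod C x = p" for x
      by (rule Cmp_cong_right) (auto simp: PD that)
    have t: "Cmp C t (Cmp C r h) = Cmp C t (Cmp C r h')"
      using h(6) by (simp add: h(1-5) PD QD q)
    show "Cmp C r h = Cmp C r h'"
      by (rule pullback_unique[OF Q]) (auto simp: t h(1-5,7) PD QD q *)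
  qed (auto simp: h)
qed

text \<open>Being a pullback is invariant under isomorphism of squares; this transports pullbacks along
  natural isomorphisms of functors.\<close>

lemma pullback_iso:
  assumes P: "is_pullback C p r s f g"
    and i: "inverse_arrows C i i'" "inverse_arrows C x x'" "inverse_arrows C y y'" "inverse_arrows C c c'"
    and ty: "r' \<in> Arr C" "s' \<in> Arr C" "f' \<in> Arr C" "g' \<in> Arr C"
      "Dom C r' = Dom C i" "Dom C s' = Dom C i" "Cod C r' = Dom C x" "Cod C s' = Dom C y"
      "Dom C f' = Dom C x" "Dom C g' = Dom C y" "Cod C f' = Dom C c" "Cod C g' = Dom C c"
    and co: "Cod C i = p" "Cod C x = Dom C f" "Cod C y = Dom C g" "Cod C c = Cod C f"
    and sq: "Cmp C x r' = Cmp C r i" "Cmp C y s' = Cmp C s i"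
      "Cmp C c f' = Cmp C f x" "Cmp C c g' = Cmp C g y"
  shows "is_pullback C (Dom C i) r' s' f' g'"
proof (rule pullbackI)
  note PD = pullbackD[OF P]
  note ID = inverse_arrowsD[OF i(1)] inverse_arrowsD[OF i(2)] inverse_arrowsD[OF i(3)] inverse_arrowsD[OF i(4)]
  note IR = inverse_arrowsD_right[OF i(1)] inverse_arrowsD_right[OF i(2)]
    inverse_arrowsD_right[OF i(3)] inverse_arrowsD_right[OF i(4)]
  have rs: "Cmp C f (Cmp C r z) = Cmp C g (Cmp C s z)" if "z \<in> Arr C" "Cod C z = p" for z
    by (rule Cmp_cong_right) (auto simp: PD that)
  have xr: "Cmp C x (Cmp C r' z) = Cmp C r (Cmp C i z)" if "z \<in> Arr C" "Cod C z = Dom C i" for z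
    by (rule Cmp_cong_right) (auto simp: PD ID ty co sq that)
  have ys: "Cmp C y (Cmp C s' z) = Cmp C s (Cmp C i z)" if "z \<in> Arr C" "Cod C z = Dom C i" for z
    by (rule Cmp_cong_right) (auto simp: PD ID ty co sq that)
  have cf: "Cmp C c (Cmp C f' z) = Cmp C f (Cmp C x z)" if "z \<in> Arr C" "Cod C z = Dom C x" for z
    by (rule Cmp_cong_right) (auto simp: PD ID ty co sq that)
  have cg: "Cmp C c (Cmp C g' z) = Cmp C g (Cmp C y z)" if "z \<in> Arr C" "Cod C z = Dom C y" for z
    by (rule Cmp_cong_right) (auto simp: PD ID ty co sq that)
  show "f' \<in> Arr C" "g' \<in> Arr C" "Cod C g' = Cod C f'" "r' \<in> Arr C" "s' \<in> Arr C"
    "Dom C r' = Dom C i" "Dom C s' = Dom C i" "Cod C r' = Dom C f'" "Cod C s' = Dom C g'"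
    by (auto simp: ty)
  have "Cmp C c (Cmp C f' r') = Cmp C c (Cmp C g' s')"
    by (auto simp: PD ID ty co sq rs cf cg)
  then show "Cmp C f' r' = Cmp C g' s'" by (rule iso_cancel[OF i(4)]) (auto simp: ty)
  show "\<exists>h\<in>Arr C. Dom C h = Dom C u \<and> Cod C h = Dom C i \<and> Cmp C r' h = u \<and> Cmp C s' h = v"
    if uv: "u \<in> Arr C" "v \<in> Arr C" "Dom C v = Dom C u" "Cod C u = Dom C f'"
      "Cod C v = Dom C g'" "Cmp C f' u = Cmp C g' v" for u v
  proof -
    have "Cmp C c (Cmp C f' u) = Cmp C c (Cmp C g' v)" using uv by simp
    then have e: "Cmp C f (Cmp C x u) = Cmp C g (Cmp C y v)" by (simp add: cf cg uv(1-5) ty)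
    obtain h where h: "h \<in> Arr C" "Dom C h = Dom C u" "Cod C h = p" "Cmp C r h = Cmp C x u"
      "Cmp C s h = Cmp C y v"
      by (rule pullback_exists[OF P, of "Cmp C x u" "Cmp C y v"]) (auto simp: e uv PD ID ty co)
    let ?h = "Cmp C i' h"
    have "Cmp C x (Cmp C r' ?h) = Cmp C x u" by (auto simp: h xr[of ?h] IR(2)[of h] ID co)
    then have 1: "Cmp C r' ?h = u"
      by (rule iso_cancel[OF i(2)]) (auto simp: h uv ID ty co)
    have "Cmp C y (Cmp C s' ?h) = Cmp C y v" by (auto simp: h ys[of ?h] IR(2)[of h] ID co)
    then have 2: "Cmp C s' ?h = v"
      by (rule iso_cancel[OF i(3)]) (auto simp: h uv ID ty co)
    show ?thesis by (intro bexI[of _ ?h]) (auto simp: 1 2 h ID co)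
  qed
  show "h = k"
    if h: "h \<in> Arr C" "k \<in> Arr C" "Dom C h = Dom C k" "Cod C h = Dom C i" "Cod C k = Dom C i"
      "Cmp C r' h = Cmp C r' k" "Cmp C s' h = Cmp C s' k" for h k
  proof -
    have rs': "Cmp C r (Cmp C i h) = Cmp C r (Cmp C i k)" "Cmp C s (Cmp C i h) = Cmp C s (Cmp C i k)"
      using xr[of h] xr[of k] ys[of h] ys[of k] h by metis+
    have "Cmp C i h = Cmp C i k"
      by (rule pullback_unique[OF P]) (simp_all add: rs' h(1-5) ID co)
    then show ?thesis by (rule iso_cancel[OF i(1)]) (auto simp: h)
  qed
qed

text \<open>Isomorphisms are monic, so changing the common codomain of a cospan along one does not affect
  which cones commute. This allows one terminal base to be exchanged for another.\<close>

lemma pullback_cospan_iso: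
  assumes t: "inverse_arrows C t t'" and f: "f \<in> Arr C" "g \<in> Arr C" "Cod C f = Dom C t" "Cod C g = Dom C t"
  shows "is_pullback C p r s (Cmp C t f) (Cmp C t g) \<longleftrightarrow> is_pullback C p r s f g"
proof -
  note T = inverse_arrowsD[OF t] inverse_arrowsD_right[OF t]
  have *: "Cmp C t (Cmp C f u) = Cmp C t (Cmp C g v) \<longleftrightarrow> Cmp C f u = Cmp C g v"
    if "u \<in> hom C z (Dom C f)" "v \<in> hom C z (Dom C g)" for u v z
    using that f T(7)[of "Cmp C f u"] T(7)[of "Cmp C g v"] by (metis (mono_tags, lifting) Cmp_arr(1,3) hom_def mem_Collect_eq)
  have 1: "Cmp C (Cmp C t f) u = Cmp C t (Cmp C f u)" if "u \<in> hom C z (Dom C f)" for u z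
    using that f T by (auto simp: hom_def)
  have 2: "Cmp C (Cmp C t g) u = Cmp C t (Cmp C g u)" if "u \<in> hom C z (Dom C g)" for u z
    using that f T by (auto simp: hom_def)
  have "Cmp C t f \<in> Arr C" "Cmp C t g \<in> Arr C" "Dom C (Cmp C t f) = Dom C f"
    "Dom C (Cmp C t g) = Dom C g" "Cod C (Cmp C t f) = Cod C (Cmp C t g)" "Cod C f = Cod C g"
    by (auto simp: f T)
  then show ?thesis unfolding is_pullback_def using f
    by (simp add: 1 2 * cong: conj_cong)
qed


subsection \<open>Pullback powers\<close>

lemma powerD:
  assumes "pullback_power C q n p b r"
  shows "q \<in> Arr C" "b \<in> Arr C" "Dom C b = p" "Cod C b = Cod C q"
    "i < n \<Longrightarrow> r i \<in> Arr C" "i < n \<Longrightarrow> Dom C (r i) = p" "i < n \<Longrightarrow> Cod C (r i) = Dom C q"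
    "i < n \<Longrightarrow> Cmp C q (r i) = b"
  using assms by (auto simp: pullback_power_def hom_def)

lemma power_universal:
  assumes "pullback_power C q n p b r" "c \<in> hom C z (Cod C q)"
    "\<And>i. i < n \<Longrightarrow> u i \<in> hom C z (Dom C q) \<and> Cmp C q (u i) = c"
  shows "\<exists>!h. h \<in> hom C z p \<and> Cmp C b h = c \<and> (\<forall>i<n. Cmp C (r i) h = u i)"
  using assms by (simp add: pullback_power_def)

lemma power_exists:
  assumes "pullback_power C q n p b r" "c \<in> Arr C" "Cod C c = Cod C q"
    "\<And>i. i < n \<Longrightarrow> u i \<in> Arr C \<and> Dom C (u i) = Dom C c \<and> Cod C (u i) = Dom C q \<and> Cmp C q (u i) = c"
  obtains h where "h \<in> Arr C" "Dom C h = Dom C c" "Cod C h = p" "Cmp C b h = c"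
    "\<And>i. i < n \<Longrightarrow> Cmp C (r i) h = u i"
proof -
  have "\<exists>!h. h \<in> hom C (Dom C c) p \<and> Cmp C b h = c \<and> (\<forall>i<n. Cmp C (r i) h = u i)"
    by (rule power_universal[OF assms(1)]) (simp_all add: hom_def assms)
  then show ?thesis using that by (auto simp: hom_def)
qed

lemma power_unique:
  assumes P: "pullback_power C q n p b r" and "h \<in> Arr C" "k \<in> Arr C" "Dom C h = Dom C k"
    "Cod C h = p" "Cod C k = p" "Cmp C b h = Cmp C b k" "\<And>i. i < n \<Longrightarrow> Cmp C (r i) h = Cmp C (r i) k"
  shows "h = k"
proof -
  note P' = powerD[OF P]
  let ?c = "Cmp C b h" and ?u = "\<lambda>i. Cmp C (r i) h"
  have "Cmp C q (?u i) = ?c" if "i < n" for i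
    by (rule Cmp_cong_right1) (auto simp: P' assms that)
  then have "\<exists>!h'. h' \<in> hom C (Dom C h) p \<and> Cmp C b h' = ?c \<and> (\<forall>i<n. Cmp C (r i) h' = ?u i)"
    using P' assms by (intro power_universal[OF P]) (simp_all add: hom_def)
  moreover have "h \<in> hom C (Dom C h) p" "k \<in> hom C (Dom C h) p" using assms by (auto simp: hom_def)
  ultimately show ?thesis using assms by metis
qed

lemma powerI:
  assumes "q \<in> Arr C" "b \<in> Arr C" "Dom C b = p" "Cod C b = Cod C q"
    "\<And>i. i < n \<Longrightarrow> r i \<in> Arr C \<and> Dom C (r i) = p \<and> Cod C (r i) = Dom C q \<and> Cmp C q (r i) = b"
    and ex: "\<And>c u. c \<in> Arr C \<Longrightarrow> Cod C c = Cod C q \<Longrightarrow>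
      (\<And>i. i < n \<Longrightarrow> u i \<in> Arr C \<and> Dom C (u i) = Dom C c \<and> Cod C (u i) = Dom C q \<and> Cmp C q (u i) = c) \<Longrightarrow>
      \<exists>h\<in>Arr C. Dom C h = Dom C c \<and> Cod C h = p \<and> Cmp C b h = c \<and> (\<forall>i<n. Cmp C (r i) h = u i)"
    and un: "\<And>h k. h \<in> Arr C \<Longrightarrow> k \<in> Arr C \<Longrightarrow> Dom C h = Dom C k \<Longrightarrow> Cod C h = p \<Longrightarrow>
      Cod C k = p \<Longrightarrow> Cmp C b h = Cmp C b k \<Longrightarrow> (\<And>i. i < n \<Longrightarrow> Cmp C (r i) h = Cmp C (r i) k) \<Longrightarrow> h = k"
  shows "pullback_power C q n p b r"
proof -
  have "\<exists>!h. h \<in> hom C z p \<and> Cmp C b h = c \<and> (\<forall>i<n. Cmp C (r i) h = u i)"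
    if "c \<in> hom C z (Cod C q) \<and> (\<forall>i<n. u i \<in> hom C z (Dom C q) \<and> Cmp C q (u i) = c)" for z c u
  proof -
    have "\<exists>h\<in>Arr C. Dom C h = Dom C c \<and> Cod C h = p \<and> Cmp C b h = c \<and> (\<forall>i<n. Cmp C (r i) h = u i)"
      using that by (intro ex) (auto simp: hom_def)
    then have "\<exists>h. h \<in> hom C z p \<and> Cmp C b h = c \<and> (\<forall>i<n. Cmp C (r i) h = u i)"
      using that by (auto simp: hom_def)
    then obtain h where h: "h \<in> hom C z p \<and> Cmp C b h = c \<and> (\<forall>i<n. Cmp C (r i) h = u i)" ..
    moreover have "k = h" if "k \<in> hom C z p \<and> Cmp C b k = c \<and> (\<forall>i<n. Cmp C (r i) k = u i)" for k
      using that h by (simp add: hom_def un)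
    ultimately show ?thesis by blast
  qed
  then show ?thesis using assms(1-5) unfolding pullback_power_def by (auto simp: hom_def)
qed

lemma power_iso:
  assumes P: "pullback_power C q n p b r" and i: "inverse_arrows C i j" "Cod C i = p"
    and b': "b' = Cmp C b i" and r': "\<And>k. k < n \<Longrightarrow> r' k = Cmp C (r k) i"
  shows "pullback_power C q n (Dom C i) b' r'"
proof (rule powerI)
  note PD = powerD[OF P] and I = inverse_arrowsD[OF i(1)] inverse_arrowsD_right[OF i(1)]
  show "q \<in> Arr C" "b' \<in> Arr C" "Dom C b' = Dom C i" "Cod C b' = Cod C q"
    by (auto simp: PD I i b')
  show "r' k \<in> Arr C \<and> Dom C (r' k) = Dom C i \<and> Cod C (r' k) = Dom C q \<and> Cmp C q (r' k) = b'"
    if "k < n" for k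
    using PD that I i b' r' by (auto intro!: Cmp_cong_right1)
  show "\<exists>h\<in>Arr C. Dom C h = Dom C c \<and> Cod C h = Dom C i \<and> Cmp C b' h = c \<and> (\<forall>i<n. Cmp C (r' i) h = u i)"
    if c: "c \<in> Arr C" "Cod C c = Cod C q"
      "\<And>i. i < n \<Longrightarrow> u i \<in> Arr C \<and> Dom C (u i) = Dom C c \<and> Cod C (u i) = Dom C q \<and> Cmp C q (u i) = c"
    for c u
  proof -
    obtain h where h: "h \<in> Arr C" "Dom C h = Dom C c" "Cod C h = p" "Cmp C b h = c"
      "\<And>i. i < n \<Longrightarrow> Cmp C (r i) h = u i"
      using power_exists[OF P c(1,2), of u] c(3) by metis
    show ?thesis by (intro bexI[of _ "Cmp C j h"]) (auto simp: h PD I i b' r')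
  qed
  show "h = k" if h: "h \<in> Arr C" "k \<in> Arr C" "Dom C h = Dom C k" "Cod C h = Dom C i"
      "Cod C k = Dom C i" "Cmp C b' h = Cmp C b' k" "\<And>i. i < n \<Longrightarrow> Cmp C (r' i) h = Cmp C (r' i) k"
    for h k
  proof -
    have "Cmp C i h = Cmp C i k"
    proof (rule power_unique[OF P])
      show "Cmp C (r l) (Cmp C i h) = Cmp C (r l) (Cmp C i k)" if "l < n" for l
        using h(7)[OF that] by (simp add: h(1-5) r' PD that I i)
      show "Cmp C b (Cmp C i h) = Cmp C b (Cmp C i k)"
        using h(6) by (simp add: h(1-5) b' PD I i)
    qed (auto simp: h(1-5) PD I i)
    then show ?thesis by (rule iso_cancel[OF i(1)]) (auto simp: h)
  qed
qed

lemma power_comparison: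
  assumes P: "pullback_power C q n p b r" and P': "pullback_power C q n p' b' r'"
  obtains i j where "inverse_arrows C i j" "Dom C i = p'" "Cod C i = p" "Cmp C b i = b'"
    "\<And>k. k < n \<Longrightarrow> Cmp C (r k) i = r' k"
proof -
  note PD = powerD[OF P] and PD' = powerD[OF P']
  obtain i where i: "i \<in> Arr C" "Dom C i = p'" "Cod C i = p" "Cmp C b i = b'"
    "\<And>k. k < n \<Longrightarrow> Cmp C (r k) i = r' k"
    by (rule power_exists[OF P, of b' r']) (auto simp: PD PD')
  obtain j where j: "j \<in> Arr C" "Dom C j = p" "Cod C j = p'" "Cmp C b' j = b"
    "\<And>k. k < n \<Longrightarrow> Cmp C (r' k) j = r k"
    by (rule power_exists[OF P', of b r]) (auto simp: PD PD')
  have p: "p \<in> Obj C" "p' \<in> Obj C" using Dom_Cod_obj[OF i(1)] i by simp_all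
  have "Cmp C j i = Ide C p'"
  proof (rule power_unique[OF P'])
    show "Cmp C b' (Cmp C j i) = Cmp C b' (Ide C p')"
      by (subst Cmp_cong_right1[OF j(4)]) (auto simp: i j PD' p)
    show "Cmp C (r' k) (Cmp C j i) = Cmp C (r' k) (Ide C p')" if "k < n" for k
      by (subst Cmp_cong_right1[OF j(5)]) (auto simp: i j PD' p that)
  qed (auto simp: i j p)
  moreover have "Cmp C i j = Ide C p"
  proof (rule power_unique[OF P])
    show "Cmp C b (Cmp C i j) = Cmp C b (Ide C p)"
      by (subst Cmp_cong_right1[OF i(4)]) (auto simp: i j PD p)
    show "Cmp C (r k) (Cmp C i j) = Cmp C (r k) (Ide C p)" if "k < n" for k
      by (subst Cmp_cong_right1[OF i(5)]) (auto simp: i j PD p that)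
  qed (auto simp: i j p)
  ultimately have "inverse_arrows C i j" using i j unfolding inverse_arrows_def by (auto simp: hom_def)
  then show ?thesis using that i by blast
qed

lemma pullback_if_power_2:
  assumes P: "pullback_power C q 2 p b r"
  shows "is_pullback C p (r 0) (r 1) q q"
proof (rule pullbackI)
  note PD = powerD[OF P]
  show "\<exists>h\<in>Arr C. Dom C h = Dom C u \<and> Cod C h = p \<and> Cmp C (r 0) h = u \<and> Cmp C (r 1) h = v"
    if uv: "u \<in> Arr C" "v \<in> Arr C" "Dom C v = Dom C u" "Cod C u = Dom C q"
      "Cod C v = Dom C q" "Cmp C q u = Cmp C q v" for u v
  proof -
    obtain h where h: "h \<in> Arr C" "Dom C h = Dom C u" "Cod C h = p"
      "\<And>i. i < 2 \<Longrightarrow> Cmp C (r i) h = (if i = 0 then u else v)"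
      by (rule power_exists[OF P, of "Cmp C q u" "\<lambda>i. if i = 0 then u else v"]) (auto simp: uv PD)
    then show ?thesis by (intro bexI[of _ h]) (auto simp: h(4)[of 0] h(4)[of 1])
  qed
  show "h = k"
    if h: "h \<in> Arr C" "k \<in> Arr C" "Dom C h = Dom C k" "Cod C h = p" "Cod C k = p"
      "Cmp C (r 0) h = Cmp C (r 0) k" "Cmp C (r 1) h = Cmp C (r 1) k" for h k
  proof (rule power_unique[OF P])
    have "Cmp C b x = Cmp C q (Cmp C (r 0) x)" if "x \<in> Arr C" "Cod C x = p" for x
      by (rule Cmp_cong_right1[symmetric]) (auto simp: that PD)
    then show "Cmp C b h = Cmp C b k" using h by simp
    show "Cmp C (r i) h = Cmp C (r i) k" if "i < 2" for i
      using h that by (cases "i = 0") (auto simp: less_2_cases_iff)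
  qed (auto simp: h)
qed (auto simp: powerD[OF P])

lemma power_2_if_pullback:
  assumes P: "is_pullback C p r s q q"
  shows "pullback_power C q 2 p (Cmp C q r) (\<lambda>i. if i = 0 then r else s)"
proof (rule powerI)
  note PD = pullbackD[OF P]
  show "\<exists>h\<in>Arr C. Dom C h = Dom C c \<and> Cod C h = p \<and> Cmp C (Cmp C q r) h = c \<and>
      (\<forall>i<2. Cmp C (if i = 0 then r else s) h = u i)"
    if c: "c \<in> Arr C" "Cod C c = Cod C q"
      "\<And>i. i < 2 \<Longrightarrow> u i \<in> Arr C \<and> Dom C (u i) = Dom C c \<and> Cod C (u i) = Dom C q \<and> Cmp C q (u i) = c"
    for c and u :: "nat \<Rightarrow> 'm"
  proof -
    note c01 = c(3)[of 0, simplified] c(3)[of 1, simplified]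
    obtain h where h: "h \<in> Arr C" "Dom C h = Dom C c" "Cod C h = p" "Cmp C r h = u 0" "Cmp C s h = u 1"
      by (rule pullback_exists[OF P, of "u 0" "u 1"]) (auto simp: c01)
    then show ?thesis
      by (intro bexI[of _ h]) (auto simp: c01 PD less_2_cases_iff)
  qed
  show "h = k"
    if h: "h \<in> Arr C" "k \<in> Arr C" "Dom C h = Dom C k" "Cod C h = p" "Cod C k = p"
      "\<And>i::nat. i < 2 \<Longrightarrow> Cmp C (if i = 0 then r else s) h = Cmp C (if i = 0 then r else s) k" for h k
    by (rule pullback_unique[OF P]) (auto simp: h(6)[of 0, simplified] h(6)[of 1, simplified] h(1-5))
qed (auto simp: pullbackD(1-2,4-10)[OF P])

text \<open>The power \<open>E\<^bsub>n+1\<^esub>\<close> is the pullback of \<open>E\<^sub>n\<close> and \<open>E\<close>. This lemma and its converse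
  \<open>pullback_power_Suc\<close> reduce pullback powers to binary pullbacks, so that preservation of the
  latter by a functor yields preservation of the former by induction.\<close>

lemma power_Suc_pullback:
  assumes P: "pullback_power C q n p b r" and P': "pullback_power C q (Suc n) p' b' r'"
  obtains h where "is_pullback C p' h (r' n) b q" "\<And>i. i < n \<Longrightarrow> Cmp C (r i) h = r' i"
    "Cmp C b h = b'"
proof -
  note PD = powerD[OF P] and PD' = powerD[OF P']
  obtain h where h: "h \<in> Arr C" "Dom C h = p'" "Cod C h = p" "Cmp C b h = b'"
    "\<And>i. i < n \<Longrightarrow> Cmp C (r i) h = r' i"
    by (rule power_exists[OF P, of b' r']) (auto simp: PD PD')
  have "is_pullback C p' h (r' n) b q"
  proof (rule pullbackI)
    show "\<exists>k\<in>Arr C. Dom C k = Dom C u \<and> Cod C k = p' \<and> Cmp C h k = u \<and> Cmp C (r' n) k = v"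
      if uv: "u \<in> Arr C" "v \<in> Arr C" "Dom C v = Dom C u" "Cod C u = Dom C b"
        "Cod C v = Dom C q" "Cmp C b u = Cmp C q v" for u v
    proof -
      let ?w = "\<lambda>i. if i < n then Cmp C (r i) u else v"
      have *: "Cmp C q (?w i) = Cmp C b u" for i
        using Cmp_cong_right1[OF PD(8), of i u] by (simp add: uv PD)
      obtain k where k: "k \<in> Arr C" "Dom C k = Dom C u" "Cod C k = p'" "Cmp C b' k = Cmp C b u"
        "\<And>i. i < Suc n \<Longrightarrow> Cmp C (r' i) k = ?w i"
        by (rule power_exists[OF P', of "Cmp C b u" ?w]) (auto simp: * uv PD)
      have "Cmp C h k = u"
      proof (rule power_unique[OF P])
        show "Cmp C b (Cmp C h k) = Cmp C b u" by (subst Cmp_cong_right1[OF h(4)]) (auto simp: k h uv PD)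
        show "Cmp C (r i) (Cmp C h k) = Cmp C (r i) u" if "i < n" for i
          using k(5)[of i] that by (subst Cmp_cong_right1[OF h(5)]) (simp_all add: k(1-3) h PD)
      qed (auto simp: k h uv PD)
      then show ?thesis using k(5)[of n] by (intro bexI[of _ k]) (auto simp: k(1-3))
    qed
    show "k = l"
      if k: "k \<in> Arr C" "l \<in> Arr C" "Dom C k = Dom C l" "Cod C k = p'" "Cod C l = p'"
        "Cmp C h k = Cmp C h l" "Cmp C (r' n) k = Cmp C (r' n) l" for k l
    proof (rule power_unique[OF P'])
      have "Cmp C b' x = Cmp C b (Cmp C h x)" if "x \<in> Arr C" "Cod C x = p'" for x
        by (rule Cmp_cong_right1[symmetric]) (auto simp: h that PD)
      then show "Cmp C b' k = Cmp C b' l" using k by simp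
      have "Cmp C (r' i) x = Cmp C (r i) (Cmp C h x)" if "x \<in> Arr C" "Cod C x = p'" "i < n" for x i
        by (rule Cmp_cong_right1[symmetric]) (auto simp: h that PD)
      then show "Cmp C (r' i) k = Cmp C (r' i) l" if "i < Suc n" for i
        using that k by (cases "i = n") auto
    qed (auto simp: k)
  qed (auto simp: h PD PD')
  then show ?thesis using that h by blast
qed

lemma pullback_power_Suc:
  assumes P: "pullback_power C q n p b r" and Q: "is_pullback C p' h s b q"
    and b': "b' = Cmp C b h" and r': "\<And>i. i < n \<Longrightarrow> r' i = Cmp C (r i) h" "r' n = s"
  shows "pullback_power C q (Suc n) p' b' r'"
proof (rule powerI)
  note PD = powerD[OF P] and QD = pullbackD(1-2,4-10)[OF Q]
  show "q \<in> Arr C" "b' \<in> Arr C" "Dom C b' = p'" "Cod C b' = Cod C q"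
    by (auto simp: PD QD b')
  show "r' k \<in> Arr C \<and> Dom C (r' k) = p' \<and> Cod C (r' k) = Dom C q \<and> Cmp C q (r' k) = b'"
    if "k < Suc n" for k
  proof (cases "k < n")
    case True
    then show ?thesis by (auto simp: PD QD b' r' Cmp_cong_right1[OF PD(8), of k h])
  next
    case False
    then show ?thesis using that QD b' r' by (auto simp: less_Suc_eq)
  qed
  show "\<exists>k\<in>Arr C. Dom C k = Dom C c \<and> Cod C k = p' \<and> Cmp C b' k = c \<and> (\<forall>i<Suc n. Cmp C (r' i) k = u i)"
    if c: "c \<in> Arr C" "Cod C c = Cod C q"
      "\<And>i. i < Suc n \<Longrightarrow> u i \<in> Arr C \<and> Dom C (u i) = Dom C c \<and> Cod C (u i) = Dom C q \<and> Cmp C q (u i) = c"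
    for c and u :: "nat \<Rightarrow> 'm"
  proof -
    obtain l where l: "l \<in> Arr C" "Dom C l = Dom C c" "Cod C l = p" "Cmp C b l = c"
      "\<And>i. i < n \<Longrightarrow> Cmp C (r i) l = u i"
      by (rule power_exists[OF P c(1,2), of u]) (auto simp: c(3))
    obtain k where k: "k \<in> Arr C" "Dom C k = Dom C c" "Cod C k = p'" "Cmp C h k = l" "Cmp C s k = u n"
      by (rule pullback_exists[OF Q, of l "u n"]) (auto simp: l c(3)[of n] PD)
    show ?thesis
      by (intro bexI[of _ k]) (auto simp: k l r' b' PD QD c(3)[of n] less_Suc_eq)
  qed
  show "k = l" if k: "k \<in> Arr C" "l \<in> Arr C" "Dom C k = Dom C l" "Cod C k = p'"
      "Cod C l = p'" "Cmp C b' k = Cmp C b' l" "\<And>i. i < Suc n \<Longrightarrow> Cmp C (r' i) k = Cmp C (r' i) l"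
    for k l
  proof (rule pullback_unique[OF Q])
    show "Cmp C h k = Cmp C h l"
    proof (rule power_unique[OF P])
      show "Cmp C (r i) (Cmp C h k) = Cmp C (r i) (Cmp C h l)" if "i < n" for i
        using k(7)[of i] that by (simp add: r'  k(1-5) QD PD)
      show "Cmp C b (Cmp C h k) = Cmp C b (Cmp C h l)"
        using k(6) by (simp add: k(1-5) b' QD(1-8) PD)
    qed (auto simp: k(1-5) QD PD)
    show "Cmp C s k = Cmp C s l" using k(7)[of n] r'(2) by simp
  qed (auto simp: k)
qed

text \<open>A zeroth power of \<open>q\<close> need not be the codomain of \<open>q\<close> itself, only isomorphic to it through the
  structure map.\<close>

lemma power_0:
  assumes "q \<in> Arr C"
  shows "pullback_power C q 0 p b r \<longleftrightarrow> is_iso C b \<and> Dom C b = p \<and> Cod C b = Cod C q"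
proof
  assume P: "pullback_power C q 0 p b r"
  have "pullback_power C q 0 (Cod C q) (Ide C (Cod C q)) r"
    by (intro powerI) (auto simp: assms)
  then obtain i j where i: "inverse_arrows C i j" "Dom C i = p" "Cod C i = Cod C q" "Cmp C (Ide C (Cod C q)) i = b"
    using power_comparison[of q 0 "Cod C q" _ _ p b r] P by blast
  have "i = b" using i(3,4) inverse_arrowsD(1)[OF i(1)] by simp
  with i show "is_iso C b \<and> Dom C b = p \<and> Cod C b = Cod C q" by (auto simp: is_iso_def)
next
  assume b: "is_iso C b \<and> Dom C b = p \<and> Cod C b = Cod C q"
  then obtain j where j: "inverse_arrows C b j" by (auto simp: is_iso_def)
  show "pullback_power C q 0 p b r"
  proof (rule powerI)
    fix c assume c: "c \<in> Arr C" "Cod C c = Cod C q"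
    show "\<exists>h\<in>Arr C. Dom C h = Dom C c \<and> Cod C h = p \<and> Cmp C b h = c \<and> (\<forall>i<0. Cmp C (r i) h = u i)"
      for u
      by (intro bexI[of _ "Cmp C j c"]) (auto simp: c b inverse_arrowsD[OF j] inverse_arrowsD_right[OF j])
  next
    fix h k assume "h \<in> Arr C" "k \<in> Arr C" "Dom C h = Dom C k" "Cod C h = p"
      "Cod C k = p" "Cmp C b h = Cmp C b k"
    then show "h = k" using b inverse_arrowsD_right(1)[OF j] by metis
  qed (auto simp: b assms inverse_arrowsD[OF j])
qed

end


subsection \<open>Functors and the pullbacks they preserve\<close>

locale functorial = dom: category C + cod: category D
  for C :: "('o, 'm) cat" and D :: "('p, 'q) cat" +
  fixes Ho :: "'o \<Rightarrow> 'p" and Ha :: "'m \<Rightarrow> 'q"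
  assumes arr [simp]: "f \<in> Arr C \<Longrightarrow> Ha f \<in> Arr D"
    and Dom_arr [simp]: "f \<in> Arr C \<Longrightarrow> Dom D (Ha f) = Ho (Dom C f)"
    and Cod_arr [simp]: "f \<in> Arr C \<Longrightarrow> Cod D (Ha f) = Ho (Cod C f)"
    and pres_Ide [simp]: "a \<in> Obj C \<Longrightarrow> Ha (Ide C a) = Ide D (Ho a)"
    and pres_Cmp: "f \<in> Arr C \<Longrightarrow> g \<in> Arr C \<Longrightarrow> Dom C g = Cod C f \<Longrightarrow>
      Ha (Cmp C g f) = Cmp D (Ha g) (Ha f)"
begin

lemma obj [simp]: "a \<in> Obj C \<Longrightarrow> Ho a \<in> Obj D"
  using Dom_arr[of "Ide C a"] arr[of "Ide C a"] cod.Dom_in[of "Ha (Ide C a)"] by simp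

lemma pres_square:
  assumes "Cmp C g f = Cmp C g' f'" "f \<in> Arr C" "g \<in> Arr C" "Dom C g = Cod C f"
    "f' \<in> Arr C" "g' \<in> Arr C" "Dom C g' = Cod C f'"
  shows "Cmp D (Ha g) (Ha f) = Cmp D (Ha g') (Ha f')"
  using assms by (simp flip: pres_Cmp)

lemma pres_inverse: "inverse_arrows C f g \<Longrightarrow> inverse_arrows D (Ha f) (Ha g)"
  unfolding inverse_arrows_def hom_def by (auto simp flip: pres_Cmp)

lemma pres_iso: "is_iso C f \<Longrightarrow> is_iso D (Ha f)"
  using pres_inverse by (auto simp: is_iso_def)

end

lemma functorial_id: "category C \<Longrightarrow> functorial C C (\<lambda>a. a) (\<lambda>f. f)"
  by (simp add: functorial_def functorial_axioms_def)

lemma functorial_comp: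
  assumes "functorial C D Fo Fa" "functorial D E Go Ga"
  shows "functorial C E (\<lambda>a. Go (Fo a)) (\<lambda>f. Ga (Fa f))"
proof -
  interpret F: functorial C D Fo Fa by fact
  interpret G: functorial D E Go Ga by fact
  show ?thesis by unfold_locales (auto simp: F.pres_Cmp G.pres_Cmp)
qed

lemma functorial_funpow:
  assumes "functorial C C Fo Fa"
  shows "functorial C C (Fo ^^ k) (Fa ^^ k)"
proof (induction k)
  case 0
  have "category C" using assms by (simp add: functorial_def)
  from functorial_id[OF this] show ?case by (simp add: id_def)
next
  case (Suc k)
  from functorial_comp[OF this assms] show ?case by (simp add: o_def)
qed

lemma functorial_is_functor: "is_functor C D F \<Longrightarrow> functorial C D (fobj F) (farr F)"
  unfolding is_functor_def functorial_def functorial_axioms_def by (auto simp: hom_def)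

definition preserves_pullbacks_over ::
  "('o, 'm) cat \<Rightarrow> ('p, 'q) cat \<Rightarrow> ('o \<Rightarrow> 'p) \<Rightarrow> ('m \<Rightarrow> 'q) \<Rightarrow> 'o \<Rightarrow> bool" where
  "preserves_pullbacks_over C D Ho Ha b \<longleftrightarrow>
     (\<forall>p r s f g. is_pullback C p r s f g \<and> Cod C f = b \<longrightarrow>
        is_pullback D (Ho p) (Ha r) (Ha s) (Ha f) (Ha g))"

context functorial
begin

lemma preserves_pullbacks_over_iso_base:
  assumes "preserves_pullbacks_over C D Ho Ha b" and t: "inverse_arrows C t t'" and b: "Cod C t = b"
  shows "preserves_pullbacks_over C D Ho Ha (Dom C t)"
  unfolding preserves_pullbacks_over_def
proof (intro allI impI)
  fix p r s f g assume *: "is_pullback C p r s f g \<and> Cod C f = Dom C t"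
  then have P: "is_pullback C p r s f g" and f: "Cod C f = Dom C t" by auto
  note PD = dom.pullbackD[OF P] and T = dom.inverse_arrowsD[OF t]
  have "is_pullback C p r s (Cmp C t f) (Cmp C t g)"
    by (auto simp: dom.pullback_cospan_iso[OF t] P PD f)
  then have "is_pullback D (Ho p) (Ha r) (Ha s) (Ha (Cmp C t f)) (Ha (Cmp C t g))"
    using assms(1) PD T f b unfolding preserves_pullbacks_over_def by auto
  then show "is_pullback D (Ho p) (Ha r) (Ha s) (Ha f) (Ha g)"
    using cod.pullback_cospan_iso[OF pres_inverse[OF t]] PD T f by (auto simp: pres_Cmp)
qed

lemma preserves_pullbacks_over_nat_iso:
  assumes "functorial C D Ko Ka" and pr: "preserves_pullbacks_over C D Ho Ha b"
    and iso: "\<And>a. a \<in> Obj C \<Longrightarrow> is_iso D (\<iota> a)"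
    and ty: "\<And>a. a \<in> Obj C \<Longrightarrow> Dom D (\<iota> a) = Ko a" "\<And>a. a \<in> Obj C \<Longrightarrow> Cod D (\<iota> a) = Ho a"
    and nat: "\<And>f. f \<in> Arr C \<Longrightarrow> Cmp D (\<iota> (Cod C f)) (Ka f) = Cmp D (Ha f) (\<iota> (Dom C f))"
  shows "preserves_pullbacks_over C D Ko Ka b"
  unfolding preserves_pullbacks_over_def
proof (intro allI impI)
  interpret K: functorial C D Ko Ka by fact
  fix p r s f g assume *: "is_pullback C p r s f g \<and> Cod C f = b"
  then have P: "is_pullback C p r s f g" by simp
  note PD = dom.pullbackD[OF P]
  have Q: "is_pullback D (Ho p) (Ha r) (Ha s) (Ha f) (Ha g)"
    using * pr unfolding preserves_pullbacks_over_def by auto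
  have ob: "p \<in> Obj C" "Cod C f \<in> Obj C" "Dom C f \<in> Obj C" "Dom C g \<in> Obj C"
    using dom.Dom_Cod_obj(1)[OF PD(4)] PD by simp_all
  note i = cod.inv_arr[OF iso[OF ob(1)]] cod.inv_arr[OF iso[OF ob(3)]]
    cod.inv_arr[OF iso[OF ob(4)]] cod.inv_arr[OF iso[OF ob(2)]]
  have "is_pullback D (Dom D (\<iota> p)) (Ka r) (Ka s) (Ka f) (Ka g)"
    using nat[OF PD(4)] nat[OF PD(5)] nat[OF PD(1)] nat[OF PD(2)]
    by (intro cod.pullback_iso[OF Q i]) (simp_all add: PD(1-9) ob ty)
  then show "is_pullback D (Ko p) (Ka r) (Ka s) (Ka f) (Ka g)" using ty ob by simp
qed

text \<open>Each power is taken apart as a binary pullback over the codomain of \<open>q\<close>, mapped, and reassembled.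
  The induction passes through the smaller powers of \<open>q\<close>, whose existence is therefore assumed.\<close>

lemma preserves_powers:
  assumes pr: "preserves_pullbacks_over C D Ho Ha (Cod C q)"
    and ex: "\<And>n. \<exists>p b r. pullback_power C q n p b r"
  shows "pullback_power C q n p b r \<Longrightarrow>
    pullback_power D (Ha q) n (Ho p) (Ha b) (\<lambda>i. Ha (r i))"
proof (induction n arbitrary: p b r)
  case 0
  have q: "q \<in> Arr C" using dom.powerD[OF 0] by simp
  have "is_iso C b" "Dom C b = p" "Cod C b = Cod C q" using 0 dom.power_0[OF q] by simp_all
  moreover have "b \<in> Arr C" using dom.powerD[OF 0] by simp
  ultimately show ?case by (auto simp: pres_iso[of b] cod.power_0[of "Ha q"] q)
next
  case (Suc n)
  note PD' = dom.powerD[OF Suc.prems]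
  obtain p0 b0 r0 where P: "pullback_power C q n p0 b0 r0" using ex by blast
  note PD = dom.powerD[OF P]
  obtain h where h: "is_pullback C p h (r n) b0 q" "\<And>i. i < n \<Longrightarrow> Cmp C (r0 i) h = r i" "Cmp C b0 h = b"
    using dom.power_Suc_pullback[OF P Suc.prems] by blast
  note hD = dom.pullbackD[OF h(1)]
  have "pullback_power D (Ha q) n (Ho p0) (Ha b0) (\<lambda>i. Ha (r0 i))"
    using Suc.IH[OF P] .
  moreover have "is_pullback D (Ho p) (Ha h) (Ha (r n)) (Ha b0) (Ha q)"
    using pr h PD unfolding preserves_pullbacks_over_def by auto
  moreover have "Ha b = Cmp D (Ha b0) (Ha h)" using PD hD h by (simp flip: pres_Cmp)
  moreover have "\<And>i. i < n \<Longrightarrow> Ha (r i) = Cmp D (Ha (r0 i)) (Ha h)" using PD hD h by (simp flip: pres_Cmp)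
  ultimately show ?case by (rule cod.pullback_power_Suc) simp_all
qed

text \<open>Pullback powers are unique up to isomorphism, so a functor preserves all \<open>n\<close>-th powers of a
  morphism as soon as it preserves one of them.\<close>

lemma preserves_power_if_one:
  assumes P: "pullback_power C q n p b r" and HP: "pullback_power D (Ha q) n (Ho p) (Ha b) (\<lambda>i. Ha (r i))"
    and P': "pullback_power C q n p' b' r'"
  shows "pullback_power D (Ha q) n (Ho p') (Ha b') (\<lambda>i. Ha (r' i))"
proof -
  note PD = dom.powerD[OF P]
  obtain i j where i: "inverse_arrows C i j" "Dom C i = p'" "Cod C i = p" "Cmp C b i = b'"
    "\<And>k. k < n \<Longrightarrow> Cmp C (r k) i = r' k"
    using dom.power_comparison[OF P P'] by blast
  note I = dom.inverse_arrowsD[OF i(1)]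
  have "pullback_power D (Ha q) n (Dom D (Ha i)) (Ha b') (\<lambda>i. Ha (r' i))"
  proof (rule cod.power_iso[OF HP pres_inverse[OF i(1)]])
    show "Ha b' = Cmp D (Ha b) (Ha i)" using i I PD by (simp flip: pres_Cmp)
    show "Ha (r' k) = Cmp D (Ha (r k)) (Ha i)" if "k < n" for k
      using i I PD that by (simp flip: pres_Cmp)
  qed (auto simp: i I)
  then show ?thesis using i I by simp
qed

end



section \<open>The category of Weil algebras\<close>

lemma is_weil_iff:
  "is_weil A \<longleftrightarrow> snd A \<subseteq> {..<fst A} \<times> {..<fst A} \<and> (\<forall>i<fst A. (i, i) \<in> snd A) \<and>
    sym (snd A) \<and> trans (snd A)"
  by (auto simp: is_weil_def equiv_def refl_on_def)

lemma is_weilD: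
  assumes "is_weil A"
  shows "(i, j) \<in> snd A \<Longrightarrow> i < fst A" "(i, j) \<in> snd A \<Longrightarrow> j < fst A"
    "i < fst A \<Longrightarrow> (i, i) \<in> snd A" "(i, j) \<in> snd A \<Longrightarrow> (j, i) \<in> snd A"
    "(i, j) \<in> snd A \<Longrightarrow> (j, k) \<in> snd A \<Longrightarrow> (i, k) \<in> snd A"
  using assms unfolding is_weil_iff by (auto dest: symD transD)

lemma is_weil_W_pow [simp]: "is_weil (W_pow n)"
  unfolding is_weil_def W_pow_def equiv_def refl_on_def sym_def trans_def by auto

lemma is_weil_N [simp]: "is_weil N_obj"
  by (simp add: N_obj_def)

lemma is_weil_W [simp]: "is_weil W"
  by (simp add: W_def)

lemma tensor_rel_iff:
  assumes "is_weil A"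
  shows "(i, j) \<in> snd (tensor_obj A B) \<longleftrightarrow> (i, j) \<in> snd A \<or>
    (fst A \<le> i \<and> fst A \<le> j \<and> (i - fst A, j - fst A) \<in> snd B)"
proof -
  have "(i, j) \<in> map_prod ((+) (fst A)) ((+) (fst A)) ` snd B \<longleftrightarrow>
      fst A \<le> i \<and> fst A \<le> j \<and> (i - fst A, j - fst A) \<in> snd B"
    by (force simp: image_iff intro: bexI[of _ "(i - fst A, j - fst A)"])
  then show ?thesis by (simp add: tensor_obj_def)
qed

lemma is_weil_tensor [simp]:
  assumes A: "is_weil A" and B: "is_weil B"
  shows "is_weil (tensor_obj A B)"
proof -
  note AD = is_weilD[OF A] and BD = is_weilD[OF B] and rel = tensor_rel_iff[OF A, of _ _ B]
  have f: "fst (tensor_obj A B) = fst A + fst B" by (simp add: tensor_obj_def)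
  have 1: "i < fst A + fst B \<and> j < fst A + fst B" if "(i, j) \<in> snd (tensor_obj A B)" for i j
    using that unfolding rel by (auto dest: AD(1,2) BD(1,2))
  have 2: "(i, i) \<in> snd (tensor_obj A B)" if "i < fst A + fst B" for i
    using that unfolding rel by (cases "i < fst A") (auto simp: AD(3) BD(3))
  have 3: "(j, i) \<in> snd (tensor_obj A B)" if "(i, j) \<in> snd (tensor_obj A B)" for i j
    using that unfolding rel by (auto intro: AD(4) BD(4))
  have 4: "(i, k) \<in> snd (tensor_obj A B)"
    if "(i, j) \<in> snd (tensor_obj A B)" "(j, k) \<in> snd (tensor_obj A B)" for i j k
    using that unfolding rel by (auto intro: AD(5) BD(5) dest: AD(1,2))
  have "snd (tensor_obj A B) \<subseteq> {..<fst A + fst B} \<times> {..<fst A + fst B}"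
    using 1 by auto
  moreover have "sym (snd (tensor_obj A B))" using 3 by (rule symI)
  moreover have "trans (snd (tensor_obj A B))" using 4 by (rule transI)
  ultimately show ?thesis unfolding is_weil_iff f using 2 by blast
qed

lemma finite_weil_basis [simp]: "finite (weil_basis A)"
  by (rule finite_subset[of _ "Pow {..<fst A}"]) (auto simp: weil_basis_def)

lemma empty_in_basis [simp]: "{} \<in> weil_basis A"
  by (simp add: weil_basis_def)

lemma basis_N: "weil_basis N_obj = {{}}"
  by (auto simp: weil_basis_def N_obj_def W_pow_def)

lemma basis_W_pow: "S \<in> weil_basis (W_pow n) \<longleftrightarrow> S = {} \<or> (\<exists>i<n. S = {i})"
proof
  assume "S \<in> weil_basis (W_pow n)"
  then have S: "S \<subseteq> {..<n}" "\<And>i j. i \<in> S \<Longrightarrow> j \<in> S \<Longrightarrow> i = j"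
    by (auto simp: weil_basis_def W_pow_def)
  show "S = {} \<or> (\<exists>i<n. S = {i})"
  proof (cases "S = {}")
    case False
    then obtain i where "i \<in> S" by blast
    with S show ?thesis by (intro disjI2 exI[of _ i]) auto
  qed simp
qed (auto simp: weil_basis_def W_pow_def)

lemma basis_W: "weil_basis W = {{}, {0}}"
  by (auto simp: basis_W_pow W_def)

lemma basis_W2: "weil_basis (W_pow 2) = {{}, {0}, {1}}"
  by (auto simp: basis_W_pow less_2_cases_iff)

text \<open>No variable of \<open>A\<close> is related to one of \<open>B\<close> in \<open>A \<otimes> B\<close>, so a monomial is nonzero exactly when
  its parts in the variables of \<open>A\<close> and of \<open>B\<close> are.\<close>

lemma basis_tensor:
  assumes "is_weil A"
  shows "V \<in> weil_basis (tensor_obj A B) \<longleftrightarrow>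
    V \<inter> {..<fst A} \<in> weil_basis A \<and> {i. fst A + i \<in> V} \<in> weil_basis B"
proof -
  note rel = tensor_rel_iff[OF assms, of _ _ B] and AD = is_weilD[OF assms]
  have f: "fst (tensor_obj A B) = fst A + fst B" by (simp add: tensor_obj_def)
  have sub: "V \<subseteq> {..<fst A + fst B} \<longleftrightarrow> {i. fst A + i \<in> V} \<subseteq> {..<fst B}"
  proof
    assume *: "{i. fst A + i \<in> V} \<subseteq> {..<fst B}"
    show "V \<subseteq> {..<fst A + fst B}"
    proof
      fix x assume "x \<in> V"
      then show "x \<in> {..<fst A + fst B}"
        using subsetD[OF *, of "x - fst A"] by (cases "x < fst A") auto
    qed
  qed auto
  have "(\<forall>i\<in>V. \<forall>j\<in>V. i \<noteq> j \<longrightarrow> (i, j) \<notin> snd (tensor_obj A B)) \<longleftrightarrow>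
    (\<forall>i\<in>V \<inter> {..<fst A}. \<forall>j\<in>V \<inter> {..<fst A}. i \<noteq> j \<longrightarrow> (i, j) \<notin> snd A) \<and>
    (\<forall>i j. fst A + i \<in> V \<longrightarrow> fst A + j \<in> V \<longrightarrow> i \<noteq> j \<longrightarrow> (i, j) \<notin> snd B)"
    (is "?L \<longleftrightarrow> ?R")
  proof
    assume L: ?L
    have "(i, j) \<notin> snd B" if "fst A + i \<in> V" "fst A + j \<in> V" "i \<noteq> j" for i j
    proof -
      have "(fst A + i, fst A + j) \<notin> snd (tensor_obj A B)" using L that by auto
      then show ?thesis unfolding rel by simp
    qed
    moreover have "(i, j) \<notin> snd A" if "i \<in> V" "j \<in> V" "i \<noteq> j" for i j
      using L that rel by auto
    ultimately show ?R by blast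
  next
    assume R: ?R
    show ?L
    proof (intro ballI impI notI)
      fix i j assume ij: "i \<in> V" "j \<in> V" "i \<noteq> j" "(i, j) \<in> snd (tensor_obj A B)"
      then consider "(i, j) \<in> snd A" | "fst A \<le> i" "fst A \<le> j" "(i - fst A, j - fst A) \<in> snd B"
        unfolding rel by blast
      then show False
      proof cases
        case 1
        then show ?thesis using R ij AD(1,2)[OF 1] by auto
      next
        case 2
        then show ?thesis using R[THEN conjunct2, rule_format, of "i - fst A" "j - fst A"] ij by auto
      qed
    qed
  qed
  then show ?thesis unfolding weil_basis_def f using sub by auto
qed

lemma basis_WW: "weil_basis (tensor_obj W W) = {{}, {0}, {1}, {0, 1}}"
proof -
  have [simp]: "fst W = 1" by (simp add: W_def W_pow_def)
  have "V \<in> weil_basis (tensor_obj W W) \<longleftrightarrow> V \<subseteq> {0, 1}" for V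
  proof -
    have "V \<in> weil_basis (tensor_obj W W) \<longleftrightarrow>
        (V \<inter> {..<1} = {} \<or> V \<inter> {..<1} = {0}) \<and> ({i. 1 + i \<in> V} = {} \<or> {i. 1 + i \<in> V} = {0})"
      by (simp add: basis_tensor basis_W)
    also have "\<dots> \<longleftrightarrow> {i. 1 + i \<in> V} \<subseteq> {0}" by auto
    also have "\<dots> \<longleftrightarrow> V \<subseteq> {0, 1}"
    proof
      assume *: "{i. 1 + i \<in> V} \<subseteq> {0}"
      show "V \<subseteq> {0, 1}"
      proof
        fix x assume "x \<in> V"
        then show "x \<in> {0, 1}" using subsetD[OF *, of "x - 1"] by (cases x) auto
      qed
    qed auto
    finally show ?thesis .
  qed
  moreover have "V \<subseteq> {0, 1} \<longleftrightarrow> V \<in> {{}, {0}, {1}, {0, 1}}" for V :: "nat set" by auto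
  ultimately show ?thesis by blast
qed

lemma weil_mult_empty [simp]: "weil_mult A a b {} = a {} * b {}"
  by (simp add: weil_mult_def)

lemma weil_mult_single:
  "{i} \<in> weil_basis A \<Longrightarrow> weil_mult A a b {i} = a {} * b {i} + a {i} * b {}"
  by (simp add: weil_mult_def Pow_insert)

lemma weil_mult_pair:
  assumes "{i, j} \<in> weil_basis A" "i \<noteq> j"
  shows "weil_mult A a b {i, j} = a {} * b {i, j} + a {i} * b {j} + a {j} * b {i} + a {i, j} * b {}"
proof -
  have "Pow {i, j} = {{}, {i}, {j}, {i, j}}" by auto
  moreover have "{i, j} - {i} = {j}" "{i, j} - {j} = {i}" "{i} \<noteq> {j}" "{i} \<noteq> {i, j}" "{j} \<noteq> {i, j}"
    using assms(2) by auto
  ultimately show ?thesis using assms(1) by (simp add: weil_mult_def)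
qed

lemma weil_mult_notin [simp]: "S \<notin> weil_basis A \<Longrightarrow> weil_mult A a b S = 0"
  by (simp add: weil_mult_def)

lemma weil_monom_apply: "weil_monom S U = (if U = S then 1 else 0)"
  by (simp add: weil_monom_def)

lemma weil_carrierD: "a \<in> weil_carrier A \<Longrightarrow> S \<notin> weil_basis A \<Longrightarrow> a S = 0"
  by (simp add: weil_carrier_def)

lemma weil_carrier_intros [simp]:
  "weil_mult A a b \<in> weil_carrier A"
  "a \<in> weil_carrier A \<Longrightarrow> b \<in> weil_carrier A \<Longrightarrow> weil_add a b \<in> weil_carrier A"
  "S \<in> weil_basis A \<Longrightarrow> weil_monom S \<in> weil_carrier A"
  "(\<lambda>S. 0) \<in> weil_carrier A"
  by (auto simp: weil_carrier_def weil_add_def weil_monom_def)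

lemma weil_homD:
  assumes "weil_hom A B f"
  shows "a \<in> weil_carrier A \<Longrightarrow> f a \<in> weil_carrier B" "f (\<lambda>S. 0) = (\<lambda>S. 0)"
    "f (weil_monom {}) = weil_monom {}" "f \<in> extensional (weil_carrier A)"
    "a \<in> weil_carrier A \<Longrightarrow> b \<in> weil_carrier A \<Longrightarrow> f (weil_add a b) = weil_add (f a) (f b)"
    "a \<in> weil_carrier A \<Longrightarrow> b \<in> weil_carrier A \<Longrightarrow> f (weil_mult A a b) = weil_mult B (f a) (f b)"
  using assms by (auto simp: weil_hom_def PiE_def)

lemma weil_hom_restrict:
  assumes "\<And>a. a \<in> weil_carrier A \<Longrightarrow> f a \<in> weil_carrier B" "f (\<lambda>S. 0) = (\<lambda>S. 0)"
    "f (weil_monom {}) = weil_monom {}"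
    "\<And>a b. a \<in> weil_carrier A \<Longrightarrow> b \<in> weil_carrier A \<Longrightarrow> f (weil_add a b) = weil_add (f a) (f b)"
    "\<And>a b. a \<in> weil_carrier A \<Longrightarrow> b \<in> weil_carrier A \<Longrightarrow> f (weil_mult A a b) = weil_mult B (f a) (f b)"
  shows "weil_hom A B (restrict f (weil_carrier A))"
  using assms unfolding weil_hom_def by auto

lemma hom_Weil_iff:
  "\<theta> \<in> hom Weil A B \<longleftrightarrow> (\<exists>f. \<theta> = (A, B, f) \<and> is_weil A \<and> is_weil B \<and> weil_hom A B f)"
  by (auto simp: hom_def Weil_def)

lemma hom_WeilI:
  assumes "is_weil A" "is_weil B" "weil_hom A B (restrict f (weil_carrier A))"
  shows "mk_weil_arr A B f \<in> hom Weil A B"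
  using assms by (auto simp: hom_Weil_iff mk_weil_arr_def)

lemma Weil_simps [simp]:
  "A \<in> Obj Weil \<longleftrightarrow> is_weil A" "Ide Weil A = mk_weil_arr A A (\<lambda>a. a)"
  "Dom Weil (A, B, f) = A" "Cod Weil (A, B, f) = B"
  "Cmp Weil (B', D, g) (A, B, f) = mk_weil_arr A D (g \<circ> f)"
  by (simp_all add: Weil_def)

lemma category_Weil: "category Weil"
proof
  fix A assume "A \<in> Obj Weil"
  then show "Ide Weil A \<in> hom Weil A A"
    by (auto intro!: hom_WeilI weil_hom_restrict)
next
  fix \<theta> \<theta>' A B D assume "\<theta> \<in> hom Weil A B" "\<theta>' \<in> hom Weil B D"
  then show "Cmp Weil \<theta>' \<theta> \<in> hom Weil A D"
    by (auto simp: hom_Weil_iff mk_weil_arr_def weil_homD intro!: weil_hom_restrict)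
next
  fix \<theta> \<theta>' \<theta>'' A B D E
  assume "\<theta> \<in> hom Weil A B" "\<theta>' \<in> hom Weil B D" "\<theta>'' \<in> hom Weil D E"
  then show "Cmp Weil \<theta>'' (Cmp Weil \<theta>' \<theta>) = Cmp Weil (Cmp Weil \<theta>'' \<theta>') \<theta>"
    by (auto simp: hom_Weil_iff mk_weil_arr_def weil_homD intro!: restrict_ext)
next
  fix \<theta> A B assume "\<theta> \<in> hom Weil A B"
  then obtain f where \<theta>: "\<theta> = (A, B, f)" and f: "weil_hom A B f" by (auto simp: hom_Weil_iff)
  have "restrict (f \<circ> restrict (\<lambda>a. a) (weil_carrier A)) (weil_carrier A) = f"
    "restrict (restrict (\<lambda>a. a) (weil_carrier B) \<circ> f) (weil_carrier A) = f"
    by (rule extensionalityI[OF _ weil_homD(4)[OF f]], auto simp: weil_homD(1)[OF f])+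
  then show "Cmp Weil \<theta> (Ide Weil A) = \<theta>" "Cmp Weil (Ide Weil B) \<theta> = \<theta>"
    by (simp_all add: \<theta> mk_weil_arr_def)
qed (auto simp: Weil_def)

interpretation Weil: category Weil by (rule category_Weil)

lemma N_in_Weil: "N_obj \<in> Obj Weil" and W_in_Weil: "W \<in> Obj Weil" and
  tensor_in_Weil: "A \<in> Obj Weil \<Longrightarrow> B \<in> Obj Weil \<Longrightarrow> tensor_obj A B \<in> Obj Weil"
  by simp_all


subsection \<open>The structural morphisms\<close>

lemma weil_bang_hom:
  assumes "is_weil A"
  shows "weil_bang A \<in> hom Weil A N_obj"
  unfolding weil_bang_def using assms
  by (intro hom_WeilI weil_hom_restrict)
    (auto simp: weil_carrier_def basis_N weil_monom_def weil_add_def)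

lemma weil_p_hom: "weil_p \<in> hom Weil W N_obj"
  by (simp add: weil_p_def weil_bang_hom)

lemma weil_0_hom: "weil_0 \<in> hom Weil N_obj W"
proof -
  have "weil_mult N_obj a b = weil_mult W a b" if "a \<in> weil_carrier N_obj" "b \<in> weil_carrier N_obj" for a b
  proof
    fix S
    have "a {0} = 0" "b {0} = 0" using that by (auto simp: weil_carrier_def basis_N)
    then show "weil_mult N_obj a b S = weil_mult W a b S"
      by (cases "S = {}"; cases "S = {0}") (simp_all add: basis_N basis_W weil_mult_single)
  qed
  then show ?thesis unfolding weil_0_def
    by (intro hom_WeilI weil_hom_restrict) (auto simp: weil_carrier_def basis_N basis_W)
qed

lemma weil_plus_hom: "weil_plus \<in> hom Weil (W_pow 2) W"
  unfolding weil_plus_def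
  by (intro hom_WeilI weil_hom_restrict)
    (auto simp: weil_carrier_def basis_W basis_W2 weil_monom_def weil_add_def fun_eq_iff
      weil_mult_single algebra_simps)

lemma weil_proj_hom: "i < 2 \<Longrightarrow> weil_proj i \<in> hom Weil (W_pow 2) W"
  unfolding weil_proj_def less_2_cases_iff
  by (intro hom_WeilI weil_hom_restrict)
    (auto simp: weil_carrier_def basis_W basis_W2 weil_monom_def weil_add_def fun_eq_iff
      weil_mult_single algebra_simps)

lemma weil_l_hom: "weil_l \<in> hom Weil W (tensor_obj W W)"
proof -
  let ?f = "\<lambda>(a :: weil_elt) S. if S = {} then a {} else if S = {0, 1} then a {0} else (0 :: nat)"
  have "?f (weil_mult W a b) = weil_mult (tensor_obj W W) (?f a) (?f b)" for a b
  proof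
    fix S :: "nat set"
    consider "S = {}" | "S = {0}" | "S = {1}" | "S = {0, 1}" | "S \<notin> {{}, {0}, {1}, {0, 1}}" by blast
    then show "?f (weil_mult W a b) S = weil_mult (tensor_obj W W) (?f a) (?f b) S"
    proof cases
      case 4
      moreover have "{0} \<noteq> {0, Suc 0}" "{Suc 0} \<noteq> {0, Suc 0}" by auto
      ultimately show ?thesis by (simp add: weil_mult_pair basis_WW basis_W weil_mult_single)
    qed (auto simp: weil_mult_single basis_WW)
  qed
  then show ?thesis unfolding weil_l_def
    by (intro hom_WeilI weil_hom_restrict)
      (auto simp: weil_carrier_def basis_WW basis_W weil_monom_def weil_add_def fun_eq_iff)
qed


subsection \<open>Linearity and the tensor product\<close>

text \<open>A Weil algebra is free as an \<open>\<nat>\<close>-module on its nonzero monomials, so a morphism is determined by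
  its values there. This is proved by induction over finite sets of monomials, and over the
  coefficient of a single one, as multiplication by a natural number is repeated addition.\<close>

lemma weil_hom_sum_monom:
  assumes f: "weil_hom A B f" and K: "K \<subseteq> weil_basis A"
  shows "f (\<lambda>U. if U \<in> K then a U else 0) = (\<lambda>V. \<Sum>U\<in>K. a U * f (weil_monom U) V)"
proof -
  have mult: "f (\<lambda>V. if V = U then k else 0) = (\<lambda>V. k * f (weil_monom U) V)"
    if U: "U \<in> weil_basis A" for U k
  proof (induction k)
    case 0
    show ?case using weil_homD(2)[OF f] by (simp cong: if_cong)
  next
    case (Suc k)
    have c: "(\<lambda>V. if V = U then k else 0) \<in> weil_carrier A" using U by (auto simp: weil_carrier_def)
    have "(\<lambda>V. if V = U then Suc k else 0) = weil_add (weil_monom U) (\<lambda>V. if V = U then k else 0)"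
      by (auto simp: weil_add_def weil_monom_def)
    then show ?case using weil_homD(5)[OF f _ c, of "weil_monom U"] U Suc
      by (auto simp: weil_add_def)
  qed
  have "finite K" by (rule finite_subset[OF K finite_weil_basis])
  then show ?thesis using K
  proof (induction K)
    case empty
    show ?case using weil_homD(2)[OF f] by simp
  next
    case (insert U K)
    let ?m = "\<lambda>V. if V = U then a U else 0" and ?k = "\<lambda>V. if V \<in> K then a V else 0"
    have "(\<lambda>V. if V \<in> insert U K then a V else 0) = weil_add ?m ?k"
      using insert by (auto simp: weil_add_def)
    moreover have "?m \<in> weil_carrier A" "?k \<in> weil_carrier A"
      using insert.prems by (auto simp: weil_carrier_def)
    ultimately have "f (\<lambda>V. if V \<in> insert U K then a V else 0) = weil_add (f ?m) (f ?k)"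
      using weil_homD(5)[OF f] by simp
    then show ?case using insert mult[of U "a U"] by (auto simp: weil_add_def)
  qed
qed

lemma weil_hom_expand:
  assumes "weil_hom A B f" "a \<in> weil_carrier A"
  shows "f a V = (\<Sum>U\<in>weil_basis A. a U * f (weil_monom U) V)"
proof -
  have "(\<lambda>U. if U \<in> weil_basis A then a U else 0) = a"
    using assms(2) by (auto simp: weil_carrier_def)
  with weil_hom_sum_monom[OF assms(1) order_refl, of a] show ?thesis by metis
qed

text \<open>A nonconstant monomial squares to zero, so its image has a constant term whose square is zero;
  hence every morphism preserves constant terms. This is why \<open>\<nat>\<close> is terminal and why a pair of
  morphisms into \<open>W\<close> needs no compatibility condition.\<close>

lemma weil_hom_constant_term:
  assumes f: "weil_hom A B f" and a: "a \<in> weil_carrier A"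
  shows "f a {} = a {}"
proof -
  have z: "f (weil_monom U) {} = 0" if U: "U \<in> weil_basis A" "U \<noteq> {}" for U
  proof -
    have "weil_mult A (weil_monom U) (weil_monom U) S = 0" for S
    proof -
      have "weil_monom U T * weil_monom U (S - T) = 0" for T
        using U by (auto simp: weil_monom_def)
      then show ?thesis by (simp only: weil_mult_def sum.neutral_const if_cancel)
    qed
    then have "weil_mult A (weil_monom U) (weil_monom U) = (\<lambda>S. 0)" by blast
    then have "weil_mult B (f (weil_monom U)) (f (weil_monom U)) {} = 0"
      using weil_homD(2,6)[OF f] U by (metis weil_carrier_intros(3))
    then show ?thesis by simp
  qed
  have "f a {} = (\<Sum>U\<in>weil_basis A. if U = {} then a {} else 0)"
    unfolding weil_hom_expand[OF f a]
    using z weil_homD(3)[OF f] by (intro sum.cong) (auto simp: weil_monom_apply)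
  also have "\<dots> = a {}" by simp
  finally show ?thesis .
qed

lemma pure_tensor_monom:
  "pure_tensor A (weil_monom S) (weil_monom U) V =
    (if U = {i. fst A + i \<in> V} then if S = V \<inter> {..<fst A} then 1 else 0 else 0)"
  by (auto simp: pure_tensor_def weil_monom_def)

lemma split_variables: "(V \<inter> {..<n}) \<union> (+) n ` {i. n + i \<in> V} = (V :: nat set)"
proof -
  have "x \<in> (+) n ` {i. n + i \<in> V}" if "x \<in> V" "\<not> x < n" for x
    using that by (intro image_eqI[of _ _ "x - n"]) auto
  then show ?thesis by auto
qed

text \<open>In the defining sum of \<open>1 \<otimes> 1\<close> only the monomial that splits \<open>V\<close> into its two groups of variables
  contributes. This makes the multiplication of an actegory natural for the functors \<open>T\<^bsub>A\<^esub>\<close> alone.\<close>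

lemma tensor_Ide:
  assumes A: "is_weil A" and B: "is_weil B"
  shows "tensor_arr (Ide Weil A) (Ide Weil B) = Ide Weil (tensor_obj A B)"
proof -
  have "(\<Sum>S\<in>weil_basis A. \<Sum>U\<in>weil_basis B. c (S \<union> (+) (fst A) ` U) *
      pure_tensor A (restrict (\<lambda>a. a) (weil_carrier A) (weil_monom S))
        (restrict (\<lambda>a. a) (weil_carrier B) (weil_monom U)) V) = c V"
    (is "?l = _") if c: "c \<in> weil_carrier (tensor_obj A B)" for c V
  proof -
    let ?S = "V \<inter> {..<fst A}" and ?U = "{i. fst A + i \<in> V}"
    have "?l = (\<Sum>S\<in>weil_basis A. \<Sum>U\<in>weil_basis B.
        if U = ?U then if S = ?S then c (S \<union> (+) (fst A) ` U) else 0 else 0)"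
      by (intro sum.cong refl) (simp add: pure_tensor_monom)
    also have "\<dots> = (\<Sum>S\<in>weil_basis A. if ?U \<in> weil_basis B then
        if S = ?S then c (S \<union> (+) (fst A) ` ?U) else 0 else 0)"
      by (intro sum.cong refl) simp
    also have "\<dots> = (if ?U \<in> weil_basis B then if ?S \<in> weil_basis A then c (?S \<union> (+) (fst A) ` ?U) else 0 else 0)"
      by simp
    also have "\<dots> = c V"
      unfolding split_variables using weil_carrierD[OF c, of V] basis_tensor[OF A, of V B] by auto
    finally show ?thesis .
  qed
  then show ?thesis by (auto simp: tensor_arr_def mk_weil_arr_def intro!: restrict_ext)
qed

text \<open>Tensoring with \<open>\<nat>\<close> is the identity by linearity. It is needed to read off, from the pullbacks
  indexed by \<open>A \<otimes> (B \<times> C)\<close>, the case \<open>A = \<nat>\<close>.\<close>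

lemma tensor_Ide_N:
  assumes "\<theta> \<in> hom Weil A B"
  shows "tensor_arr (Ide Weil N_obj) \<theta> = \<theta>"
proof -
  obtain f where \<theta>: "\<theta> = (A, B, f)" and f: "weil_hom A B f" using assms by (auto simp: hom_Weil_iff)
  have [simp]: "fst N_obj = 0" "(+) (0::nat) = (\<lambda>x. x)" by (auto simp: N_obj_def W_pow_def)
  have "(\<Sum>S\<in>weil_basis N_obj. \<Sum>U\<in>weil_basis A. c (S \<union> (+) (fst N_obj) ` U) *
      pure_tensor N_obj (restrict (\<lambda>a. a) (weil_carrier N_obj) (weil_monom S)) (f (weil_monom U)) V) = f c V"
    if "c \<in> weil_carrier A" for c V
    by (simp add: basis_N pure_tensor_def weil_monom_def[of "{}"] weil_carrier_def[of N_obj]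
        weil_hom_expand[OF f that])
  then have "restrict (\<lambda>c V. \<Sum>S\<in>weil_basis N_obj. \<Sum>U\<in>weil_basis A. c (S \<union> (+) (fst N_obj) ` U) *
      pure_tensor N_obj (restrict (\<lambda>a. a) (weil_carrier N_obj) (weil_monom S)) (f (weil_monom U)) V)
      (weil_carrier A) = f"
    using weil_homD(4)[OF f] by (intro extensionalityI[of _ "weil_carrier A"]) auto
  then show ?thesis
    by (simp add: \<theta> tensor_arr_def mk_weil_arr_def tensor_obj_N)
qed

text \<open>A pair \<open>u, v : Z \<rightarrow> W\<close> corresponds to the morphism whose coefficients at \<open>x\<^sub>0\<close> and \<open>x\<^sub>1\<close> are those of
  \<open>u\<close> and \<open>v\<close> at \<open>x\<close>; the constant terms of \<open>u\<close> and \<open>v\<close> agree automatically. It is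
  multiplicative because \<open>x\<^sub>0 x\<^sub>1 = 0\<close>.\<close>

lemma product_W_W: "is_product Weil W W (W_pow 2) (weil_proj 0) (weil_proj 1)"
  unfolding is_product_def
proof (intro conjI allI impI)
  show "weil_proj 0 \<in> hom Weil (W_pow 2) W" "weil_proj 1 \<in> hom Weil (W_pow 2) W"
    by (simp_all add: weil_proj_hom)
  fix Z \<theta> \<theta>' assume *: "\<theta> \<in> hom Weil Z W \<and> \<theta>' \<in> hom Weil Z W"
  then obtain u v where \<theta>: "\<theta> = (Z, W, u)" "\<theta>' = (Z, W, v)" and Z: "is_weil Z"
    and u: "weil_hom Z W u" and v: "weil_hom Z W v"
    by (auto simp: hom_Weil_iff)
  note uD = weil_homD[OF u] and vD = weil_homD[OF v]
  note const = weil_hom_constant_term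
  let ?h = "\<lambda>a S. if S = {} then a {} else if S = {0} then u a {0} else if S = {1} then v a {0} else (0::nat)"
  have h: "weil_hom Z (W_pow 2) (restrict ?h (weil_carrier Z))"
  proof (rule weil_hom_restrict)
    fix a b assume ab: "a \<in> weil_carrier Z" "b \<in> weil_carrier Z"
    show "?h (weil_mult Z a b) = weil_mult (W_pow 2) (?h a) (?h b)"
    proof
      fix S :: "nat set"
      consider "S = {}" | "S = {0}" | "S = {1}" | "S \<notin> {{}, {0}, {1}}" by blast
      then show "?h (weil_mult Z a b) S = weil_mult (W_pow 2) (?h a) (?h b) S"
        by cases (auto simp: uD vD ab const[OF u] const[OF v] basis_W basis_W2 weil_mult_single)
    qed
  next
    fix a b assume ab: "a \<in> weil_carrier Z" "b \<in> weil_carrier Z"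
    show "?h (weil_add a b) = weil_add (?h a) (?h b)"
      unfolding uD(5)[OF ab] vD(5)[OF ab] by (auto simp: weil_add_def)
  qed (auto simp: weil_carrier_def[of "W_pow 2"] basis_W2 uD(2,3) vD(2,3) weil_monom_apply fun_eq_iff weil_carrierD)
  let ?\<eta> = "mk_weil_arr Z (W_pow 2) ?h"
  have proj: "weil_proj i = (W_pow 2, W, \<lambda>a\<in>weil_carrier (W_pow 2).
      \<lambda>S. if S = {} then a {} else if S = {0} then a {i} else 0)" for i
    by (simp add: weil_proj_def mk_weil_arr_def)
  have W_eq: "c = (\<lambda>S. if S = {} then c {} else if S = {0} then c {0} else 0)"
    if "c \<in> weil_carrier W" for c
    using that by (auto simp: weil_carrier_def basis_W fun_eq_iff)
  show "\<exists>!\<eta>. \<eta> \<in> hom Weil Z (W_pow 2) \<and> Cmp Weil (weil_proj 0) \<eta> = \<theta> \<and> Cmp Weil (weil_proj 1) \<eta> = \<theta>'"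
  proof
    have m: "?h a \<in> weil_carrier (W_pow 2)" if "a \<in> weil_carrier Z" for a
      using weil_homD(1)[OF h, of a] that by simp
    have "restrict ((\<lambda>a\<in>weil_carrier (W_pow 2). \<lambda>S. if S = {} then a {} else if S = {0} then a {i} else 0) \<circ>
        restrict ?h (weil_carrier Z)) (weil_carrier Z) = g"
      if g: "weil_hom Z W g" and gi: "\<And>a. g a {0} = ?h a {i}" for g i
    proof (rule extensionalityI)
      show "g \<in> extensional (weil_carrier Z)" using weil_homD(4)[OF g] .
      fix a assume a: "a \<in> weil_carrier Z"
      have "(\<lambda>S. if S = {} then g a {} else if S = {0} then g a {0} else 0) = g a"
        using W_eq[OF weil_homD(1)[OF g a]] by metis
      then show "restrict ((\<lambda>a\<in>weil_carrier (W_pow 2). \<lambda>S. if S = {} then a {} else if S = {0} then a {i} else 0) \<circ>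
        restrict ?h (weil_carrier Z)) (weil_carrier Z) a = g a"
        using a m[OF a] by (simp only: restrict_apply' o_apply gi const[OF g a] simp_thms if_True)
    qed simp
    from this[OF u, of 0] this[OF v, of 1]
    have "Cmp Weil (weil_proj 0) ?\<eta> = \<theta>" "Cmp Weil (weil_proj 1) ?\<eta> = \<theta>'"
      by (simp_all add: proj \<theta> mk_weil_arr_def del: One_nat_def)
    then show "?\<eta> \<in> hom Weil Z (W_pow 2) \<and> Cmp Weil (weil_proj 0) ?\<eta> = \<theta> \<and> Cmp Weil (weil_proj 1) ?\<eta> = \<theta>'"
      using hom_WeilI[OF Z is_weil_W_pow h] by blast
  next
    fix \<eta> assume \<eta>: "\<eta> \<in> hom Weil Z (W_pow 2) \<and> Cmp Weil (weil_proj 0) \<eta> = \<theta> \<and> Cmp Weil (weil_proj 1) \<eta> = \<theta>'"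
    then obtain k where k: "\<eta> = (Z, W_pow 2, k)" "weil_hom Z (W_pow 2) k" by (auto simp: hom_Weil_iff)
    note kD = weil_homD[OF k(2)]
    have ku: "k a {0} = u a {0}" and kv: "k a {1} = v a {0}" if a: "a \<in> weil_carrier Z" for a
    proof -
      have *: "g a {0} = k a {i}" if "Cmp Weil (weil_proj i) \<eta> = (Z, W, g)" for g i
      proof -
        have "g = restrict ((\<lambda>a\<in>weil_carrier (W_pow 2). \<lambda>S. if S = {} then a {} else if S = {0} then a {i} else 0) \<circ> k) (weil_carrier Z)"
          using that by (simp add: k proj mk_weil_arr_def)
        then show ?thesis using a kD(1)[OF a] by simp
      qed
      show "k a {0} = u a {0}" "k a {1} = v a {0}" using * \<eta> \<theta> by auto
    qed
    have "k = restrict ?h (weil_carrier Z)"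
    proof (rule extensionalityI[OF kD(4)])
      fix a assume a: "a \<in> weil_carrier Z"
      have "k a S = ?h a S" for S
        using weil_carrierD[OF kD(1)[OF a], of S] ku[OF a] kv[OF a] const[OF k(2) a]
        by (auto simp: basis_W2)
      then show "k a = restrict ?h (weil_carrier Z) a" using a by auto
    qed simp
    then show "\<eta> = ?\<eta>" by (simp add: k mk_weil_arr_def)
  qed
qed



section \<open>Tangent actegories\<close>

locale acteg =
  fixes X :: "('o, 'm) actegory"
  assumes weil_actegory: "weil_actegory X"
begin

abbreviation C where "C \<equiv> und X"

lemma act_functor: "is_functor (cat_prod Weil C) C (act X)"
  using weil_actegory by (simp add: weil_actegory_def Let_def)

sublocale category "und X"
  using act_functor by (simp add: is_functor_def)

lemma Tact_arr [simp]:
  assumes "\<theta> \<in> hom Weil A B" "f \<in> Arr C"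
  shows "Tact X \<theta> f \<in> Arr C" "Dom C (Tact X \<theta> f) = Tobj X A (Dom C f)"
    "Cod C (Tact X \<theta> f) = Tobj X B (Cod C f)"
proof -
  have "(\<theta>, f) \<in> hom (cat_prod Weil C) (A, Dom C f) (B, Cod C f)"
    using assms by (auto simp: hom_def cat_prod_def)
  then have "farr (act X) (\<theta>, f) \<in> hom C (fobj (act X) (A, Dom C f)) (fobj (act X) (B, Cod C f))"
    using act_functor unfolding is_functor_def by blast
  then show "Tact X \<theta> f \<in> Arr C" "Dom C (Tact X \<theta> f) = Tobj X A (Dom C f)"
    "Cod C (Tact X \<theta> f) = Tobj X B (Cod C f)"
    by (auto simp: hom_def Tact_def Tobj_def)
qed

lemma Tact_Cmp:
  assumes "\<theta> \<in> hom Weil A B" "\<theta>' \<in> hom Weil B D" "f \<in> Arr C" "g \<in> Arr C"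
    "Dom C g = Cod C f"
  shows "Tact X (Cmp Weil \<theta>' \<theta>) (Cmp C g f) = Cmp C (Tact X \<theta>' g) (Tact X \<theta> f)"
proof -
  have "(\<theta>, f) \<in> hom (cat_prod Weil C) (A, Dom C f) (B, Cod C f)"
    "(\<theta>', g) \<in> hom (cat_prod Weil C) (B, Cod C f) (D, Cod C g)"
    using assms by (auto simp: hom_def cat_prod_def)
  then have "farr (act X) (Cmp (cat_prod Weil C) (\<theta>', g) (\<theta>, f)) =
      Cmp C (farr (act X) (\<theta>', g)) (farr (act X) (\<theta>, f))"
    using act_functor unfolding is_functor_def by blast
  then show ?thesis by (simp add: Tact_def cat_prod_def)
qed

lemma Ide_Weil_hom: "A \<in> Obj Weil \<Longrightarrow> Ide Weil A \<in> hom Weil A A"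
  by (rule Weil.Ide_in)

lemma functorial_T:
  assumes A: "A \<in> Obj Weil"
  shows "functorial C C (Tobj X A) (Tarr X A)"
proof
  note I = Ide_Weil_hom[OF A]
  fix f assume "f \<in> Arr C"
  then show "Tarr X A f \<in> Arr C" "Dom C (Tarr X A f) = Tobj X A (Dom C f)"
    "Cod C (Tarr X A f) = Tobj X A (Cod C f)"
    using Tact_arr[OF I] by (simp_all only: Tarr_def)
next
  fix a assume a: "a \<in> Obj C"
  have "\<forall>a\<in>Obj (cat_prod Weil C). farr (act X) (Ide (cat_prod Weil C) a) = Ide C (fobj (act X) a)"
    using act_functor by (simp add: is_functor_def)
  from this[rule_format, of "(A, a)"] show "Tarr X A (Ide C a) = Ide C (Tobj X A a)"
    using A a by (simp add: cat_prod_def Tarr_def Tact_def Tobj_def)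
next
  note I = Ide_Weil_hom[OF A]
  fix f g assume "f \<in> Arr C" "g \<in> Arr C" "Dom C g = Cod C f"
  from Tact_Cmp[OF I I this]
  show "Tarr X A (Cmp C g f) = Cmp C (Tarr X A g) (Tarr X A f)"
    using Weil.Cmp_Ide[OF I] by (simp only: Tarr_def)
qed

lemma Tarr_simps [simp]:
  assumes "A \<in> Obj Weil"
  shows "f \<in> Arr C \<Longrightarrow> Tarr X A f \<in> Arr C"
    "f \<in> Arr C \<Longrightarrow> Dom C (Tarr X A f) = Tobj X A (Dom C f)"
    "f \<in> Arr C \<Longrightarrow> Cod C (Tarr X A f) = Tobj X A (Cod C f)"
    "a \<in> Obj C \<Longrightarrow> Tobj X A a \<in> Obj C"
    "a \<in> Obj C \<Longrightarrow> Tarr X A (Ide C a) = Ide C (Tobj X A a)"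
  using functorial.arr[OF functorial_T] functorial.Dom_arr[OF functorial_T] functorial.Cod_arr[OF functorial_T]
    functorial.obj[OF functorial_T] functorial.pres_Ide[OF functorial_T] assms by auto

lemma Tarr_Cmp:
  "A \<in> Obj Weil \<Longrightarrow> f \<in> Arr C \<Longrightarrow> g \<in> Arr C \<Longrightarrow> Dom C g = Cod C f \<Longrightarrow>
   Tarr X A (Cmp C g f) = Cmp C (Tarr X A g) (Tarr X A f)"
  using functorial.pres_Cmp[OF functorial_T] by blast

lemma Tnat_arr:
  assumes "\<theta> \<in> hom Weil A B" "x \<in> Obj C"
  shows "Tnat X \<theta> x \<in> Arr C" "Dom C (Tnat X \<theta> x) = Tobj X A x"
    "Cod C (Tnat X \<theta> x) = Tobj X B x"
  using Tact_arr[OF assms(1), of "Ide C x"] assms by (simp_all add: Tnat_def)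

lemma Tnat_natural:
  assumes "\<theta> \<in> hom Weil A B" "f \<in> Arr C"
  shows "Cmp C (Tnat X \<theta> (Cod C f)) (Tarr X A f) =
    Cmp C (Tarr X B f) (Tnat X \<theta> (Dom C f))"
proof -
  have AB: "A \<in> Obj Weil" "B \<in> Obj Weil" using assms by (auto simp: hom_Weil_iff)
  have "Cmp C (Tnat X \<theta> (Cod C f)) (Tarr X A f) = Tact X \<theta> f"
    using Tact_Cmp[OF Ide_Weil_hom[OF AB(1)] assms(1), of f "Ide C (Cod C f)"]
      Weil.Cmp_Ide[OF assms(1)] assms(2) by (simp add: Tnat_def Tarr_def del: Weil_simps)
  moreover have "Cmp C (Tarr X B f) (Tnat X \<theta> (Dom C f)) = Tact X \<theta> f"
    using Tact_Cmp[OF assms(1) Ide_Weil_hom[OF AB(2)], of "Ide C (Dom C f)" f]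
      Weil.Ide_Cmp[OF assms(1)] assms(2) by (simp add: Tnat_def Tarr_def del: Weil_simps)
  ultimately show ?thesis by simp
qed

lemma act_unit:
  assumes "x \<in> Obj C"
  shows "act_unit X x \<in> Arr C" "Dom C (act_unit X x) = x"
    "Cod C (act_unit X x) = Tobj X N_obj x" "is_iso C (act_unit X x)"
  using weil_actegory assms by (auto simp: weil_actegory_def Let_def hom_def)

lemma act_unit_natural:
  assumes "f \<in> Arr C"
  shows "Cmp C (Tarr X N_obj f) (act_unit X (Dom C f)) =
    Cmp C (act_unit X (Cod C f)) f"
  using weil_actegory assms by (auto simp: weil_actegory_def Let_def hom_def)

lemma act_mult:
  assumes "A \<in> Obj Weil" "B \<in> Obj Weil" "x \<in> Obj C"
  shows "act_mult X A B x \<in> Arr C" "Dom C (act_mult X A B x) = Tobj X A (Tobj X B x)"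
    "Cod C (act_mult X A B x) = Tobj X (tensor_obj A B) x" "is_iso C (act_mult X A B x)"
  using weil_actegory assms by (auto simp: weil_actegory_def Let_def hom_def)

lemma act_mult_natural:
  assumes A: "A \<in> Obj Weil" and B: "B \<in> Obj Weil" and f: "f \<in> Arr C"
  shows "Cmp C (act_mult X A B (Cod C f)) (Tarr X A (Tarr X B f)) =
    Cmp C (Tarr X (tensor_obj A B) f) (act_mult X A B (Dom C f))"
proof -
  have "\<forall>A A' \<theta> B B' \<theta>' x y f.
      \<theta> \<in> hom Weil A A' \<and> \<theta>' \<in> hom Weil B B' \<and> f \<in> hom C x y \<longrightarrow>
      Cmp C (act_mult X A' B' y) (Tact X \<theta> (Tact X \<theta>' f)) =
      Cmp C (Tact X (tensor_arr \<theta> \<theta>') f) (act_mult X A B x)"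
    using weil_actegory by (simp add: weil_actegory_def Let_def)
  then have "Cmp C (act_mult X A B (Cod C f)) (Tact X (Ide Weil A) (Tact X (Ide Weil B) f)) =
      Cmp C (Tact X (tensor_arr (Ide Weil A) (Ide Weil B)) f) (act_mult X A B (Dom C f))"
    using Ide_Weil_hom[OF A] Ide_Weil_hom[OF B] f by (auto simp only: hom_def mem_Collect_eq)
  then show ?thesis using tensor_Ide[of A B] A B by (simp add: Tarr_def)
qed


subsection \<open>The tangent structure maps\<close>

lemma tan_p_arr [simp]:
  assumes "x \<in> Obj C"
  shows "tan_p X x \<in> Arr C" "Dom C (tan_p X x) = Tobj X W x" "Cod C (tan_p X x) = x"
  using inverse_arrowsD[OF inv_arr[OF act_unit(4)[OF assms]]] act_unit[OF assms]
    Tnat_arr[OF weil_p_hom assms] by (simp_all add: tan_p_def)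

lemma tan_0_arr [simp]:
  assumes "x \<in> Obj C"
  shows "tan_0 X x \<in> Arr C" "Dom C (tan_0 X x) = x" "Cod C (tan_0 X x) = Tobj X W x"
  using act_unit[OF assms] Tnat_arr[OF weil_0_hom assms] by (simp_all add: tan_0_def)

lemma tan_plus_arr [simp]:
  assumes "x \<in> Obj C"
  shows "tan_plus X x \<in> Arr C" "Dom C (tan_plus X x) = Tobj X (W_pow 2) x"
    "Cod C (tan_plus X x) = Tobj X W x"
  using Tnat_arr[OF weil_plus_hom assms] by (simp_all add: tan_plus_def)

lemma tan_l_arr [simp]:
  assumes "x \<in> Obj C"
  shows "tan_l X x \<in> Arr C" "Dom C (tan_l X x) = Tobj X W x"
    "Cod C (tan_l X x) = Tobj X W (Tobj X W x)"
  using inverse_arrowsD[OF inv_arr[OF act_mult(4)[OF W_in_Weil W_in_Weil assms]]]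
    act_mult[OF W_in_Weil W_in_Weil assms] Tnat_arr[OF weil_l_hom assms]
  by (simp_all add: tan_l_def)

lemma tan_0_natural:
  assumes f: "f \<in> Arr C"
  shows "Cmp C (tan_0 X (Cod C f)) f = Cmp C (Tarr X W f) (tan_0 X (Dom C f))"
proof -
  let ?x = "Dom C f" and ?y = "Cod C f"
  have xy: "?x \<in> Obj C" "?y \<in> Obj C" using f by auto
  note u = act_unit[OF xy(1)] act_unit[OF xy(2)] Tnat_arr[OF weil_0_hom xy(1)] Tnat_arr[OF weil_0_hom xy(2)]
  have "Cmp C (tan_0 X ?y) f = Cmp C (Tnat X weil_0 ?y) (Cmp C (act_unit X ?y) f)"
    using u f by (simp add: tan_0_def)
  also have "\<dots> = Cmp C (Tnat X weil_0 ?y) (Cmp C (Tarr X N_obj f) (act_unit X ?x))"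
    by (simp add: act_unit_natural f)
  also have "\<dots> = Cmp C (Tarr X W f) (Cmp C (Tnat X weil_0 ?x) (act_unit X ?x))"
    by (rule Cmp_cong_right[OF Tnat_natural[OF weil_0_hom f]]) (simp_all add: u f)
  finally show ?thesis by (simp add: tan_0_def)
qed


subsection \<open>Iterated tangent functors\<close>

lemma functorial_T_pow: "functorial C C (Tobj X W ^^ k) (Tarr X W ^^ k)"
  by (rule functorial_funpow[OF functorial_T[OF W_in_Weil]])

text \<open>As \<open>T\<^bsub>\<nat>\<^esub>\<close> is isomorphic to the identity, preservation by \<open>T\<^bsub>\<nat>\<^esub> H\<close> is preservation by \<open>H\<close>.\<close>

lemma preserves_pullbacks_over_unit:
  assumes H: "functorial B C Ho Ha"
    and pr: "preserves_pullbacks_over B C (\<lambda>x. Tobj X N_obj (Ho x)) (\<lambda>f. Tarr X N_obj (Ha f)) b"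
  shows "preserves_pullbacks_over B C Ho Ha b"
proof -
  interpret H: functorial B "und X" Ho Ha by fact
  show ?thesis
  proof (rule functorial.preserves_pullbacks_over_nat_iso
      [OF functorial_comp[OF H functorial_T[OF N_in_Weil]] H pr, where \<iota> = "\<lambda>a. act_unit X (Ho a)"])
    show "Cmp C (act_unit X (Ho (Cod B f))) (Ha f) =
        Cmp C (Tarr X N_obj (Ha f)) (act_unit X (Ho (Dom B f)))" if "f \<in> Arr B" for f
      using act_unit_natural[OF H.arr[OF that]] that by simp
  qed (auto simp: act_unit)
qed

text \<open>As \<open>T\<^bsub>A\<^esub> T\<^bsub>W\<^esub>\<close> is isomorphic to \<open>T\<^bsub>A \<otimes> W\<^esub>\<close>, quantifying over all Weil
  algebras \<open>A\<close> lets preservation pass to the powers of the tangent functor by induction.\<close>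

lemma preserves_pullbacks_over_T_pow:
  assumes H: "functorial B C Ho Ha"
    and pr: "\<And>A. A \<in> Obj Weil \<Longrightarrow>
      preserves_pullbacks_over B C (\<lambda>x. Tobj X A (Ho x)) (\<lambda>f. Tarr X A (Ha f)) b"
  shows "preserves_pullbacks_over B C (\<lambda>x. (Tobj X W ^^ k) (Ho x)) (\<lambda>f. (Tarr X W ^^ k) (Ha f)) b"
proof -
  have "preserves_pullbacks_over B C (\<lambda>x. Tobj X A ((Tobj X W ^^ k) (Ho x)))
      (\<lambda>f. Tarr X A ((Tarr X W ^^ k) (Ha f))) b" if "A \<in> Obj Weil" for A
    using that
  proof (induction k arbitrary: A)
    case 0
    then show ?case using pr by simp
  next
    case (Suc k)
    have AW: "tensor_obj A W \<in> Obj Weil" by (rule tensor_in_Weil[OF Suc.prems W_in_Weil])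
    have Hk: "functorial B C (\<lambda>x. (Tobj X W ^^ k) (Ho x)) (\<lambda>f. (Tarr X W ^^ k) (Ha f))"
      by (rule functorial_comp[OF H functorial_T_pow])
    interpret Hk: functorial B "und X" "\<lambda>x. (Tobj X W ^^ k) (Ho x)" "\<lambda>f. (Tarr X W ^^ k) (Ha f)" by fact
    have H1: "functorial B C (\<lambda>x. Tobj X A (Tobj X W ((Tobj X W ^^ k) (Ho x))))
        (\<lambda>f. Tarr X A (Tarr X W ((Tarr X W ^^ k) (Ha f))))"
      by (rule functorial_comp[OF functorial_comp[OF Hk functorial_T[OF W_in_Weil]] functorial_T[OF Suc.prems]])
    have "preserves_pullbacks_over B C (\<lambda>x. Tobj X A (Tobj X W ((Tobj X W ^^ k) (Ho x))))
        (\<lambda>f. Tarr X A (Tarr X W ((Tarr X W ^^ k) (Ha f)))) b"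
    proof (rule functorial.preserves_pullbacks_over_nat_iso
        [OF functorial_comp[OF Hk functorial_T[OF AW]] H1 Suc.IH[OF AW],
          where \<iota> = "\<lambda>a. act_mult X A W ((Tobj X W ^^ k) (Ho a))"])
      show "Cmp C (act_mult X A W ((Tobj X W ^^ k) (Ho (Cod B f))))
          (Tarr X A (Tarr X W ((Tarr X W ^^ k) (Ha f)))) =
        Cmp C (Tarr X (tensor_obj A W) ((Tarr X W ^^ k) (Ha f)))
          (act_mult X A W ((Tobj X W ^^ k) (Ho (Dom B f))))" if "f \<in> Arr B" for f
        using act_mult_natural[OF Suc.prems W_in_Weil Hk.arr[OF that]] that by simp
    qed (use act_mult[OF Suc.prems W_in_Weil Hk.obj] in auto)
    then show ?case by simp
  qed
  from this[OF N_in_Weil] show ?thesis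
    by (rule preserves_pullbacks_over_unit[OF functorial_comp[OF H functorial_T_pow]])
qed

end

locale tangent_acteg = acteg +
  assumes tangent_actegory: "tangent_actegory X"
begin

text \<open>The product \<open>W \<times> W\<close> in \<open>Weil\<close> gives a pullback over \<open>T\<^bsub>\<nat>\<^esub> x\<close>, which is then moved to the
  isomorphic base \<open>x\<close>, where \<open>p\<close> takes its values.\<close>

lemma tangent_bundle_pullback:
  assumes x: "x \<in> Obj C"
  shows "is_pullback C (Tobj X (W_pow 2) x) (Tnat X (weil_proj 0) x) (Tnat X (weil_proj 1) x)
    (tan_p X x) (tan_p X x)"
proof -
  have "is_pullback C (Tobj X (tensor_obj N_obj (W_pow 2)) x)
      (Tnat X (tensor_arr (Ide Weil N_obj) (weil_proj 0)) x)
      (Tnat X (tensor_arr (Ide Weil N_obj) (weil_proj 1)) x)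
      (Tnat X (tensor_arr (Ide Weil N_obj) (weil_bang W)) x)
      (Tnat X (tensor_arr (Ide Weil N_obj) (weil_bang W)) x)"
    using tangent_actegory x product_W_W N_in_Weil W_in_Weil unfolding tangent_actegory_def by blast
  moreover have "tensor_arr (Ide Weil N_obj) (weil_proj 0) = weil_proj 0"
    "tensor_arr (Ide Weil N_obj) (weil_proj 1) = weil_proj 1"
    "tensor_arr (Ide Weil N_obj) (weil_bang W) = weil_p"
    using tensor_Ide_N[OF weil_proj_hom[of 0]] tensor_Ide_N[OF weil_proj_hom[of 1]]
      tensor_Ide_N[OF weil_p_hom] unfolding weil_p_def by simp_all
  ultimately have "is_pullback C (Tobj X (W_pow 2) x) (Tnat X (weil_proj 0) x)
      (Tnat X (weil_proj 1) x) (Tnat X weil_p x) (Tnat X weil_p x)"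
    by (simp only: tensor_obj_N)
  moreover have "inverse_arrows C (inv_arr C (act_unit X x)) (act_unit X x)"
    using inverse_arrowsD[OF inv_arr[OF act_unit(4)[OF x]]] by (simp add: inverse_arrows_def hom_def)
  ultimately show ?thesis
    using Tnat_arr[OF weil_p_hom x] act_unit[OF x] inverse_arrowsD[OF inv_arr[OF act_unit(4)[OF x]]]
    unfolding tan_p_def by (subst pullback_cospan_iso) simp_all
qed

end

lemma tangent_acteg_iff: "tangent_acteg X \<longleftrightarrow> tangent_actegory X"
  by (auto simp: tangent_acteg_def tangent_acteg_axioms_def acteg_def tangent_actegory_def)


section \<open>Differential functors\<close>

locale oplax = X: tangent_acteg X + X': tangent_acteg X'
  for X :: "('o, 'm) actegory" and X' :: "('p, 'q) actegory" +
  fixes F :: "('o, 'm, 'p, 'q) ftor" and \<alpha> :: "weil_obj \<times> 'o \<Rightarrow> 'q"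
  assumes oplax_linear: "oplax_linear X X' (F, \<alpha>)"
begin

abbreviation C where "C \<equiv> und X"
abbreviation C' where "C' \<equiv> und X'"

sublocale F: functorial "und X" "und X'" "fobj F" "farr F"
  using oplax_linear by (intro functorial_is_functor) (simp add: oplax_linear_def Let_def)

lemma \<alpha>_nat_trans:
  "nat_trans (cat_prod Weil C) C' (ftor_comp (cat_prod Weil C) F (act X))
     (ftor_comp (cat_prod Weil C) (act X')
       (ftor_prod Weil C (mk_ftor Weil (\<lambda>A. A) (\<lambda>\<theta>. \<theta>)) F)) \<alpha>"
  using oplax_linear by (simp add: oplax_linear_def Let_def)

lemma \<alpha>_arr [simp]:
  assumes "A \<in> Obj Weil" "x \<in> Obj C"
  shows "\<alpha> (A, x) \<in> Arr C'" "Dom C' (\<alpha> (A, x)) = fobj F (Tobj X A x)"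
    "Cod C' (\<alpha> (A, x)) = Tobj X' A (fobj F x)"
  using \<alpha>_nat_trans assms
  by (auto simp: nat_trans_def ftor_comp_def ftor_prod_def mk_ftor_def cat_prod_def hom_def Tobj_def)

lemma \<alpha>_natural:
  assumes \<theta>: "\<theta> \<in> hom Weil A B" and f: "f \<in> Arr C"
  shows "Cmp C' (\<alpha> (B, Cod C f)) (farr F (Tact X \<theta> f)) =
    Cmp C' (Tact X' \<theta> (farr F f)) (\<alpha> (A, Dom C f))"
proof -
  have AB: "A \<in> Obj Weil" "B \<in> Obj Weil" using \<theta> by (auto simp: hom_Weil_iff)
  have \<theta>A: "\<theta> \<in> Arr Weil" using \<theta> by (simp add: hom_def)
  have *: "(\<theta>, f) \<in> hom (cat_prod Weil C) (A, Dom C f) (B, Cod C f)"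
    using \<theta> f by (auto simp: hom_def cat_prod_def)
  have "\<forall>a b t. t \<in> hom (cat_prod Weil C) a b \<longrightarrow>
     Cmp C' (\<alpha> b) (farr (ftor_comp (cat_prod Weil C) F (act X)) t) =
     Cmp C' (farr (ftor_comp (cat_prod Weil C) (act X')
       (ftor_prod Weil C (mk_ftor Weil (\<lambda>A. A) (\<lambda>\<theta>. \<theta>)) F)) t) (\<alpha> a)"
    using \<alpha>_nat_trans by (simp add: nat_trans_def)
  from this[rule_format, OF *] show ?thesis
    using AB \<theta>A f by (simp add: ftor_comp_def ftor_prod_def mk_ftor_def cat_prod_def Tact_def)
qed

lemma \<alpha>_Tarr:
  assumes A: "A \<in> Obj Weil" and f: "f \<in> Arr C"
  shows "Cmp C' (\<alpha> (A, Cod C f)) (farr F (Tarr X A f)) =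
    Cmp C' (Tarr X' A (farr F f)) (\<alpha> (A, Dom C f))"
  using \<alpha>_natural[OF X.Ide_Weil_hom[OF A] f] by (simp only: Tarr_def)

lemma \<alpha>_Tnat:
  assumes \<theta>: "\<theta> \<in> hom Weil A B" and x: "x \<in> Obj C"
  shows "Cmp C' (\<alpha> (B, x)) (farr F (Tnat X \<theta> x)) = Cmp C' (Tnat X' \<theta> (fobj F x)) (\<alpha> (A, x))"
  using \<alpha>_natural[OF \<theta>, of "Ide C x"] x by (simp add: Tnat_def)

lemma \<alpha>_unit:
  "x \<in> Obj C \<Longrightarrow> Cmp C' (\<alpha> (N_obj, x)) (farr F (act_unit X x)) = act_unit X' (fobj F x)"
  using oplax_linear by (simp add: oplax_linear_def Let_def)

lemma \<alpha>_mult: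
  "A \<in> Obj Weil \<Longrightarrow> B \<in> Obj Weil \<Longrightarrow> x \<in> Obj C \<Longrightarrow>
   Cmp C' (\<alpha> (tensor_obj A B, x)) (farr F (act_mult X A B x)) =
   Cmp C' (act_mult X' A B (fobj F x)) (Cmp C' (Tarr X' A (\<alpha> (B, x))) (\<alpha> (A, Tobj X B x)))"
  using oplax_linear by (simp add: oplax_linear_def Let_def del: Weil_simps)

text \<open>The maps \<open>0\<close>, \<open>p\<close> and \<open>\<ell>\<close> of a tangent structure are components of \<open>T\<^bsub>\<theta>\<^esub>\<close> corrected by unit or
  multiplication isomorphisms. Naturality of \<open>\<alpha>\<close> in \<open>\<theta>\<close> handles the former and the coherence of
  \<open>\<alpha>\<close> the latter; where the isomorphism occurs inverted, in \<open>p\<close> and \<open>\<ell>\<close>, the equation is proved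
  after composing with it.\<close>

lemma \<alpha>_0:
  assumes x: "x \<in> Obj C"
  shows "Cmp C' (\<alpha> (W, x)) (farr F (tan_0 X x)) = tan_0 X' (fobj F x)"
proof -
  note t = X.act_unit[OF x] X.Tnat_arr[OF weil_0_hom x] X'.Tnat_arr[OF weil_0_hom F.obj[OF x]]
    \<alpha>_arr[OF W_in_Weil x] \<alpha>_arr[OF N_in_Weil x]
  have "Cmp C' (\<alpha> (W, x)) (farr F (tan_0 X x)) =
      Cmp C' (\<alpha> (W, x)) (Cmp C' (farr F (Tnat X weil_0 x)) (farr F (act_unit X x)))"
    unfolding tan_0_def by (simp add: F.pres_Cmp t)
  also have "\<dots> = Cmp C' (Tnat X' weil_0 (fobj F x)) (Cmp C' (\<alpha> (N_obj, x)) (farr F (act_unit X x)))"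
    by (rule X'.Cmp_cong_right[OF \<alpha>_Tnat[OF weil_0_hom x]]) (simp_all add: t)
  finally show ?thesis by (simp add: \<alpha>_unit[OF x] tan_0_def)
qed

lemma \<alpha>_p:
  assumes x: "x \<in> Obj C"
  shows "Cmp C' (tan_p X' (fobj F x)) (\<alpha> (W, x)) = farr F (tan_p X x)"
proof -
  note i = X.inv_arr[OF X.act_unit(4)[OF x]] and i' = X'.inv_arr[OF X'.act_unit(4)[OF F.obj[OF x]]]
  note t = X.act_unit[OF x] X'.act_unit[OF F.obj[OF x]] X.Tnat_arr[OF weil_p_hom x]
    X'.Tnat_arr[OF weil_p_hom F.obj[OF x]] \<alpha>_arr[OF W_in_Weil x] \<alpha>_arr[OF N_in_Weil x]
    X.inverse_arrowsD(2-4)[OF i] X'.inverse_arrowsD(2-4)[OF i']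
  have "Cmp C' (act_unit X' (fobj F x)) (farr F (tan_p X x)) =
      Cmp C' (\<alpha> (N_obj, x)) (Cmp C' (farr F (act_unit X x)) (farr F (tan_p X x)))"
    by (rule X'.Cmp_cong_right1[symmetric, OF \<alpha>_unit[OF x]]) (simp_all add: t x)
  also have "\<dots> = Cmp C' (\<alpha> (N_obj, x)) (farr F (Cmp C (act_unit X x) (tan_p X x)))"
    by (simp add: F.pres_Cmp t x)
  also have "\<dots> = Cmp C' (\<alpha> (N_obj, x)) (farr F (Tnat X weil_p x))"
    unfolding tan_p_def by (simp add: X.inverse_arrowsD_right(2)[OF i] t)
  also have "\<dots> = Cmp C' (Tnat X' weil_p (fobj F x)) (\<alpha> (W, x))"
    by (rule \<alpha>_Tnat[OF weil_p_hom x])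
  also have "\<dots> = Cmp C' (act_unit X' (fobj F x)) (Cmp C' (tan_p X' (fobj F x)) (\<alpha> (W, x)))"
    unfolding tan_p_def by (simp add: X'.inverse_arrowsD_right(2)[OF i'] t)
  finally have "farr F (tan_p X x) = Cmp C' (tan_p X' (fobj F x)) (\<alpha> (W, x))"
    by (rule X'.iso_cancel[OF i']) (simp_all add: t x)
  then show ?thesis by simp
qed

lemma \<alpha>_l:
  assumes x: "x \<in> Obj C"
  shows "Cmp C' (tan_l X' (fobj F x)) (\<alpha> (W, x)) =
    Cmp C' (Tarr X' W (\<alpha> (W, x))) (Cmp C' (\<alpha> (W, Tobj X W x)) (farr F (tan_l X x)))"
proof -
  let ?\<mu> = "act_mult X W W x" and ?\<mu>' = "act_mult X' W W (fobj F x)"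
  have Tx: "Tobj X W x \<in> Obj C" using x X.Tarr_simps(4)[OF W_in_Weil] by blast
  have WW: "tensor_obj W W \<in> Obj Weil" by (rule tensor_in_Weil[OF W_in_Weil W_in_Weil])
  note m = X.act_mult[OF W_in_Weil W_in_Weil x] and m' = X'.act_mult[OF W_in_Weil W_in_Weil F.obj[OF x]]
  note i = X.inv_arr[OF m(4)] and i' = X'.inv_arr[OF m'(4)]
  note t = m m' X.Tnat_arr[OF weil_l_hom x]
    X'.Tnat_arr[OF weil_l_hom F.obj[OF x]] \<alpha>_arr[OF W_in_Weil x] \<alpha>_arr[OF W_in_Weil Tx] \<alpha>_arr[OF WW x]
    X.inverse_arrowsD(2-4)[OF i] X'.inverse_arrowsD(2-4)[OF i'] W_in_Weil
    X'.Tarr_simps[OF W_in_Weil] X.Tarr_simps[OF W_in_Weil]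
  have "Cmp C' ?\<mu>' (Cmp C' (tan_l X' (fobj F x)) (\<alpha> (W, x))) =
      Cmp C' (Tnat X' weil_l (fobj F x)) (\<alpha> (W, x))"
    unfolding tan_l_def by (simp add: X'.inverse_arrowsD_right(2)[OF i'] t del: Weil_simps)
  also have "\<dots> = Cmp C' (\<alpha> (tensor_obj W W, x)) (farr F (Tnat X weil_l x))"
    by (rule \<alpha>_Tnat[OF weil_l_hom x, symmetric])
  also have "\<dots> = Cmp C' (\<alpha> (tensor_obj W W, x)) (farr F (Cmp C ?\<mu> (tan_l X x)))"
    unfolding tan_l_def by (simp add: X.inverse_arrowsD_right(2)[OF i] t)
  also have "\<dots> = Cmp C' (\<alpha> (tensor_obj W W, x)) (Cmp C' (farr F ?\<mu>) (farr F (tan_l X x)))"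
    by (simp add: F.pres_Cmp t x)
  also have "\<dots> = Cmp C' ?\<mu>' (Cmp C' (Cmp C' (Tarr X' W (\<alpha> (W, x))) (\<alpha> (W, Tobj X W x))) (farr F (tan_l X x)))"
    by (rule X'.Cmp_cong_right[OF \<alpha>_mult[OF W_in_Weil W_in_Weil x]]) (simp_all add: t x del: Weil_simps)
  finally have "Cmp C' (tan_l X' (fobj F x)) (\<alpha> (W, x)) =
      Cmp C' (Cmp C' (Tarr X' W (\<alpha> (W, x))) (\<alpha> (W, Tobj X W x))) (farr F (tan_l X x))"
    by (rule X'.iso_cancel[OF i']) (simp_all add: t x del: Weil_simps)
  also have "\<dots> = Cmp C' (Tarr X' W (\<alpha> (W, x))) (Cmp C' (\<alpha> (W, Tobj X W x)) (farr F (tan_l X x)))"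
    by (simp add: t x del: Weil_simps)
  finally show ?thesis .
qed

end



section \<open>Additive and differential bundles\<close>

definition fibre_sum :: "('o, 'm) cat \<Rightarrow> ('o, 'm, 'z) add_bundle_scheme \<Rightarrow> 'm \<Rightarrow> 'm \<Rightarrow> 'm" where
  "fibre_sum C B u v = Cmp C (bplus B) (pair2 C B u v)"

context category
begin

lemma pair2_eq:
  assumes P: "is_pullback C (tot2 B) (pr0 B) (pr1 B) q q'"
    and h: "h \<in> Arr C" "Cod C h = tot2 B" "Cmp C (pr0 B) h = u" "Cmp C (pr1 B) h = v"
  shows "pair2 C B u v = h"
  unfolding pair2_def
proof (rule the_equality)
  note PD = pullbackD[OF P]
  have Du: "Dom C u = Dom C h" using h PD by auto
  then show "h \<in> hom C (Dom C u) (tot2 B) \<and> Cmp C (pr0 B) h = u \<and> Cmp C (pr1 B) h = v"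
    using h by (simp add: hom_def)
  fix k assume "k \<in> hom C (Dom C u) (tot2 B) \<and> Cmp C (pr0 B) k = u \<and> Cmp C (pr1 B) k = v"
  then have k: "k \<in> Arr C" "Dom C k = Dom C u" "Cod C k = tot2 B" "Cmp C (pr0 B) k = u" "Cmp C (pr1 B) k = v"
    by (auto simp: hom_def)
  show "k = h" by (rule pullback_unique[OF P]) (simp_all add: k h Du)
qed

lemma pair2:
  assumes P: "is_pullback C (tot2 B) (pr0 B) (pr1 B) q q'"
    and uv: "u \<in> Arr C" "v \<in> Arr C" "Dom C v = Dom C u" "Cod C u = Dom C q" "Cod C v = Dom C q'"
      "Cmp C q u = Cmp C q' v"
  shows "pair2 C B u v \<in> Arr C" "Dom C (pair2 C B u v) = Dom C u" "Cod C (pair2 C B u v) = tot2 B"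
    "Cmp C (pr0 B) (pair2 C B u v) = u" "Cmp C (pr1 B) (pair2 C B u v) = v"
proof -
  obtain h where h: "h \<in> Arr C" "Dom C h = Dom C u" "Cod C h = tot2 B" "Cmp C (pr0 B) h = u" "Cmp C (pr1 B) h = v"
    using pullback_exists[OF P uv] by metis
  have "pair2 C B u v = h" by (rule pair2_eq[OF P h(1,3,4,5)])
  with h show "pair2 C B u v \<in> Arr C" "Dom C (pair2 C B u v) = Dom C u" "Cod C (pair2 C B u v) = tot2 B"
    "Cmp C (pr0 B) (pair2 C B u v) = u" "Cmp C (pr1 B) (pair2 C B u v) = v" by simp_all
qed

lemma additive_bundleD:
  assumes "additive_bundle C B"
  shows "proj B \<in> Arr C" "Dom C (proj B) = tot B" "Cod C (proj B) = base B"
    "bplus B \<in> Arr C" "Dom C (bplus B) = tot2 B" "Cod C (bplus B) = tot B"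
    "bzero B \<in> Arr C" "Dom C (bzero B) = base B" "Cod C (bzero B) = tot B"
    "pr0 B \<in> Arr C" "Dom C (pr0 B) = tot2 B" "Cod C (pr0 B) = tot B"
    "pr1 B \<in> Arr C" "Dom C (pr1 B) = tot2 B" "Cod C (pr1 B) = tot B"
  using assms by (auto simp: additive_bundle_def hom_def is_pullback_def)

lemma additive_bundle_rules:
  assumes "additive_bundle C B"
  shows "is_pullback C (tot2 B) (pr0 B) (pr1 B) (proj B) (proj B)"
    "Cmp C (proj B) (bplus B) = Cmp C (proj B) (pr0 B)"
    "Cmp C (proj B) (bplus B) = Cmp C (proj B) (pr1 B)"
    "Cmp C (proj B) (bzero B) = Ide C (base B)"
    "\<exists>P b r. pullback_power C (proj B) n P b r"
  using assms by (auto simp: additive_bundle_def)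

lemma additive_bundle_obj:
  assumes "additive_bundle C B"
  shows "tot B \<in> Obj C" "base B \<in> Obj C" "tot2 B \<in> Obj C"
  using Dom_Cod_obj additive_bundleD[OF assms] by metis+

lemma fibre_sum:
  assumes B: "additive_bundle C B"
    and uv: "u \<in> Arr C" "v \<in> Arr C" "Dom C v = Dom C u" "Cod C u = tot B" "Cod C v = tot B"
      "Cmp C (proj B) u = Cmp C (proj B) v"
  shows "fibre_sum C B u v \<in> Arr C" "Dom C (fibre_sum C B u v) = Dom C u"
    "Cod C (fibre_sum C B u v) = tot B" "Cmp C (proj B) (fibre_sum C B u v) = Cmp C (proj B) u"
proof -
  note BD = additive_bundleD[OF B] and BR = additive_bundle_rules[OF B]
  have p: "pair2 C B u v \<in> Arr C" "Dom C (pair2 C B u v) = Dom C u" "Cod C (pair2 C B u v) = tot2 B"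
    "Cmp C (pr0 B) (pair2 C B u v) = u"
    by (rule pair2[OF BR(1)]; simp add: uv BD)+
  show "fibre_sum C B u v \<in> Arr C" "Dom C (fibre_sum C B u v) = Dom C u" "Cod C (fibre_sum C B u v) = tot B"
    by (simp_all add: fibre_sum_def p BD)
  have "Cmp C (proj B) (fibre_sum C B u v) = Cmp C (proj B) (Cmp C (pr0 B) (pair2 C B u v))"
    unfolding fibre_sum_def by (rule Cmp_cong_right[OF BR(2)]) (simp_all add: BD p)
  then show "Cmp C (proj B) (fibre_sum C B u v) = Cmp C (proj B) u" by (simp add: p)
qed

lemma additive_bundle_laws:
  assumes B: "additive_bundle C B"
    and u: "u \<in> Arr C" "Cod C u = tot B"
  shows "fibre_sum C B u (Cmp C (bzero B) (Cmp C (proj B) u)) = u"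
    and "v \<in> Arr C \<Longrightarrow> Dom C v = Dom C u \<Longrightarrow> Cod C v = tot B \<Longrightarrow> Cmp C (proj B) u = Cmp C (proj B) v \<Longrightarrow>
      fibre_sum C B u v = fibre_sum C B v u"
    and "v \<in> Arr C \<Longrightarrow> Dom C v = Dom C u \<Longrightarrow> Cod C v = tot B \<Longrightarrow> Cmp C (proj B) u = Cmp C (proj B) v \<Longrightarrow>
      w \<in> Arr C \<Longrightarrow> Dom C w = Dom C u \<Longrightarrow> Cod C w = tot B \<Longrightarrow> Cmp C (proj B) v = Cmp C (proj B) w \<Longrightarrow>
      fibre_sum C B (fibre_sum C B u v) w = fibre_sum C B u (fibre_sum C B v w)"
  using assms unfolding additive_bundle_def fibre_sum_def hom_def Let_def by blast+

lemma additive_bundle_homD: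
  assumes "additive_bundle_hom C B B' f g"
  shows "f \<in> Arr C" "Dom C f = tot B" "Cod C f = tot B'" "g \<in> Arr C" "Dom C g = base B" "Cod C g = base B'"
    "Cmp C (proj B') f = Cmp C g (proj B)"
    "Cmp C f (bplus B) = Cmp C (bplus B') (pair2 C B' (Cmp C f (pr0 B)) (Cmp C f (pr1 B)))"
    "Cmp C f (bzero B) = Cmp C (bzero B') g"
  using assms by (auto simp: additive_bundle_hom_def hom_def)

text \<open>As \<open>pair2\<close> is a definite description, the equation expressing additivity of \<open>(f, g)\<close> is
  usable only once the pair in it is known to exist. It does because \<open>f\<close> covers \<open>g\<close>, so that \<open>f\<pi>\<^sub>0\<close> and
  \<open>f\<pi>\<^sub>1\<close> agree over the base.\<close>

lemma additive_bundle_hom_pair: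
  assumes h: "additive_bundle_hom C B B' f g" and B: "additive_bundle C B"
    and P: "is_pullback C (tot2 B') (pr0 B') (pr1 B') (proj B') (proj B')"
    and q: "proj B' \<in> hom C (tot B') (base B')"
  defines "d \<equiv> pair2 C B' (Cmp C f (pr0 B)) (Cmp C f (pr1 B))"
  shows "d \<in> Arr C" "Dom C d = tot2 B" "Cod C d = tot2 B'"
    "Cmp C (pr0 B') d = Cmp C f (pr0 B)" "Cmp C (pr1 B') d = Cmp C f (pr1 B)"
proof -
  note BD = additive_bundleD[OF B] and BR = additive_bundle_rules[OF B] and hD = additive_bundle_homD[OF h]
  have q': "Dom C (proj B') = tot B'" using q by (simp add: hom_def)
  have q0: "Cmp C (proj B') (Cmp C f x) = Cmp C g (Cmp C (proj B) x)"
    if "x \<in> Arr C" "Cod C x = tot B" for x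
    by (rule Cmp_cong_right[OF hD(7)]) (use q that in \<open>simp_all add: hD BD hom_def\<close>)
  have "Cmp C (proj B') (Cmp C f (pr0 B)) = Cmp C (proj B') (Cmp C f (pr1 B))"
    using pullbackD(10)[OF BR(1)] by (simp add: q0 BD)
  then show "d \<in> Arr C" "Dom C d = tot2 B" "Cod C d = tot2 B'"
    "Cmp C (pr0 B') d = Cmp C f (pr0 B)" "Cmp C (pr1 B') d = Cmp C f (pr1 B)"
    unfolding d_def using pair2[OF P, of "Cmp C f (pr0 B)" "Cmp C f (pr1 B)"]
    by (simp_all add: hD(1-6) BD q')
qed

end

lemma T_bundle_simps [simp]:
  "tot (T_bundle X B) = Tobj X W (tot B)" "base (T_bundle X B) = Tobj X W (base B)"
  "proj (T_bundle X B) = Tarr X W (proj B)" "tot2 (T_bundle X B) = Tobj X W (tot2 B)"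
  "pr0 (T_bundle X B) = Tarr X W (pr0 B)" "pr1 (T_bundle X B) = Tarr X W (pr1 B)"
  "bplus (T_bundle X B) = Tarr X W (bplus B)" "bzero (T_bundle X B) = Tarr X W (bzero B)"
  by (simp_all add: T_bundle_def)

lemma tangent_bundle_simps [simp]:
  "tot (tangent_bundle X x) = Tobj X W x" "base (tangent_bundle X x) = x"
  "proj (tangent_bundle X x) = tan_p X x" "tot2 (tangent_bundle X x) = Tobj X (W_pow 2) x"
  "pr0 (tangent_bundle X x) = Tnat X (weil_proj 0) x" "pr1 (tangent_bundle X x) = Tnat X (weil_proj 1) x"
  "bplus (tangent_bundle X x) = tan_plus X x" "bzero (tangent_bundle X x) = tan_0 X x"
  by (simp_all add: tangent_bundle_def)

lemma differential_bundleD: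
  assumes "differential_bundle X E"
  shows "additive_bundle (und X) E"
    "pullback_power (und X) (proj E) n P b r \<Longrightarrow>
      pullback_power (und X) ((Tarr X W ^^ k) (proj E)) n ((Tobj X W ^^ k) P) ((Tarr X W ^^ k) b)
        (\<lambda>i. (Tarr X W ^^ k) (r i))"
    "additive_bundle_hom (und X) E (T_bundle X E) (lift E) (tan_0 X (base E))"
    "additive_bundle_hom (und X) E (tangent_bundle X (tot E)) (lift E) (bzero E)"
    "Cmp (und X) (tan_l X (tot E)) (lift E) = Cmp (und X) (Tarr X W (lift E)) (lift E)"
    "is_pullback (und X) (tot2 E)
         (Cmp (und X) (Tarr X W (bplus E))
            (pair2 (und X) (T_bundle X E)
               (Cmp (und X) (lift E) (pr0 E)) (Cmp (und X) (tan_0 X (tot E)) (pr1 E))))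
         (Cmp (und X) (proj E) (pr0 E)) (Tarr X W (proj E)) (tan_0 X (base E))"
  using assms by (simp_all add: differential_bundle_def Let_def)

context oplax
begin

lemma \<alpha>_T_Cmp:
  assumes A: "A \<in> Obj Weil" and f: "f \<in> Arr C" "Dom C f = x" "Cod C f = y"
    and v: "v \<in> Arr C" "Cod C v = Tobj X A x"
  shows "Cmp C' (\<alpha> (A, y)) (farr F (Cmp C (Tarr X A f) v)) =
    Cmp C' (Tarr X' A (farr F f)) (Cmp C' (\<alpha> (A, x)) (farr F v))"
proof -
  have x: "x \<in> Obj C" "y \<in> Obj C" using f by auto
  have "Cmp C' (\<alpha> (A, y)) (Cmp C' (farr F (Tarr X A f)) (farr F v)) =
    Cmp C' (Tarr X' A (farr F f)) (Cmp C' (\<alpha> (A, x)) (farr F v))"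
    by (rule X'.Cmp_cong_right[OF \<alpha>_Tarr[OF A f(1), unfolded f(2,3)]]) (use A in \<open>simp_all add: f v x\<close>)
  then show ?thesis using A by (simp add: F.pres_Cmp f v)
qed

lemma \<alpha>_Tnat_Cmp:
  assumes \<theta>: "\<theta> \<in> hom Weil A B" and x: "x \<in> Obj C"
    and v: "v \<in> Arr C" "Cod C v = Tobj X A x"
  shows "Cmp C' (\<alpha> (B, x)) (farr F (Cmp C (Tnat X \<theta> x) v)) =
    Cmp C' (Tnat X' \<theta> (fobj F x)) (Cmp C' (\<alpha> (A, x)) (farr F v))"
proof -
  note t = X.Tnat_arr[OF \<theta> x] X'.Tnat_arr[OF \<theta> F.obj[OF x]]
  have AB: "A \<in> Obj Weil" "B \<in> Obj Weil" using \<theta> by (auto simp: hom_Weil_iff)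
  have "Cmp C' (\<alpha> (B, x)) (Cmp C' (farr F (Tnat X \<theta> x)) (farr F v)) =
    Cmp C' (Tnat X' \<theta> (fobj F x)) (Cmp C' (\<alpha> (A, x)) (farr F v))"
    by (rule X'.Cmp_cong_right[OF \<alpha>_Tnat[OF \<theta> x]]) (use AB in \<open>simp_all add: t v x\<close>)
  then show ?thesis by (simp add: F.pres_Cmp t v)
qed

end

context tangent_acteg
begin

text \<open>Preservation of powers by \<open>T\<^sup>k\<close> at \<open>k = 1\<close>, applied to \<open>E\<^sub>2\<close>.\<close>

lemma T_bundle_pullback:
  assumes E: "differential_bundle X E"
  shows "is_pullback C (Tobj X W (tot2 E)) (Tarr X W (pr0 E)) (Tarr X W (pr1 E))
    (Tarr X W (proj E)) (Tarr X W (proj E))"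
proof -
  note ED = differential_bundleD[OF E]
  from ED(2)[OF power_2_if_pullback[OF additive_bundle_rules(1)[OF ED(1)]], of 1]
  have "pullback_power C (Tarr X W (proj E)) 2 (Tobj X W (tot2 E))
      (Tarr X W (Cmp C (proj E) (pr0 E))) (\<lambda>i. Tarr X W (if i = 0 then pr0 E else pr1 E))"
    by simp
  from pullback_if_power_2[OF this] show ?thesis by simp
qed

text \<open>Both sides are \<open>0\<close> after the projection to the base, the first because \<open>\<lambda>\<close> covers \<open>0\<close>, the
  second by naturality of \<open>0\<close>. Hence the pair \<open>\<langle>\<lambda>\<pi>\<^sub>0, 0\<pi>\<^sub>1\<rangle>\<close> in the universality of the lift exists.\<close>

lemma lift_pair:
  assumes E: "differential_bundle X E"
  shows "Cmp C (Tarr X W (proj E)) (Cmp C (lift E) (pr0 E)) =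
    Cmp C (Tarr X W (proj E)) (Cmp C (tan_0 X (tot E)) (pr1 E))"
proof -
  note ED = differential_bundleD[OF E]
  note BD = additive_bundleD[OF ED(1)] and BR = additive_bundle_rules[OF ED(1)]
    and ob = additive_bundle_obj[OF ED(1)] and hD = additive_bundle_homD[OF ED(3), simplified]
  have "Cmp C (Tarr X W (proj E)) (Cmp C (lift E) (pr0 E)) =
      Cmp C (tan_0 X (base E)) (Cmp C (proj E) (pr0 E))"
    by (rule Cmp_cong_right[OF hD(7)]) (simp_all add: hD BD ob)
  also have "\<dots> = Cmp C (tan_0 X (base E)) (Cmp C (proj E) (pr1 E))"
    using BR by metis
  also have "\<dots> = Cmp C (Tarr X W (proj E)) (Cmp C (tan_0 X (tot E)) (pr1 E))"
    by (rule Cmp_cong_right) (use tan_0_natural[OF BD(1)] in \<open>simp_all add: BD ob\<close>)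
  finally show ?thesis .
qed

end


section \<open>Differential functors carry differential objects to differential bundles\<close>

locale lax = oplax X X' F \<alpha>
  for X :: "('o, 'm) actegory" and X' :: "('p, 'q) actegory" and F \<alpha> +
  fixes star :: 'o
  assumes lax: "lax_differential X star X' (F, \<alpha>)"
    and star: "terminal (und X) star" "terminal (und X) (Tobj X W star)"
begin

lemma terminal_iso:
  assumes t: "terminal C t"
  obtains i j where "inverse_arrows C i j" "Dom C i = t" "Cod C i = star"
proof -
  have "t \<in> Obj C" using t by (simp add: terminal_def)
  then obtain i where i: "i \<in> Arr C" "Dom C i = t" "Cod C i = star"
    using X.terminal_arrow[OF star(1)] by blast
  then show ?thesis using that X.terminal_arrow_iso[OF t star(1) i] by (auto simp: is_iso_def)
qed

lemma terminal_T:
  assumes t: "terminal C t"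
  shows "terminal C (Tobj X W t)"
proof -
  obtain i j where i: "inverse_arrows C i j" "Dom C i = t" "Cod C i = star"
    using terminal_iso[OF t] .
  note iD = X.inverse_arrowsD[OF i(1)]
  have "inverse_arrows C (Tarr X W i) (Tarr X W j)"
    by (rule functorial.pres_inverse[OF X.functorial_T[OF W_in_Weil] i(1)])
  from X.terminal_if_iso[OF star(2) this] show ?thesis
    by (simp add: iD(1) i(2,3))
qed

text \<open>The pullbacks that a differential functor preserves by definition are those over one chosen
  terminal object; as all terminal objects are isomorphic, those over any other are preserved too.\<close>

lemma T_F_preserves:
  assumes t: "terminal C t" and A: "A \<in> Obj Weil"
  shows "preserves_pullbacks_over C C' (\<lambda>x. Tobj X' A (fobj F x)) (\<lambda>f. Tarr X' A (farr F f)) t"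
proof -
  obtain i j where i: "inverse_arrows C i j" "Dom C i = t" "Cod C i = star"
    using terminal_iso[OF t] .
  have "preserves_pullbacks_over C C' (\<lambda>x. Tobj X' A (fobj F x)) (\<lambda>f. Tarr X' A (farr F f)) star"
    using lax A unfolding lax_differential_def preserves_pullbacks_over_def by blast
  from functorial.preserves_pullbacks_over_iso_base
    [OF functorial_comp[OF F.functorial_axioms X'.functorial_T[OF A]] this i(1,3)]
  show ?thesis by (simp add: i(2))
qed

lemma F_preserves:
  "terminal C t \<Longrightarrow> preserves_pullbacks_over C C' (fobj F) (farr F) t"
  by (rule X'.preserves_pullbacks_over_unit[OF F.functorial_axioms T_F_preserves[OF _ N_in_Weil]])

lemma T_pow_F_preserves:
  "terminal C t \<Longrightarrow>
    preserves_pullbacks_over C C' (\<lambda>x. (Tobj X' W ^^ k) (fobj F x)) (\<lambda>f. (Tarr X' W ^^ k) (farr F f)) t"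
  by (rule X'.preserves_pullbacks_over_T_pow[OF F.functorial_axioms T_F_preserves])

lemma \<alpha>_pullback:
  assumes "A \<in> Obj Weil" "f \<in> Arr C"
  shows "is_pullback C' (fobj F (Tobj X A (Dom C f)))
    (\<alpha> (A, Dom C f)) (farr F (Tarr X A f)) (Tarr X' A (farr F f)) (\<alpha> (A, Cod C f))"
  using lax assms unfolding lax_differential_def hom_def by blast

end

locale lax_object = lax +
  fixes E
  assumes E: "differential_bundle X E" and terminal_base: "terminal (und X) (base E)"
begin

abbreviation "FE \<equiv> Eval_obj X' (E, (F, \<alpha>))"

lemma FE_simps [simp]:
  "tot FE = fobj F (tot E)" "base FE = fobj F (base E)" "proj FE = farr F (proj E)"
  "tot2 FE = fobj F (tot2 E)" "pr0 FE = farr F (pr0 E)" "pr1 FE = farr F (pr1 E)"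
  "bplus FE = farr F (bplus E)" "bzero FE = farr F (bzero E)"
  "lift FE = Cmp C' (\<alpha> (W, tot E)) (farr F (lift E))"
  by (simp_all add: Eval_obj_def)

lemmas E_add = differential_bundleD(1)[OF E]
lemmas E_arr [simp] = X.additive_bundleD[OF E_add] X.additive_bundle_obj[OF E_add]
lemmas E_rules = X.additive_bundle_rules[OF E_add]
lemmas E_hom_T = differential_bundleD(3)[OF E]
lemmas E_hom_tangent = differential_bundleD(4)[OF E]

lemma lift_arr [simp]:
  "lift E \<in> Arr C" "Dom C (lift E) = tot E" "Cod C (lift E) = Tobj X W (tot E)"
  using X.additive_bundle_homD(1-3)[OF E_hom_T] by simp_all

text \<open>Precomposition with \<open>k\<close> is included because the additive laws concern generalised elements of
  \<open>F E\<close>, which arise from morphisms of the source category only after such a composition.\<close>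

lemma pair2_FE:
  assumes "u \<in> Arr C" "v \<in> Arr C" "Dom C v = Dom C u" "Cod C u = tot E"
    "Cod C v = tot E" "Cmp C (proj E) u = Cmp C (proj E) v"
    and k: "k \<in> Arr C'" "Cod C' k = fobj F (Dom C u)"
  shows "pair2 C' FE (Cmp C' (farr F u) k) (Cmp C' (farr F v) k) =
    Cmp C' (farr F (pair2 C E u v)) k"
proof -
  have FP: "is_pullback C' (tot2 FE) (pr0 FE) (pr1 FE) (farr F (proj E)) (farr F (proj E))"
    using F_preserves[OF terminal_base] E_rules(1) by (auto simp: preserves_pullbacks_over_def)
  have p: "pair2 C E u v \<in> Arr C" "Dom C (pair2 C E u v) = Dom C u"
    "Cod C (pair2 C E u v) = tot2 E"
    "Cmp C (pr0 E) (pair2 C E u v) = u" "Cmp C (pr1 E) (pair2 C E u v) = v"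
    by (rule X.pair2[OF E_rules(1)]; simp add: assms)+
  show ?thesis
  proof (rule X'.pair2_eq[OF FP])
    have c: "Cmp C' (farr F (pr0 E)) (farr F (pair2 C E u v)) = farr F u"
      "Cmp C' (farr F (pr1 E)) (farr F (pair2 C E u v)) = farr F v"
      using p by (simp_all flip: F.pres_Cmp)
    show "Cmp C' (pr0 FE) (Cmp C' (farr F (pair2 C E u v)) k) = Cmp C' (farr F u) k"
      unfolding FE_simps by (rule X'.Cmp_cong_right1[OF c(1)]) (simp_all add: p k)
    show "Cmp C' (pr1 FE) (Cmp C' (farr F (pair2 C E u v)) k) = Cmp C' (farr F v) k"
      unfolding FE_simps by (rule X'.Cmp_cong_right1[OF c(2)]) (simp_all add: p k)
  qed (simp_all add: p k)
qed

lemma fibre_sum_FE: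
  assumes "u \<in> Arr C" "v \<in> Arr C" "Dom C v = Dom C u" "Cod C u = tot E"
    "Cod C v = tot E" "Cmp C (proj E) u = Cmp C (proj E) v"
    and k: "k \<in> Arr C'" "Cod C' k = fobj F (Dom C u)"
  shows "fibre_sum C' FE (Cmp C' (farr F u) k) (Cmp C' (farr F v) k) =
    Cmp C' (farr F (fibre_sum C E u v)) k"
proof -
  have p: "pair2 C E u v \<in> Arr C" "Dom C (pair2 C E u v) = Dom C u"
    "Cod C (pair2 C E u v) = tot2 E"
    by (rule X.pair2[OF E_rules(1)]; simp add: assms)+
  show ?thesis
    unfolding fibre_sum_def pair2_FE[OF assms] by (simp add: F.pres_Cmp p k)
qed

lemma E_powers: "\<exists>P b r. pullback_power C (proj E) n P b r"
  by (rule E_rules(5))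

lemma F_powers:
  assumes "pullback_power C (proj E) n P b r"
  shows "pullback_power C' (farr F (proj E)) n (fobj F P) (farr F b) (\<lambda>i. farr F (r i))"
  by (rule F.preserves_powers[OF _ E_powers assms]) (simp add: F_preserves[OF terminal_base])

text \<open>The additive laws are equations between morphisms out of the powers of \<open>E\<close>, stated on
  generalised elements. Every tuple of generalised elements of \<open>F E\<close> in a common fibre factors
  through the image of the universal tuple, where the law is the image of a law of \<open>E\<close>.\<close>

lemma additive_FE: "additive_bundle C' FE"
proof -
  have FP: "is_pullback C' (fobj F (tot2 E)) (farr F (pr0 E)) (farr F (pr1 E)) (farr F (proj E)) (farr F (proj E))"
    using F_preserves[OF terminal_base] E_rules(1) by (auto simp: preserves_pullbacks_over_def)
  have comm: "fibre_sum C' FE u v = fibre_sum C' FE v u"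
    if uv: "u \<in> Arr C'" "v \<in> Arr C'" "Dom C' v = Dom C' u"
      "Cod C' u = fobj F (tot E)" "Cod C' v = fobj F (tot E)"
      "Cmp C' (farr F (proj E)) u = Cmp C' (farr F (proj E)) v" for u v
  proof -
    obtain k where k: "k \<in> Arr C'" "Dom C' k = Dom C' u" "Cod C' k = fobj F (tot2 E)"
      "Cmp C' (farr F (pr0 E)) k = u" "Cmp C' (farr F (pr1 E)) k = v"
      by (rule X'.pullback_exists[OF FP uv(1-3)]) (simp_all add: uv)
    have e: "Cmp C (proj E) (pr0 E) = Cmp C (proj E) (pr1 E)" using E_rules by metis
    have "fibre_sum C' FE u v = Cmp C' (farr F (fibre_sum C E (pr0 E) (pr1 E))) k"
      using fibre_sum_FE[of "pr0 E" "pr1 E" k] e k by simp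
    also have "fibre_sum C E (pr0 E) (pr1 E) = fibre_sum C E (pr1 E) (pr0 E)"
      by (rule X.additive_bundle_laws(2)[OF E_add]) (simp_all add: e)
    also have "Cmp C' (farr F (fibre_sum C E (pr1 E) (pr0 E))) k = fibre_sum C' FE v u"
      using fibre_sum_FE[of "pr1 E" "pr0 E" k] e k by simp
    finally show ?thesis .
  qed
  have unit: "fibre_sum C' FE u (Cmp C' (farr F (bzero E)) (Cmp C' (farr F (proj E)) u)) = u"
    if u: "u \<in> Arr C'" "Cod C' u = fobj F (tot E)" for u
  proof -
    let ?z = "Cmp C (bzero E) (proj E)"
    have pz: "Cmp C (proj E) ?z = proj E"
      using X.Cmp_cong_right1[OF E_rules(4), of "proj E"] by simp
    have "Cmp C' (farr F (bzero E)) (Cmp C' (farr F (proj E)) u) = Cmp C' (farr F ?z) u"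
      by (simp add: F.pres_Cmp u)
    moreover have "u = Cmp C' (farr F (Ide C (tot E))) u" by (simp add: u)
    ultimately have "fibre_sum C' FE u (Cmp C' (farr F (bzero E)) (Cmp C' (farr F (proj E)) u)) =
        fibre_sum C' FE (Cmp C' (farr F (Ide C (tot E))) u) (Cmp C' (farr F ?z) u)"
      by metis
    also have "\<dots> = Cmp C' (farr F (fibre_sum C E (Ide C (tot E)) ?z)) u"
      by (rule fibre_sum_FE) (simp_all add: u pz)
    also have "fibre_sum C E (Ide C (tot E)) ?z = Ide C (tot E)"
      using X.additive_bundle_laws(1)[OF E_add, of "Ide C (tot E)"] by simp
    finally show ?thesis using u by simp
  qed
  have assoc: "fibre_sum C' FE (fibre_sum C' FE u v) w = fibre_sum C' FE u (fibre_sum C' FE v w)"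
    if uv: "u \<in> Arr C'" "v \<in> Arr C'" "w \<in> Arr C'" "Dom C' v = Dom C' u"
      "Dom C' w = Dom C' u"
      "Cod C' u = fobj F (tot E)" "Cod C' v = fobj F (tot E)" "Cod C' w = fobj F (tot E)"
      "Cmp C' (farr F (proj E)) u = Cmp C' (farr F (proj E)) v"
      "Cmp C' (farr F (proj E)) v = Cmp C' (farr F (proj E)) w" for u v w
  proof -
    obtain P b r where P: "pullback_power C (proj E) 3 P b r" using E_powers by blast
    note PD = X.powerD[OF P]
    (* The universal triple of generalised elements of E in a common fibre. *)
    define x y z where "x = r 0" and "y = r 1" and "z = r 2"
    have xyz: "x \<in> Arr C" "y \<in> Arr C" "z \<in> Arr C" "Dom C x = P"
      "Dom C y = P" "Dom C z = P" "Cod C x = tot E" "Cod C y = tot E" "Cod C z = tot E"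
      "Cmp C (proj E) x = b" "Cmp C (proj E) y = b" "Cmp C (proj E) z = b"
      unfolding x_def y_def z_def using PD(5-8)[of 0] PD(5-8)[of 1] PD(5-8)[of 2] by simp_all
    define t where "t = (\<lambda>i::nat. if i = 0 then u else if i = 1 then v else w)"
    obtain k where k: "k \<in> Arr C'" "Dom C' k = Dom C' (Cmp C' (farr F (proj E)) u)"
      "Cod C' k = fobj F P" "\<And>i. i < 3 \<Longrightarrow> Cmp C' (farr F (r i)) k = t i"
      by (rule X'.power_exists[OF F_powers[OF P], of "Cmp C' (farr F (proj E)) u" t])
        (auto simp: t_def uv)
    have e: "u = Cmp C' (farr F x) k" "v = Cmp C' (farr F y) k" "w = Cmp C' (farr F z) k"
      unfolding x_def y_def z_def using k(4)[of 0] k(4)[of 1] k(4)[of 2] by (simp_all add: t_def)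
    note S = X.fibre_sum[OF E_add xyz(1,2), simplified xyz] X.fibre_sum[OF E_add xyz(2,3), simplified xyz]
    have "fibre_sum C' FE (fibre_sum C' FE u v) w =
        Cmp C' (farr F (fibre_sum C E (fibre_sum C E x y) z)) k"
      unfolding e by (simp add: fibre_sum_FE xyz k S)
    also have "fibre_sum C E (fibre_sum C E x y) z = fibre_sum C E x (fibre_sum C E y z)"
      by (rule X.additive_bundle_laws(3)[OF E_add]) (simp_all add: xyz)
    also have "Cmp C' (farr F (fibre_sum C E x (fibre_sum C E y z))) k =
        fibre_sum C' FE u (fibre_sum C' FE v w)"
      unfolding e by (simp add: fibre_sum_FE xyz k S)
    finally show ?thesis .
  qed
  have "\<exists>P b r. pullback_power C' (farr F (proj E)) n P b r" for n
    using E_powers[of n] F_powers by blast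
  moreover have "Cmp C' (farr F (proj E)) (farr F (bplus E)) = Cmp C' (farr F (proj E)) (farr F (pr0 E))"
    by (rule F.pres_square[OF E_rules(2)]) simp_all
  moreover have "Cmp C' (farr F (proj E)) (farr F (bplus E)) = Cmp C' (farr F (proj E)) (farr F (pr1 E))"
    by (rule F.pres_square[OF E_rules(3)]) simp_all
  moreover have "Cmp C' (farr F (proj E)) (farr F (bzero E)) = Ide C' (fobj F (base E))"
    using E_rules(4) by (simp flip: F.pres_Cmp)
  ultimately show ?thesis
    unfolding additive_bundle_def Let_def fibre_sum_def[symmetric]
    using FP comm unit assoc unfolding hom_def by (simp add: fibre_sum_def[symmetric])
qed

text \<open>The image under \<open>F\<close> of a power of \<open>q\<close> is one power of \<open>F q\<close> that \<open>T'\<^sup>k\<close> preserves; an arbitrary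
  power of \<open>F q\<close> is isomorphic to it.\<close>

lemma T_pow_FE:
  assumes "pullback_power C' (farr F (proj E)) n P b r"
  shows "pullback_power C' ((Tarr X' W ^^ k) (farr F (proj E))) n ((Tobj X' W ^^ k) P)
    ((Tarr X' W ^^ k) b) (\<lambda>i. (Tarr X' W ^^ k) (r i))"
proof -
  obtain P0 b0 r0 where P0: "pullback_power C (proj E) n P0 b0 r0" using E_powers by blast
  have "pullback_power C' ((Tarr X' W ^^ k) (farr F (proj E))) n ((Tobj X' W ^^ k) (fobj F P0))
      ((Tarr X' W ^^ k) (farr F b0)) (\<lambda>i. (Tarr X' W ^^ k) (farr F (r0 i)))"
    by (rule functorial.preserves_powers[OF functorial_comp[OF F.functorial_axioms X'.functorial_T_pow] _ E_powers P0])
      (simp add: T_pow_F_preserves[OF terminal_base])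
  from functorial.preserves_power_if_one[OF X'.functorial_T_pow F_powers[OF P0] this assms]
  show ?thesis .
qed

lemma T_FE_pullback:
  "is_pullback C' (tot2 (T_bundle X' FE)) (pr0 (T_bundle X' FE)) (pr1 (T_bundle X' FE))
    (Tarr X' W (farr F (proj E))) (Tarr X' W (farr F (proj E)))"
  using T_F_preserves[OF terminal_base W_in_Weil] E_rules(1) by (auto simp: preserves_pullbacks_over_def)

text \<open>Pairs in \<open>T' F E\<close> come from pairs in \<open>T E\<close> through \<open>\<alpha>\<close> at \<open>E\<^sub>2\<close>, as \<open>\<alpha>\<close> is natural at the
  projections \<open>\<pi>\<^sub>0\<close> and \<open>\<pi>\<^sub>1\<close>. The lemma serves both the additivity and the universality of the
  lift.\<close>

lemma pair2_T_FE:
  assumes "u \<in> Arr C" "v \<in> Arr C" "Dom C v = Dom C u" "Cod C u = Tobj X W (tot E)"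
    "Cod C v = Tobj X W (tot E)" "Cmp C (Tarr X W (proj E)) u = Cmp C (Tarr X W (proj E)) v"
  shows "pair2 C' (T_bundle X' FE) (Cmp C' (\<alpha> (W, tot E)) (farr F u)) (Cmp C' (\<alpha> (W, tot E)) (farr F v)) =
    Cmp C' (\<alpha> (W, tot2 E)) (farr F (pair2 C (T_bundle X E) u v))"
proof -
  let ?d = "pair2 C (T_bundle X E) u v"
  have TP: "is_pullback C (tot2 (T_bundle X E)) (pr0 (T_bundle X E)) (pr1 (T_bundle X E))
      (Tarr X W (proj E)) (Tarr X W (proj E))"
    using X.T_bundle_pullback[OF E] by simp
  have d: "?d \<in> Arr C" "Dom C ?d = Dom C u" "Cod C ?d = Tobj X W (tot2 E)"
    "Cmp C (Tarr X W (pr0 E)) ?d = u" "Cmp C (Tarr X W (pr1 E)) ?d = v"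
    using X.pair2[OF TP assms(1-3)] assms by simp_all
  have e: "Cmp C' (Tarr X' W (farr F p)) (Cmp C' (\<alpha> (W, tot2 E)) (farr F ?d)) =
      Cmp C' (\<alpha> (W, tot E)) (farr F x)"
    if p: "p \<in> Arr C" "Dom C p = tot2 E" "Cod C p = tot E" "Cmp C (Tarr X W p) ?d = x" for p x
  proof -
    have "Cmp C' (Tarr X' W (farr F p)) (Cmp C' (\<alpha> (W, tot2 E)) (farr F ?d)) =
        Cmp C' (\<alpha> (W, tot E)) (Cmp C' (farr F (Tarr X W p)) (farr F ?d))"
      using \<alpha>_Tarr[OF W_in_Weil p(1)] p d by (intro X'.Cmp_cong_right) simp_all
    also have "Cmp C' (farr F (Tarr X W p)) (farr F ?d) = farr F x"
      using p d by (simp flip: F.pres_Cmp)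
    finally show ?thesis .
  qed
  show ?thesis
    by (rule X'.pair2_eq[OF T_FE_pullback]) (simp_all add: d e)
qed

text \<open>The analogue for the fibrewise addition of the tangent bundle, where \<open>\<alpha>\<close> at \<open>W\<^sup>2\<close> is natural with
  respect to the projections \<open>W\<^sup>2 \<rightarrow> W\<close> of Weil algebras.\<close>

lemma pair2_tangent_FE:
  assumes "u \<in> Arr C" "v \<in> Arr C" "Dom C v = Dom C u" "Cod C u = Tobj X W x"
    "Cod C v = Tobj X W x" "Cmp C (tan_p X x) u = Cmp C (tan_p X x) v"
    and x: "x \<in> Obj C"
  shows "pair2 C' (tangent_bundle X' (fobj F x)) (Cmp C' (\<alpha> (W, x)) (farr F u)) (Cmp C' (\<alpha> (W, x)) (farr F v)) =
    Cmp C' (\<alpha> (W_pow 2, x)) (farr F (pair2 C (tangent_bundle X x) u v))"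
proof -
  let ?d = "pair2 C (tangent_bundle X x) u v"
  have TP: "is_pullback C (tot2 (tangent_bundle X x)) (pr0 (tangent_bundle X x)) (pr1 (tangent_bundle X x))
      (tan_p X x) (tan_p X x)"
    using X.tangent_bundle_pullback[OF x] by simp
  have TP': "is_pullback C' (tot2 (tangent_bundle X' (fobj F x))) (pr0 (tangent_bundle X' (fobj F x)))
      (pr1 (tangent_bundle X' (fobj F x))) (tan_p X' (fobj F x)) (tan_p X' (fobj F x))"
    using X'.tangent_bundle_pullback[OF F.obj[OF x]] by simp
  have d: "?d \<in> Arr C" "Dom C ?d = Dom C u" "Cod C ?d = Tobj X (W_pow 2) x"
    "Cmp C (Tnat X (weil_proj 0) x) ?d = u" "Cmp C (Tnat X (weil_proj 1) x) ?d = v"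
    using X.pair2[OF TP assms(1-3)] assms by simp_all
  have e: "Cmp C' (Tnat X' (weil_proj i) (fobj F x)) (Cmp C' (\<alpha> (W_pow 2, x)) (farr F ?d)) =
      Cmp C' (\<alpha> (W, x)) (farr F y)"
    if p: "i < 2" "Cmp C (Tnat X (weil_proj i) x) ?d = y" for i y
  proof -
    note pr = weil_proj_hom[OF p(1)]
    note t = X.Tnat_arr[OF pr x] X'.Tnat_arr[OF pr F.obj[OF x]]
    have "Cmp C' (Tnat X' (weil_proj i) (fobj F x)) (Cmp C' (\<alpha> (W_pow 2, x)) (farr F ?d)) =
        Cmp C' (\<alpha> (W, x)) (Cmp C' (farr F (Tnat X (weil_proj i) x)) (farr F ?d))"
      by (rule X'.Cmp_cong_right[OF \<alpha>_Tnat[OF pr x, symmetric]]) (simp_all add: t d x)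
    also have "Cmp C' (farr F (Tnat X (weil_proj i) x)) (farr F ?d) = farr F y"
      using p d t by (simp flip: F.pres_Cmp)
    finally show ?thesis .
  qed
  show ?thesis
    by (rule X'.pair2_eq[OF TP']) (simp_all add: d e x del: One_nat_def)
qed

lemma lift_FE_arr [simp]:
  "Cmp C' (\<alpha> (W, tot E)) (farr F (lift E)) \<in> Arr C'"
  "Dom C' (Cmp C' (\<alpha> (W, tot E)) (farr F (lift E))) = fobj F (tot E)"
  "Cod C' (Cmp C' (\<alpha> (W, tot E)) (farr F (lift E))) = Tobj X' W (fobj F (tot E))"
  by simp_all

lemma lift_FE_Cmp:
  assumes "u \<in> Arr C" "Cod C u = tot E"
  shows "Cmp C' (\<alpha> (W, tot E)) (Cmp C' (farr F (lift E)) (farr F u)) =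
    Cmp C' (\<alpha> (W, tot E)) (farr F (Cmp C (lift E) u))"
  using assms by (simp add: F.pres_Cmp)

lemma hom_T_FE: "additive_bundle_hom C' FE (T_bundle X' FE) (lift FE) (tan_0 X' (base FE))"
proof -
  note hD = X.additive_bundle_homD[OF E_hom_T, simplified]
  have TP: "is_pullback C (tot2 (T_bundle X E)) (pr0 (T_bundle X E)) (pr1 (T_bundle X E))
      (proj (T_bundle X E)) (proj (T_bundle X E))"
    using X.T_bundle_pullback[OF E] by simp
  let ?d = "pair2 C (T_bundle X E) (Cmp C (lift E) (pr0 E)) (Cmp C (lift E) (pr1 E))"
  have d: "?d \<in> Arr C" "Dom C ?d = tot2 E" "Cod C ?d = Tobj X W (tot2 E)"
    "Cmp C (Tarr X W (pr0 E)) ?d = Cmp C (lift E) (pr0 E)"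
    "Cmp C (Tarr X W (pr1 E)) ?d = Cmp C (lift E) (pr1 E)"
    using X.additive_bundle_hom_pair[OF E_hom_T E_add TP] by (simp_all add: hom_def)
  have e: "Cmp C (Tarr X W (proj E)) (Cmp C (lift E) (pr0 E)) =
      Cmp C (Tarr X W (proj E)) (Cmp C (lift E) (pr1 E))"
    using X.Cmp_cong_right[OF X.pullbackD(10)[OF TP], of ?d] by (simp add: d)
  have "Cmp C' (Tarr X' W (farr F (proj E))) (lift FE) = Cmp C' (\<alpha> (W, base E)) (farr F (Cmp C (Tarr X W (proj E)) (lift E)))"
    by (simp add: \<alpha>_T_Cmp)
  also have "\<dots> = Cmp C' (\<alpha> (W, base E)) (Cmp C' (farr F (tan_0 X (base E))) (farr F (proj E)))"
    by (simp add: hD(7) F.pres_Cmp)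
  also have "\<dots> = Cmp C' (tan_0 X' (base FE)) (farr F (proj E))"
    by (simp add: X'.Cmp_cong_right1[OF \<alpha>_0])
  finally have 1: "Cmp C' (Tarr X' W (farr F (proj E))) (lift FE) = Cmp C' (tan_0 X' (base FE)) (farr F (proj E))" .
  have "Cmp C' (lift FE) (farr F (bplus E)) =
      Cmp C' (\<alpha> (W, tot E)) (farr F (Cmp C (Tarr X W (bplus E)) ?d))"
    by (simp add: lift_FE_Cmp hD(8))
  also have "\<dots> = Cmp C' (Tarr X' W (farr F (bplus E))) (Cmp C' (\<alpha> (W, tot2 E)) (farr F ?d))"
    by (simp add: \<alpha>_T_Cmp d)
  also have "Cmp C' (\<alpha> (W, tot2 E)) (farr F ?d) =
      pair2 C' (T_bundle X' FE) (Cmp C' (lift FE) (farr F (pr0 E))) (Cmp C' (lift FE) (farr F (pr1 E)))"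
    using pair2_T_FE[OF _ _ _ _ _ e] by (simp add: lift_FE_Cmp)
  finally have 2: "Cmp C' (lift FE) (farr F (bplus E)) = Cmp C' (Tarr X' W (farr F (bplus E)))
      (pair2 C' (T_bundle X' FE) (Cmp C' (lift FE) (farr F (pr0 E))) (Cmp C' (lift FE) (farr F (pr1 E))))" .
  have 3: "Cmp C' (lift FE) (farr F (bzero E)) = Cmp C' (Tarr X' W (farr F (bzero E))) (tan_0 X' (base FE))"
    by (simp add: lift_FE_Cmp hD(9) \<alpha>_T_Cmp \<alpha>_0)
  from 1 2 3 show ?thesis unfolding additive_bundle_hom_def hom_def by simp
qed

lemma hom_tangent_FE: "additive_bundle_hom C' FE (tangent_bundle X' (tot FE)) (lift FE) (bzero FE)"
proof -
  note hD = X.additive_bundle_homD[OF E_hom_tangent, simplified]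
  have TP: "is_pullback C (tot2 (tangent_bundle X (tot E))) (pr0 (tangent_bundle X (tot E)))
      (pr1 (tangent_bundle X (tot E))) (proj (tangent_bundle X (tot E))) (proj (tangent_bundle X (tot E)))"
    using X.tangent_bundle_pullback[of "tot E"] by simp
  let ?d = "pair2 C (tangent_bundle X (tot E)) (Cmp C (lift E) (pr0 E)) (Cmp C (lift E) (pr1 E))"
  have d: "?d \<in> Arr C" "Dom C ?d = tot2 E" "Cod C ?d = Tobj X (W_pow 2) (tot E)"
    "Cmp C (Tnat X (weil_proj 0) (tot E)) ?d = Cmp C (lift E) (pr0 E)"
    "Cmp C (Tnat X (weil_proj 1) (tot E)) ?d = Cmp C (lift E) (pr1 E)"
    using X.additive_bundle_hom_pair[OF E_hom_tangent E_add TP] by (simp_all add: hom_def)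
  have e: "Cmp C (tan_p X (tot E)) (Cmp C (lift E) (pr0 E)) =
      Cmp C (tan_p X (tot E)) (Cmp C (lift E) (pr1 E))"
    using X.Cmp_cong_right[OF X.pullbackD(10)[OF TP], of ?d] X.Tnat_arr[OF weil_proj_hom[of 0], of "tot E"]
      X.Tnat_arr[OF weil_proj_hom[of 1], of "tot E"] by (simp add: d del: One_nat_def)
  have "Cmp C' (tan_p X' (tot FE)) (lift FE) = Cmp C' (farr F (tan_p X (tot E))) (farr F (lift E))"
    by (simp add: X'.Cmp_cong_right1[OF \<alpha>_p])
  also have "\<dots> = Cmp C' (farr F (bzero E)) (farr F (proj E))"
    by (rule F.pres_square[OF hD(7)]) simp_all
  finally have 1: "Cmp C' (tan_p X' (tot FE)) (lift FE) = Cmp C' (farr F (bzero E)) (farr F (proj E))" .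
  have "Cmp C' (lift FE) (farr F (bplus E)) =
      Cmp C' (\<alpha> (W, tot E)) (farr F (Cmp C (tan_plus X (tot E)) ?d))"
    by (simp add: lift_FE_Cmp hD(8))
  also have "\<dots> = Cmp C' (tan_plus X' (tot FE)) (Cmp C' (\<alpha> (W_pow 2, tot E)) (farr F ?d))"
    unfolding tan_plus_def by (simp add: \<alpha>_Tnat_Cmp[OF weil_plus_hom] d)
  also have "Cmp C' (\<alpha> (W_pow 2, tot E)) (farr F ?d) =
      pair2 C' (tangent_bundle X' (tot FE)) (Cmp C' (lift FE) (farr F (pr0 E))) (Cmp C' (lift FE) (farr F (pr1 E)))"
    using pair2_tangent_FE[OF _ _ _ _ _ e] by (simp add: lift_FE_Cmp)
  finally have 2: "Cmp C' (lift FE) (farr F (bplus E)) = Cmp C' (tan_plus X' (tot FE))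
      (pair2 C' (tangent_bundle X' (tot FE)) (Cmp C' (lift FE) (farr F (pr0 E))) (Cmp C' (lift FE) (farr F (pr1 E))))" .
  have "Cmp C' (lift FE) (farr F (bzero E)) = Cmp C' (\<alpha> (W, tot E)) (Cmp C' (farr F (tan_0 X (tot E))) (farr F (bzero E)))"
    by (simp add: lift_FE_Cmp hD(9) flip: F.pres_Cmp)
  also have "\<dots> = Cmp C' (tan_0 X' (tot FE)) (farr F (bzero E))"
    by (simp add: X'.Cmp_cong_right1[OF \<alpha>_0])
  finally have 3: "Cmp C' (lift FE) (farr F (bzero E)) = Cmp C' (tan_0 X' (tot FE)) (farr F (bzero E))" .
  from 1 2 3 show ?thesis unfolding additive_bundle_hom_def hom_def by simp
qed

lemma lift_coassoc_FE:
  "Cmp C' (tan_l X' (tot FE)) (lift FE) = Cmp C' (Tarr X' W (lift FE)) (lift FE)"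
proof -
  have "Cmp C' (tan_l X' (tot FE)) (lift FE) =
      Cmp C' (Tarr X' W (\<alpha> (W, tot E))) (Cmp C' (Cmp C' (\<alpha> (W, Tobj X W (tot E))) (farr F (tan_l X (tot E)))) (farr F (lift E)))"
    unfolding FE_simps by (rule X'.Cmp_cong_right[OF \<alpha>_l]) simp_all
  also have "\<dots> = Cmp C' (Tarr X' W (\<alpha> (W, tot E))) (Cmp C' (\<alpha> (W, Tobj X W (tot E))) (farr F (Cmp C (Tarr X W (lift E)) (lift E))))"
    by (simp add: F.pres_Cmp flip: differential_bundleD(5)[OF E])
  also have "\<dots> = Cmp C' (Tarr X' W (lift FE)) (lift FE)"
    by (simp add: \<alpha>_T_Cmp X'.Tarr_Cmp)
  finally show ?thesis .
qed

text \<open>The square expressing universality of the lift of \<open>E\<close> is a pullback over \<open>T b\<close>, where \<open>b\<close> is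
  the base. As \<open>T b\<close> is terminal, \<open>F\<close> preserves this pullback, and pasting it with the naturality
  square of \<open>\<alpha>\<^bsub>W\<^esub>\<close> at the projection gives the universality of the lift of \<open>F E\<close>.\<close>

lemma universality_FE:
  "is_pullback C' (tot2 FE)
    (Cmp C' (Tarr X' W (bplus FE)) (pair2 C' (T_bundle X' FE)
      (Cmp C' (lift FE) (pr0 FE)) (Cmp C' (tan_0 X' (tot FE)) (pr1 FE))))
    (Cmp C' (proj FE) (pr0 FE)) (Tarr X' W (proj FE)) (tan_0 X' (base FE))"
proof -
  let ?d = "pair2 C (T_bundle X E) (Cmp C (lift E) (pr0 E)) (Cmp C (tan_0 X (tot E)) (pr1 E))"
  let ?S = "Cmp C (Tarr X W (bplus E)) ?d"
  have TP: "is_pullback C (tot2 (T_bundle X E)) (pr0 (T_bundle X E)) (pr1 (T_bundle X E))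
      (Tarr X W (proj E)) (Tarr X W (proj E))"
    using X.T_bundle_pullback[OF E] by simp
  have d: "?d \<in> Arr C" "Dom C ?d = tot2 E" "Cod C ?d = Tobj X W (tot2 E)"
    using X.pair2(1-3)[OF TP _ _ _ _ _ X.lift_pair[OF E]] by simp_all
  have "is_pullback C (tot2 E) ?S (Cmp C (proj E) (pr0 E)) (Tarr X W (proj E)) (tan_0 X (base E))"
    by (rule differential_bundleD(6)[OF E])
  then have "is_pullback C' (fobj F (tot2 E)) (farr F ?S) (farr F (Cmp C (proj E) (pr0 E)))
      (farr F (Tarr X W (proj E))) (farr F (tan_0 X (base E)))"
    using F_preserves[OF terminal_T[OF terminal_base]] unfolding preserves_pullbacks_over_def by simp
  moreover have "is_pullback C' (fobj F (Tobj X W (tot E))) (\<alpha> (W, tot E)) (farr F (Tarr X W (proj E)))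
      (Tarr X' W (farr F (proj E))) (\<alpha> (W, base E))"
    using \<alpha>_pullback[OF W_in_Weil, of "proj E"] by simp
  ultimately have "is_pullback C' (fobj F (tot2 E)) (Cmp C' (\<alpha> (W, tot E)) (farr F ?S))
      (farr F (Cmp C (proj E) (pr0 E))) (Tarr X' W (farr F (proj E)))
      (Cmp C' (\<alpha> (W, base E)) (farr F (tan_0 X (base E))))"
    by (rule X'.pullback_paste)
  moreover have "Cmp C' (\<alpha> (W, base E)) (farr F (tan_0 X (base E))) = tan_0 X' (fobj F (base E))"
    by (rule \<alpha>_0) simp
  moreover have "farr F (Cmp C (proj E) (pr0 E)) = Cmp C' (farr F (proj E)) (farr F (pr0 E))"
    by (simp add: F.pres_Cmp)
  moreover have "Cmp C' (\<alpha> (W, tot E)) (farr F (Cmp C (tan_0 X (tot E)) (pr1 E))) =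
      Cmp C' (tan_0 X' (fobj F (tot E))) (farr F (pr1 E))"
    by (simp add: F.pres_Cmp X'.Cmp_cong_right1[OF \<alpha>_0])
  then have "Cmp C' (\<alpha> (W, tot E)) (farr F ?S) = Cmp C' (Tarr X' W (farr F (bplus E)))
      (pair2 C' (T_bundle X' FE) (Cmp C' (lift FE) (farr F (pr0 E)))
        (Cmp C' (tan_0 X' (fobj F (tot E))) (farr F (pr1 E))))"
    using pair2_T_FE[OF _ _ _ _ _ X.lift_pair[OF E]] by (simp add: \<alpha>_T_Cmp d lift_FE_Cmp)
  ultimately show ?thesis unfolding FE_simps by simp
qed

lemma differential_FE: "differential_bundle X' FE"
  using additive_FE T_pow_FE hom_T_FE hom_tangent_FE lift_coassoc_FE universality_FE
  unfolding differential_bundle_def Let_def by simp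

end



section \<open>The categories involved\<close>

lemma category_full_subcat:
  assumes "category C"
  shows "category (full_subcat C S)"
proof -
  interpret category C by fact
  have h: "f \<in> hom (full_subcat C S) a b \<longleftrightarrow> f \<in> hom C a b \<and> a \<in> S \<and> b \<in> S" for f a b
    by (auto simp: hom_def full_subcat_def)
  show ?thesis
    unfolding category_def h
    by (auto simp: full_subcat_def intro: Ide_in Cmp_in Cmp_assoc Cmp_Ide Ide_Cmp)
qed

lemma category_wide_subcat:
  assumes "category C" and "\<And>a. a \<in> Obj C \<Longrightarrow> P (Ide C a)"
    and "\<And>f g a b c. f \<in> hom C a b \<Longrightarrow> g \<in> hom C b c \<Longrightarrow> P f \<Longrightarrow> P g \<Longrightarrow> P (Cmp C g f)"
  shows "category (C\<lparr>Arr := {f \<in> Arr C. P f}\<rparr>)"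
proof -
  interpret category C by fact
  have h: "f \<in> hom (C\<lparr>Arr := {f \<in> Arr C. P f}\<rparr>) a b \<longleftrightarrow> f \<in> hom C a b \<and> P f" for f a b
    by (auto simp: hom_def)
  show ?thesis
    unfolding category_def h
    by (auto intro: Ide_in Cmp_in Cmp_assoc Cmp_Ide Ide_Cmp assms(2,3))
qed

lemma category_cat_prod:
  assumes "category C" "category D"
  shows "category (cat_prod C D)"
proof -
  interpret C: category C by fact
  interpret D: category D by fact
  have h: "f \<in> hom (cat_prod C D) a b \<longleftrightarrow> fst f \<in> hom C (fst a) (fst b) \<and> snd f \<in> hom D (snd a) (snd b)"
    for f a b by (cases f; cases a; cases b) (auto simp: hom_def cat_prod_def)
  show ?thesis
    unfolding category_def h
    by (auto simp: cat_prod_def split: prod.splits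
        intro: C.Ide_in C.Cmp_in C.Cmp_assoc C.Cmp_Ide C.Ide_Cmp D.Ide_in D.Cmp_in D.Cmp_assoc D.Cmp_Ide D.Ide_Cmp)
qed

context category
begin

lemma additive_bundle_hom_Ide:
  assumes B: "additive_bundle C B"
  shows "additive_bundle_hom C B B (Ide C (tot B)) (Ide C (base B))"
proof -
  note BD = additive_bundleD[OF B] and BR = additive_bundle_rules[OF B] and ob = additive_bundle_obj[OF B]
  have "pair2 C B (pr0 B) (pr1 B) = Ide C (tot2 B)"
    by (rule pair2_eq[OF BR(1)]) (simp_all add: BD ob)
  then show ?thesis unfolding additive_bundle_hom_def hom_def by (simp add: BD ob)
qed

lemma additive_bundle_hom_Cmp:
  assumes B: "additive_bundle C B" and B': "additive_bundle C B'" and B'': "additive_bundle C B''"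
    and f: "additive_bundle_hom C B B' f g" and f': "additive_bundle_hom C B' B'' f' g'"
  shows "additive_bundle_hom C B B'' (Cmp C f' f) (Cmp C g' g)"
proof -
  note BD = additive_bundleD[OF B] additive_bundleD[OF B'] additive_bundleD[OF B'']
  note BR' = additive_bundle_rules[OF B'] and BR'' = additive_bundle_rules[OF B'']
  note fD = additive_bundle_homD[OF f] and fD' = additive_bundle_homD[OF f']
  have q: "proj B' \<in> hom C (tot B') (base B')" "proj B'' \<in> hom C (tot B'') (base B'')"
    by (simp_all add: hom_def BD)
  note p = additive_bundle_hom_pair[OF f B BR'(1) q(1)] and p' = additive_bundle_hom_pair[OF f' B' BR''(1) q(2)]
  let ?d = "pair2 C B' (Cmp C f (pr0 B)) (Cmp C f (pr1 B))"
  let ?d' = "pair2 C B'' (Cmp C f' (pr0 B')) (Cmp C f' (pr1 B'))"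
  have "Cmp C (proj B'') (Cmp C f' f) = Cmp C g' (Cmp C (proj B') f)"
    by (rule Cmp_cong_right[OF fD'(7)]) (simp_all add: BD fD(1-6) fD'(1-6))
  then have 1: "Cmp C (proj B'') (Cmp C f' f) = Cmp C (Cmp C g' g) (proj B)"
    by (simp add: BD fD fD'(1-6))
  have "Cmp C (Cmp C f' f) (bplus B) = Cmp C f' (Cmp C (bplus B') ?d)"
    by (simp add: BD fD fD'(1-6))
  also have "\<dots> = Cmp C (bplus B'') (Cmp C ?d' ?d)"
    by (rule Cmp_cong_right[OF fD'(8)]) (simp_all add: BD p p' fD'(1-6))
  also have "Cmp C ?d' ?d = pair2 C B'' (Cmp C (Cmp C f' f) (pr0 B)) (Cmp C (Cmp C f' f) (pr1 B))"
  proof (rule pair2_eq[OF BR''(1), symmetric])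
    have "Cmp C (pr0 B'') (Cmp C ?d' ?d) = Cmp C f' (Cmp C (pr0 B') ?d)"
      by (rule Cmp_cong_right[OF p'(4)]) (simp_all add: BD p(1-3) p'(1-3) fD'(1-6))
    then show "Cmp C (pr0 B'') (Cmp C ?d' ?d) = Cmp C (Cmp C f' f) (pr0 B)"
      by (simp add: p(4) BD fD(1-6) fD'(1-6))
    have "Cmp C (pr1 B'') (Cmp C ?d' ?d) = Cmp C f' (Cmp C (pr1 B') ?d)"
      by (rule Cmp_cong_right[OF p'(5)]) (simp_all add: BD p(1-3) p'(1-3) fD'(1-6))
    then show "Cmp C (pr1 B'') (Cmp C ?d' ?d) = Cmp C (Cmp C f' f) (pr1 B)"
      by (simp add: p(5) BD fD(1-6) fD'(1-6))
  qed (simp_all add: p p')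
  finally have 2: "Cmp C (Cmp C f' f) (bplus B) =
      Cmp C (bplus B'') (pair2 C B'' (Cmp C (Cmp C f' f) (pr0 B)) (Cmp C (Cmp C f' f) (pr1 B)))" .
  have "Cmp C f' (Cmp C (bzero B') g) = Cmp C (bzero B'') (Cmp C g' g)"
    by (rule Cmp_cong_right[OF fD'(9)]) (simp_all add: BD fD(1-6) fD'(1-6))
  then have 3: "Cmp C (Cmp C f' f) (bzero B) = Cmp C (bzero B'') (Cmp C g' g)"
    by (simp add: BD fD fD'(1-6))
  from 1 2 3 show ?thesis
    unfolding additive_bundle_hom_def hom_def by (simp add: fD(1-6) fD'(1-6))
qed

end

lemma hom_DBun_iff:
  "t \<in> hom (DBun_add X) E E' \<longleftrightarrow> (\<exists>f g. t = (E, E', f, g) \<and> differential_bundle X E \<and>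
     differential_bundle X E' \<and> additive_bundle_hom (und X) E E' f g)"
  by (auto simp: hom_def DBun_add_def)

lemma (in acteg) category_DBun: "category (DBun_add X)"
proof
  fix E assume "E \<in> Obj (DBun_add X)"
  then have E: "differential_bundle X E" by (simp add: DBun_add_def)
  have "additive_bundle_hom (und X) E E (Ide (und X) (tot E)) (Ide (und X) (base E))"
    by (rule additive_bundle_hom_Ide[OF differential_bundleD(1)[OF E]])
  then show "Ide (DBun_add X) E \<in> hom (DBun_add X) E E"
    using E by (simp add: hom_DBun_iff) (simp add: DBun_add_def)
next
  fix t t' E E' E'' assume "t \<in> hom (DBun_add X) E E'" "t' \<in> hom (DBun_add X) E' E''"
  then obtain f g f' g' where t: "t = (E, E', f, g)" "t' = (E', E'', f', g')"
    and E: "differential_bundle X E" "differential_bundle X E'" "differential_bundle X E''"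
    and f: "additive_bundle_hom (und X) E E' f g" "additive_bundle_hom (und X) E' E'' f' g'"
    by (auto simp: hom_DBun_iff)
  have "additive_bundle_hom (und X) E E'' (Cmp (und X) f' f) (Cmp (und X) g' g)"
    by (rule additive_bundle_hom_Cmp[OF E[THEN differential_bundleD(1)] f])
  then show "Cmp (DBun_add X) t' t \<in> hom (DBun_add X) E E''"
    using E by (simp add: hom_DBun_iff) (simp add: DBun_add_def t)
next
  fix t t' t'' E E' E'' E'''
  assume "t \<in> hom (DBun_add X) E E'" "t' \<in> hom (DBun_add X) E' E''" "t'' \<in> hom (DBun_add X) E'' E'''"
  then show "Cmp (DBun_add X) t'' (Cmp (DBun_add X) t' t) = Cmp (DBun_add X) (Cmp (DBun_add X) t'' t') t"
    by (auto simp: hom_DBun_iff) (auto simp: DBun_add_def additive_bundle_homD)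
next
  fix t E E' assume "t \<in> hom (DBun_add X) E E'"
  then show "Cmp (DBun_add X) t (Ide (DBun_add X) E) = t" "Cmp (DBun_add X) (Ide (DBun_add X) E') t = t"
    by (auto simp: hom_DBun_iff) (auto simp: DBun_add_def additive_bundle_homD)
qed (auto simp: DBun_add_def)

lemma (in acteg) category_DObj: "category (DObj_add X)"
  unfolding DObj_add_def by (rule category_full_subcat[OF category_DBun])

lemma hom_DObj_iff:
  "t \<in> hom (DObj_add X) E E' \<longleftrightarrow> t \<in> hom (DBun_add X) E E' \<and> terminal (und X) (base E) \<and> terminal (und X) (base E')"
  by (auto simp: hom_def DObj_add_def full_subcat_def)

lemma DObj_simps:
  "E \<in> Obj (DObj_add X) \<longleftrightarrow> differential_bundle X E \<and> terminal (und X) (base E)"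
  "Ide (DObj_add X) E = (E, E, Ide (und X) (tot E), Ide (und X) (base E))"
  "Cmp (DObj_add X) (E', E'', f', g') (E, E1, f, g) = (E, E'', Cmp (und X) f' f, Cmp (und X) g' g)"
  by (auto simp: DObj_add_def full_subcat_def DBun_add_def)

lemma nat_transD:
  assumes "nat_trans C D F G \<phi>"
  shows "a \<in> Obj C \<Longrightarrow> \<phi> a \<in> Arr D" "a \<in> Obj C \<Longrightarrow> Dom D (\<phi> a) = fobj F a" "a \<in> Obj C \<Longrightarrow> Cod D (\<phi> a) = fobj G a"
    "f \<in> Arr C \<Longrightarrow> Cmp D (\<phi> (Cod C f)) (farr F f) = Cmp D (farr G f) (\<phi> (Dom C f))"
    "\<phi> \<in> extensional (Obj C)"
  using assms by (auto simp: nat_trans_def hom_def)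

lemma hom_DiffFun_iff:
  "t \<in> hom (DiffFun X star X') \<FF> \<GG> \<longleftrightarrow> (\<exists>\<phi>. t = (\<FF>, \<GG>, \<phi>) \<and> lax_differential X star X' \<FF> \<and>
     lax_differential X star X' \<GG> \<and> nat_trans (und X) (und X') (fst \<FF>) (fst \<GG>) \<phi>)"
  by (auto simp: hom_def DiffFun_def)

lemma DiffFun_simps:
  "\<FF> \<in> Obj (DiffFun X star X') \<longleftrightarrow> lax_differential X star X' \<FF>"
  "Dom (DiffFun X star X') (\<FF>, \<GG>, \<phi>) = \<FF>" "Cod (DiffFun X star X') (\<FF>, \<GG>, \<phi>) = \<GG>"
  "Ide (DiffFun X star X') \<FF> = (\<FF>, \<FF>, \<lambda>x\<in>Obj (und X). Ide (und X') (fobj (fst \<FF>) x))"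
  "Cmp (DiffFun X star X') (\<GG>', \<HH>, \<psi>) (\<FF>, \<GG>, \<phi>) = (\<FF>, \<HH>, \<lambda>x\<in>Obj (und X). Cmp (und X') (\<psi> x) (\<phi> x))"
  by (simp_all add: DiffFun_def)

locale eval_setting = X: tangent_acteg X + X': tangent_acteg X'
  for X :: "('o, 'm) actegory" and X' :: "('p, 'q) actegory" +
  fixes star :: 'o
  assumes star: "terminal (und X) star" "terminal (und X) (Tobj X W star)"
begin

abbreviation C where "C \<equiv> und X"
abbreviation C' where "C' \<equiv> und X'"

lemma lax_intro: "lax_differential X star X' (F, \<alpha>) \<Longrightarrow> lax X X' F \<alpha> star"
  by unfold_locales (auto simp: lax_differential_def star)

lemma is_functor_lax: "lax_differential X star X' \<FF> \<Longrightarrow> is_functor C C' (fst \<FF>)"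
  by (cases \<FF>) (simp add: lax_differential_def oplax_linear_def Let_def)

lemma category_DiffFun: "category (DiffFun X star X')"
proof
  fix \<FF> assume "\<FF> \<in> Obj (DiffFun X star X')"
  then have F: "lax_differential X star X' \<FF>" by (simp add: DiffFun_simps)
  interpret F: functorial "und X" "und X'" "fobj (fst \<FF>)" "farr (fst \<FF>)"
    by (rule functorial_is_functor[OF is_functor_lax[OF F]])
  have "nat_trans C C' (fst \<FF>) (fst \<FF>) (\<lambda>x\<in>Obj C. Ide C' (fobj (fst \<FF>) x))"
    by (auto simp: nat_trans_def hom_def)
  then show "Ide (DiffFun X star X') \<FF> \<in> hom (DiffFun X star X') \<FF> \<FF>"
    using F by (simp add: hom_DiffFun_iff DiffFun_simps)
next
  fix t t' \<FF> \<GG> \<HH> assume "t \<in> hom (DiffFun X star X') \<FF> \<GG>" "t' \<in> hom (DiffFun X star X') \<GG> \<HH>"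
  then obtain \<phi> \<psi> where t: "t = (\<FF>, \<GG>, \<phi>)" "t' = (\<GG>, \<HH>, \<psi>)"
    and FGH: "lax_differential X star X' \<FF>" "lax_differential X star X' \<GG>" "lax_differential X star X' \<HH>"
    and \<phi>: "nat_trans C C' (fst \<FF>) (fst \<GG>) \<phi>" and \<psi>: "nat_trans C C' (fst \<GG>) (fst \<HH>) \<psi>"
    by (auto simp: hom_DiffFun_iff)
  interpret F: functorial "und X" "und X'" "fobj (fst \<FF>)" "farr (fst \<FF>)"
    by (rule functorial_is_functor[OF is_functor_lax[OF FGH(1)]])
  interpret G: functorial "und X" "und X'" "fobj (fst \<GG>)" "farr (fst \<GG>)"
    by (rule functorial_is_functor[OF is_functor_lax[OF FGH(2)]])
  interpret H: functorial "und X" "und X'" "fobj (fst \<HH>)" "farr (fst \<HH>)"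
    by (rule functorial_is_functor[OF is_functor_lax[OF FGH(3)]])
  have "Cmp C' (Cmp C' (\<psi> (Cod C f)) (\<phi> (Cod C f))) (farr (fst \<FF>) f) =
      Cmp C' (farr (fst \<HH>) f) (Cmp C' (\<psi> (Dom C f)) (\<phi> (Dom C f)))"
    if f: "f \<in> Arr C" for f
  proof -
    note \<phi>D = nat_transD[OF \<phi>] and \<psi>D = nat_transD[OF \<psi>]
    have "Cmp C' (Cmp C' (\<psi> (Cod C f)) (\<phi> (Cod C f))) (farr (fst \<FF>) f) =
        Cmp C' (\<psi> (Cod C f)) (Cmp C' (farr (fst \<GG>) f) (\<phi> (Dom C f)))"
      using f by (simp add: \<phi>D \<psi>D(1-3))
    also have "\<dots> = Cmp C' (farr (fst \<HH>) f) (Cmp C' (\<psi> (Dom C f)) (\<phi> (Dom C f)))"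
      by (rule X'.Cmp_cong_right[OF \<psi>D(4)[OF f]]) (use f in \<open>simp_all add: \<phi>D(1-3) \<psi>D(1-3)\<close>)
    finally show ?thesis .
  qed
  then have "nat_trans C C' (fst \<FF>) (fst \<HH>) (\<lambda>x\<in>Obj C. Cmp C' (\<psi> x) (\<phi> x))"
    using nat_transD(1-3)[OF \<phi>] nat_transD(1-3)[OF \<psi>] by (auto simp: nat_trans_def hom_def)
  then show "Cmp (DiffFun X star X') t' t \<in> hom (DiffFun X star X') \<FF> \<HH>"
    using FGH by (simp add: hom_DiffFun_iff DiffFun_simps t)
next
  fix t t' t'' \<FF> \<GG> \<HH> \<KK>
  assume "t \<in> hom (DiffFun X star X') \<FF> \<GG>" "t' \<in> hom (DiffFun X star X') \<GG> \<HH>"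
    "t'' \<in> hom (DiffFun X star X') \<HH> \<KK>"
  then show "Cmp (DiffFun X star X') t'' (Cmp (DiffFun X star X') t' t) =
      Cmp (DiffFun X star X') (Cmp (DiffFun X star X') t'' t') t"
    by (auto simp: hom_DiffFun_iff DiffFun_simps nat_transD intro!: restrict_ext)
next
  fix t \<FF> \<GG> assume "t \<in> hom (DiffFun X star X') \<FF> \<GG>"
  then obtain \<phi> where t: "t = (\<FF>, \<GG>, \<phi>)" and \<phi>: "nat_trans C C' (fst \<FF>) (fst \<GG>) \<phi>"
    by (auto simp: hom_DiffFun_iff)
  note \<phi>D = nat_transD[OF \<phi>]
  have "(\<lambda>x\<in>Obj C. Cmp C' (\<phi> x) ((\<lambda>x\<in>Obj C. Ide C' (fobj (fst \<FF>) x)) x)) = \<phi>"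
    "(\<lambda>x\<in>Obj C. Cmp C' ((\<lambda>x\<in>Obj C. Ide C' (fobj (fst \<GG>) x)) x) (\<phi> x)) = \<phi>"
    by (rule extensionalityI[OF _ \<phi>D(5)]; simp add: \<phi>D(1-3))+
  then show "Cmp (DiffFun X star X') t (Ide (DiffFun X star X') \<FF>) = t"
    "Cmp (DiffFun X star X') (Ide (DiffFun X star X') \<GG>) t = t"
    by (simp_all add: t DiffFun_simps)
qed (auto simp: DiffFun_def)

lemma linear_trans_Ide:
  assumes "lax_differential X star X' \<FF>"
  shows "linear_trans X X' (Ide (DiffFun X star X') \<FF>)"
proof -
  obtain F \<alpha> where \<FF>: "\<FF> = (F, \<alpha>)" by (cases \<FF>)
  interpret F: lax X X' F \<alpha> star using assms lax_intro \<FF> by simp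
  show ?thesis by (simp add: \<FF> DiffFun_simps linear_trans_def)
qed

lemma linear_trans_Cmp:
  assumes t: "t \<in> hom (DiffFun X star X') \<FF> \<GG>" and t': "t' \<in> hom (DiffFun X star X') \<GG> \<HH>"
    and l: "linear_trans X X' t" "linear_trans X X' t'"
  shows "linear_trans X X' (Cmp (DiffFun X star X') t' t)"
proof -
  obtain \<phi> \<psi> where tt: "t = (\<FF>, \<GG>, \<phi>)" "t' = (\<GG>, \<HH>, \<psi>)"
    and FGH: "lax_differential X star X' \<FF>" "lax_differential X star X' \<GG>" "lax_differential X star X' \<HH>"
    and \<phi>: "nat_trans C C' (fst \<FF>) (fst \<GG>) \<phi>" and \<psi>: "nat_trans C C' (fst \<GG>) (fst \<HH>) \<psi>"
    using t t' by (auto simp: hom_DiffFun_iff)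
  obtain F \<alpha> G \<beta> H \<gamma> where FF: "\<FF> = (F, \<alpha>)" "\<GG> = (G, \<beta>)" "\<HH> = (H, \<gamma>)" by (metis surj_pair)
  interpret F: lax X X' F \<alpha> star using FGH lax_intro FF by simp
  interpret G: lax X X' G \<beta> star using FGH lax_intro FF by simp
  interpret H: lax X X' H \<gamma> star using FGH lax_intro FF by simp
  note \<phi>D = nat_transD(1-3)[OF \<phi>, unfolded FF fst_conv] and \<psi>D = nat_transD(1-3)[OF \<psi>, unfolded FF fst_conv]
  have "Cmp C' (\<gamma> (A, x)) (Cmp C' (\<psi> (Tobj X A x)) (\<phi> (Tobj X A x))) =
      Cmp C' (Tarr X' A (Cmp C' (\<psi> x) (\<phi> x))) (\<alpha> (A, x))"
    if A: "A \<in> Obj Weil" and x: "x \<in> Obj C" for A x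
  proof -
    note s = X.Tarr_simps[OF A] X'.Tarr_simps[OF A] F.\<alpha>_arr[OF A x] G.\<alpha>_arr[OF A x] H.\<alpha>_arr[OF A x]
    have l\<phi>: "Cmp C' (\<beta> (A, x)) (\<phi> (Tobj X A x)) = Cmp C' (Tarr X' A (\<phi> x)) (\<alpha> (A, x))"
      and l\<psi>: "Cmp C' (\<gamma> (A, x)) (\<psi> (Tobj X A x)) = Cmp C' (Tarr X' A (\<psi> x)) (\<beta> (A, x))"
      using l A x unfolding linear_trans_def tt FF by auto
    have "Cmp C' (\<gamma> (A, x)) (Cmp C' (\<psi> (Tobj X A x)) (\<phi> (Tobj X A x))) =
        Cmp C' (Tarr X' A (\<psi> x)) (Cmp C' (\<beta> (A, x)) (\<phi> (Tobj X A x)))"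
      by (rule X'.Cmp_cong_right[OF l\<psi>]) (simp_all add: s \<phi>D \<psi>D x)
    also have "\<dots> = Cmp C' (Tarr X' A (\<psi> x)) (Cmp C' (Tarr X' A (\<phi> x)) (\<alpha> (A, x)))"
      by (simp add: l\<phi>)
    also have "\<dots> = Cmp C' (Tarr X' A (Cmp C' (\<psi> x) (\<phi> x))) (\<alpha> (A, x))"
      using A by (simp add: X'.Tarr_Cmp s \<phi>D \<psi>D x)
    finally show ?thesis .
  qed
  then show ?thesis
    unfolding linear_trans_def tt FF DiffFun_simps by simp
qed

lemma category_DiffFun_lin: "category (DiffFun_lin X star X')"
proof -
  interpret category "DiffFun X star X'" by (rule category_DiffFun)
  show ?thesis
    unfolding DiffFun_lin_def
    by (rule category_wide_subcat[OF category_DiffFun])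
      (auto simp only: DiffFun_simps(1) intro: linear_trans_Ide linear_trans_Cmp)
qed


section \<open>The evaluation functor\<close>

lemma Eval_obj_differential:
  assumes "E \<in> Obj (DObj_add X)" "lax_differential X star X' \<FF>"
  shows "differential_bundle X' (Eval_obj X' (E, \<FF>))"
proof -
  obtain F \<alpha> where \<FF>: "\<FF> = (F, \<alpha>)" by (cases \<FF>)
  have "lax X X' F \<alpha> star" using assms lax_intro \<FF> by simp
  then interpret F: lax_object X X' F \<alpha> star E
    using assms by (simp add: lax_object_def lax_object_axioms_def DObj_simps)
  show ?thesis using F.differential_FE by (simp add: \<FF>)
qed

lemma Eval_obj_fields [simp]:
  "tot (Eval_obj X' (E, \<FF>)) = fobj (fst \<FF>) (tot E)" "base (Eval_obj X' (E, \<FF>)) = fobj (fst \<FF>) (base E)"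
  "proj (Eval_obj X' (E, \<FF>)) = farr (fst \<FF>) (proj E)" "tot2 (Eval_obj X' (E, \<FF>)) = fobj (fst \<FF>) (tot2 E)"
  "pr0 (Eval_obj X' (E, \<FF>)) = farr (fst \<FF>) (pr0 E)" "pr1 (Eval_obj X' (E, \<FF>)) = farr (fst \<FF>) (pr1 E)"
  "bplus (Eval_obj X' (E, \<FF>)) = farr (fst \<FF>) (bplus E)" "bzero (Eval_obj X' (E, \<FF>)) = farr (fst \<FF>) (bzero E)"
  by (cases \<FF>; simp add: Eval_obj_def)+

text \<open>Since \<open>f\<close> is additive, additivity of \<open>\<phi> \<circ> F f\<close> follows from naturality of \<open>\<phi>\<close> at the
  addition, the zero and the projections of \<open>E'\<close>. Compatibility with the lifts is not part of
  additivity, which is why \<open>\<phi>\<close> may be any natural transformation, linear or not.\<close>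

lemma Eval_arr_additive:
  assumes t: "(E, E', f, g) \<in> hom (DObj_add X) E E'"
    and s: "(\<FF>, \<GG>, \<phi>) \<in> hom (DiffFun X star X') \<FF> \<GG>"
  shows "additive_bundle_hom C' (Eval_obj X' (E, \<FF>)) (Eval_obj X' (E', \<GG>))
    (Cmp C' (\<phi> (tot E')) (farr (fst \<FF>) f)) (Cmp C' (\<phi> (base E')) (farr (fst \<FF>) g))"
proof -
  have lx: "lax_differential X star X' \<FF>" "lax_differential X star X' \<GG>"
    and \<phi>: "nat_trans C C' (fst \<FF>) (fst \<GG>) \<phi>"
    using s by (auto simp: hom_DiffFun_iff)
  have E: "additive_bundle C E" "additive_bundle C E'" and f: "additive_bundle_hom C E E' f g"
    and ob: "E' \<in> Obj (DObj_add X)"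
    using t by (auto simp: hom_DObj_iff hom_DBun_iff DObj_simps dest: differential_bundleD(1))
  interpret F: functorial "und X" "und X'" "fobj (fst \<FF>)" "farr (fst \<FF>)"
    by (rule functorial_is_functor[OF is_functor_lax[OF lx(1)]])
  interpret G: functorial "und X" "und X'" "fobj (fst \<GG>)" "farr (fst \<GG>)"
    by (rule functorial_is_functor[OF is_functor_lax[OF lx(2)]])
  let ?F = "farr (fst \<FF>)" and ?G = "farr (fst \<GG>)"
  note ED = X.additive_bundleD[OF E(1)] X.additive_bundleD[OF E(2)]
    X.additive_bundle_obj[OF E(1)] X.additive_bundle_obj[OF E(2)]
  note fD = X.additive_bundle_homD[OF f] and \<phi>D = nat_transD(1-3)[OF \<phi>]
  have q: "proj E' \<in> hom C (tot E') (base E')" by (simp add: hom_def ED)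
  note p = X.additive_bundle_hom_pair[OF f E(1) X.additive_bundle_rules(1)[OF E(2)] q]
  let ?d = "pair2 C E' (Cmp C f (pr0 E)) (Cmp C f (pr1 E))"
  have nat: "Cmp C' (\<phi> y) (Cmp C' (?F h) k) = Cmp C' (?G h) (Cmp C' (\<phi> x) k)"
    if "h \<in> Arr C" "Dom C h = x" "Cod C h = y" "k \<in> Arr C'" "Cod C' k = fobj (fst \<FF>) x"
    for h k x y
    using X'.Cmp_cong_right[OF nat_transD(4)[OF \<phi> that(1)], of k] that \<phi>D by auto
  have 1: "Cmp C' (?G (proj E')) (Cmp C' (\<phi> (tot E')) (?F f)) =
      Cmp C' (Cmp C' (\<phi> (base E')) (?F g)) (?F (proj E))"
  proof -
    have "Cmp C' (?G (proj E')) (Cmp C' (\<phi> (tot E')) (?F f)) =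
        Cmp C' (\<phi> (base E')) (Cmp C' (?F (proj E')) (?F f))"
      by (rule nat[symmetric]) (simp_all add: ED fD(1-6))
    also have "Cmp C' (?F (proj E')) (?F f) = Cmp C' (?F g) (?F (proj E))"
      by (rule F.pres_square[OF fD(7)]) (simp_all add: ED fD(1-6))
    finally show ?thesis by (simp add: ED fD(1-6) \<phi>D)
  qed
  have 2: "Cmp C' (Cmp C' (\<phi> (tot E')) (?F f)) (?F (bplus E)) = Cmp C' (?G (bplus E'))
      (pair2 C' (Eval_obj X' (E', \<GG>)) (Cmp C' (Cmp C' (\<phi> (tot E')) (?F f)) (?F (pr0 E)))
        (Cmp C' (Cmp C' (\<phi> (tot E')) (?F f)) (?F (pr1 E))))"
  proof -
    have "Cmp C' (Cmp C' (\<phi> (tot E')) (?F f)) (?F (bplus E)) =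
        Cmp C' (\<phi> (tot E')) (Cmp C' (?F f) (?F (bplus E)))"
      by (simp add: ED fD(1-6) \<phi>D)
    also have "Cmp C' (?F f) (?F (bplus E)) = Cmp C' (?F (bplus E')) (?F ?d)"
      by (rule F.pres_square[OF fD(8)]) (simp_all add: ED fD(1-6) p)
    also have "Cmp C' (\<phi> (tot E')) (Cmp C' (?F (bplus E')) (?F ?d)) =
        Cmp C' (?G (bplus E')) (Cmp C' (\<phi> (tot2 E')) (?F ?d))"
      by (rule nat) (simp_all add: ED p)
    also have "Cmp C' (\<phi> (tot2 E')) (?F ?d) =
        pair2 C' (Eval_obj X' (E', \<GG>)) (Cmp C' (Cmp C' (\<phi> (tot E')) (?F f)) (?F (pr0 E)))
        (Cmp C' (Cmp C' (\<phi> (tot E')) (?F f)) (?F (pr1 E)))"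
    proof (rule X'.pair2_eq[symmetric,
          OF X'.additive_bundle_rules(1)[OF differential_bundleD(1)[OF Eval_obj_differential[OF ob lx(2)]]]])
      have *: "Cmp C' (?G r') (Cmp C' (\<phi> (tot2 E')) (?F ?d)) =
          Cmp C' (Cmp C' (\<phi> (tot E')) (?F f)) (?F r)"
        if r: "r' \<in> Arr C" "Dom C r' = tot2 E'" "Cod C r' = tot E'"
          "r \<in> Arr C" "Dom C r = tot2 E" "Cod C r = tot E"
          "Cmp C r' ?d = Cmp C f r" for r r'
      proof -
        have "Cmp C' (?G r') (Cmp C' (\<phi> (tot2 E')) (?F ?d)) =
            Cmp C' (\<phi> (tot E')) (Cmp C' (?F r') (?F ?d))"
          by (rule nat[symmetric]) (simp_all add: ED p r)
        also have "Cmp C' (?F r') (?F ?d) = Cmp C' (?F f) (?F r)"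
          by (rule F.pres_square[OF r(7)]) (simp_all add: ED p r(1-6) fD(1-6))
        finally show ?thesis by (simp add: ED fD(1-6) \<phi>D r(1-6))
      qed
      show "Cmp C' (pr0 (Eval_obj X' (E', \<GG>))) (Cmp C' (\<phi> (tot2 E')) (?F ?d)) =
          Cmp C' (Cmp C' (\<phi> (tot E')) (?F f)) (?F (pr0 E))"
        unfolding Eval_obj_fields by (rule *) (simp_all add: ED p)
      show "Cmp C' (pr1 (Eval_obj X' (E', \<GG>))) (Cmp C' (\<phi> (tot2 E')) (?F ?d)) =
          Cmp C' (Cmp C' (\<phi> (tot E')) (?F f)) (?F (pr1 E))"
        unfolding Eval_obj_fields by (rule *) (simp_all add: ED p)
    qed (simp_all add: ED p \<phi>D)
    finally show ?thesis .
  qed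
  have 3: "Cmp C' (Cmp C' (\<phi> (tot E')) (?F f)) (?F (bzero E)) =
      Cmp C' (?G (bzero E')) (Cmp C' (\<phi> (base E')) (?F g))"
  proof -
    have "Cmp C' (Cmp C' (\<phi> (tot E')) (?F f)) (?F (bzero E)) =
        Cmp C' (\<phi> (tot E')) (Cmp C' (?F f) (?F (bzero E)))"
      by (simp add: ED fD(1-6) \<phi>D)
    also have "Cmp C' (?F f) (?F (bzero E)) = Cmp C' (?F (bzero E')) (?F g)"
      by (rule F.pres_square[OF fD(9)]) (simp_all add: ED fD(1-6))
    also have "Cmp C' (\<phi> (tot E')) (Cmp C' (?F (bzero E')) (?F g)) =
        Cmp C' (?G (bzero E')) (Cmp C' (\<phi> (base E')) (?F g))"
      by (rule nat) (simp_all add: ED fD(1-6))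
    finally show ?thesis .
  qed
  from 1 2 3 show ?thesis
    unfolding additive_bundle_hom_def hom_def by (simp add: ED fD(1-6) \<phi>D)
qed

text \<open>\<open>Eval\<close> is given by the same formulas on all four categories of differential functors, so they
  are treated together as subcategories of \<open>DiffFun\<close>.\<close>

definition subcat_DiffFun :: "('o, 'm, 'p, 'q) dfun_cat \<Rightarrow> bool" where
  "subcat_DiffFun D \<longleftrightarrow> category D \<and> Obj D \<subseteq> Obj (DiffFun X star X') \<and>
     Arr D \<subseteq> Arr (DiffFun X star X') \<and> Dom D = Dom (DiffFun X star X') \<and> Cod D = Cod (DiffFun X star X') \<and>
     Ide D = Ide (DiffFun X star X') \<and> Cmp D = Cmp (DiffFun X star X')"

lemma subcat_DiffFun_full_subcat: "subcat_DiffFun D \<Longrightarrow> subcat_DiffFun (full_subcat D S)"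
  unfolding subcat_DiffFun_def using category_full_subcat[of D S] by (auto simp: full_subcat_def)

lemma subcat_DiffFuns:
  "subcat_DiffFun (DiffFun X star X')" "subcat_DiffFun (DiffFun_lin X star X')"
  "subcat_DiffFun (DiffFun_strong X star X')" "subcat_DiffFun (DiffFun_strong_lin X star X')"
proof -
  show D: "subcat_DiffFun (DiffFun X star X')"
    by (simp add: subcat_DiffFun_def category_DiffFun)
  show L: "subcat_DiffFun (DiffFun_lin X star X')"
    unfolding subcat_DiffFun_def using category_DiffFun_lin by (auto simp: DiffFun_lin_def)
  show "subcat_DiffFun (DiffFun_strong X star X')" "subcat_DiffFun (DiffFun_strong_lin X star X')"
    unfolding DiffFun_strong_def DiffFun_strong_lin_def
    by (rule subcat_DiffFun_full_subcat[OF D], rule subcat_DiffFun_full_subcat[OF L])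
qed

text \<open>Preservation of composition is the interchange law, by naturality of the first transformation at
  the second morphism.\<close>

lemma Eval_functor:
  assumes D: "subcat_DiffFun D"
  shows "is_functor (cat_prod (DObj_add X) D) (DBun_add X') (Eval X X' D)"
proof -
  have cD: "category D" and OD: "\<And>\<FF>. \<FF> \<in> Obj D \<Longrightarrow> lax_differential X star X' \<FF>"
    and sD: "Dom D = Dom (DiffFun X star X')" "Cod D = Cod (DiffFun X star X')"
      "Ide D = Ide (DiffFun X star X')" "Cmp D = Cmp (DiffFun X star X')"
    using D by (auto simp: subcat_DiffFun_def DiffFun_simps)
  have hD: "t \<in> hom (DiffFun X star X') \<FF> \<GG>" if "t \<in> hom D \<FF> \<GG>" for t \<FF> \<GG>
    using that D by (auto simp: subcat_DiffFun_def hom_def)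
  have cB: "category (cat_prod (DObj_add X) D)"
    by (rule category_cat_prod[OF X.category_DObj cD])
  interpret B: category "cat_prod (DObj_add X) D" by (rule cB)
  have hom_prod: "(t, s) \<in> hom (cat_prod (DObj_add X) D) (E, \<FF>) (E', \<GG>) \<longleftrightarrow>
      t \<in> hom (DObj_add X) E E' \<and> s \<in> hom D \<FF> \<GG>" for t s E \<FF> E' \<GG>
    by (auto simp: hom_def cat_prod_def)
  have obj: "fobj (Eval X X' D) (E, \<FF>) = Eval_obj X' (E, \<FF>)" "Eval_obj X' (E, \<FF>) \<in> Obj (DBun_add X')"
    if "(E, \<FF>) \<in> Obj (cat_prod (DObj_add X) D)" for E \<FF>
    using that Eval_obj_differential[of E \<FF>] OD by (auto simp: Eval_def mk_ftor_def cat_prod_def DBun_add_def)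
  have arr: "farr (Eval X X' D) (t, s) = Eval_arr X' (t, s)"
    "farr (Eval X X' D) (t, s) \<in> hom (DBun_add X') (fobj (Eval X X' D) (E, \<FF>)) (fobj (Eval X X' D) (E', \<GG>))"
    if ts: "(t, s) \<in> hom (cat_prod (DObj_add X) D) (E, \<FF>) (E', \<GG>)" for t s E \<FF> E' \<GG>
  proof -
    have t: "t \<in> hom (DObj_add X) E E'" and s: "s \<in> hom (DiffFun X star X') \<FF> \<GG>"
      using ts hD by (auto simp: hom_prod)
    then obtain f g \<phi> where e: "t = (E, E', f, g)" "s = (\<FF>, \<GG>, \<phi>)"
      by (auto simp: hom_DObj_iff hom_DBun_iff hom_DiffFun_iff)
    show 1: "farr (Eval X X' D) (t, s) = Eval_arr X' (t, s)"
      using ts by (simp add: Eval_def mk_ftor_def hom_def)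
    have o: "(E, \<FF>) \<in> Obj (cat_prod (DObj_add X) D)" "(E', \<GG>) \<in> Obj (cat_prod (DObj_add X) D)"
      using B.Dom_in B.Cod_in ts by (metis (mono_tags, lifting) hom_def mem_Collect_eq)+
    have "differential_bundle X' (Eval_obj X' (E, \<FF>))" "differential_bundle X' (Eval_obj X' (E', \<GG>))"
      using obj(2)[OF o(1)] obj(2)[OF o(2)] by (auto simp: DBun_add_def)
    then show "farr (Eval X X' D) (t, s) \<in> hom (DBun_add X') (fobj (Eval X X' D) (E, \<FF>)) (fobj (Eval X X' D) (E', \<GG>))"
      unfolding 1 obj(1)[OF o(1)] obj(1)[OF o(2)] hom_DBun_iff
      using Eval_arr_additive[of E E' f g \<FF> \<GG> \<phi>] t s by (simp add: Eval_arr_def e)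
  qed
  have ide: "farr (Eval X X' D) (Ide (cat_prod (DObj_add X) D) (E, \<FF>)) = Ide (DBun_add X') (fobj (Eval X X' D) (E, \<FF>))"
    if o: "(E, \<FF>) \<in> Obj (cat_prod (DObj_add X) D)" for E \<FF>
  proof -
    have I: "Ide (cat_prod (DObj_add X) D) (E, \<FF>) = (Ide (DObj_add X) E, Ide D \<FF>)"
      by (simp add: cat_prod_def)
    have h: "(Ide (DObj_add X) E, Ide D \<FF>) \<in> hom (cat_prod (DObj_add X) D) (E, \<FF>) (E, \<FF>)"
      using B.Ide_in[OF o] by (simp add: I)
    have lx: "lax_differential X star X' \<FF>" and E: "E \<in> Obj (DObj_add X)"
      using o OD by (auto simp: cat_prod_def)
    have ob: "tot E \<in> Obj C" "base E \<in> Obj C"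
      using X.additive_bundle_obj[OF differential_bundleD(1)] E by (auto simp: DObj_simps)
    interpret F: functorial "und X" "und X'" "fobj (fst \<FF>)" "farr (fst \<FF>)"
      by (rule functorial_is_functor[OF is_functor_lax[OF lx]])
    show ?thesis
      unfolding I obj(1)[OF o] arr(1)[OF h]
      by (simp add: sD DiffFun_simps DObj_simps Eval_arr_def DBun_add_def ob)
  qed
  have cmp: "farr (Eval X X' D) (Cmp (cat_prod (DObj_add X) D) (t', s') (t, s)) =
      Cmp (DBun_add X') (farr (Eval X X' D) (t', s')) (farr (Eval X X' D) (t, s))"
    if ts: "(t, s) \<in> hom (cat_prod (DObj_add X) D) (E, \<FF>) (E', \<GG>)"
      and ts': "(t', s') \<in> hom (cat_prod (DObj_add X) D) (E', \<GG>) (E'', \<HH>)" for t s t' s' E \<FF> E' \<GG> E'' \<HH>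
  proof -
    have t: "t \<in> hom (DObj_add X) E E'" "t' \<in> hom (DObj_add X) E' E''"
      and s: "s \<in> hom (DiffFun X star X') \<FF> \<GG>" "s' \<in> hom (DiffFun X star X') \<GG> \<HH>"
      using ts ts' hD by (auto simp: hom_prod)
    from t s obtain f g \<phi> f' g' \<psi> where e: "t = (E, E', f, g)" "s = (\<FF>, \<GG>, \<phi>)" "t' = (E', E'', f', g')" "s' = (\<GG>, \<HH>, \<psi>)"
      and f: "additive_bundle_hom C E E' f g" and f': "additive_bundle_hom C E' E'' f' g'"
      and E: "differential_bundle X E" "differential_bundle X E'" "differential_bundle X E''"
      and lx: "lax_differential X star X' \<FF>" "lax_differential X star X' \<GG>" "lax_differential X star X' \<HH>"
      and \<phi>: "nat_trans C C' (fst \<FF>) (fst \<GG>) \<phi>" and \<psi>: "nat_trans C C' (fst \<GG>) (fst \<HH>) \<psi>"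
      by (auto simp: hom_DObj_iff hom_DBun_iff hom_DiffFun_iff)
    interpret F: functorial "und X" "und X'" "fobj (fst \<FF>)" "farr (fst \<FF>)"
      by (rule functorial_is_functor[OF is_functor_lax[OF lx(1)]])
    interpret G: functorial "und X" "und X'" "fobj (fst \<GG>)" "farr (fst \<GG>)"
      by (rule functorial_is_functor[OF is_functor_lax[OF lx(2)]])
    interpret H: functorial "und X" "und X'" "fobj (fst \<HH>)" "farr (fst \<HH>)"
      by (rule functorial_is_functor[OF is_functor_lax[OF lx(3)]])
    note fD = X.additive_bundle_homD(1-6)[OF f] and fD' = X.additive_bundle_homD(1-6)[OF f']
    note ob = X.additive_bundle_obj[OF differential_bundleD(1)[OF E(2)]] X.additive_bundle_obj[OF differential_bundleD(1)[OF E(3)]]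
    have interchange: "Cmp C' (Cmp C' (\<psi> z) (\<phi> z)) (farr (fst \<FF>) (Cmp C k h)) =
        Cmp C' (Cmp C' (\<psi> z) (farr (fst \<GG>) k)) (Cmp C' (\<phi> y) (farr (fst \<FF>) h))"
      if "h \<in> Arr C" "Cod C h = y" "k \<in> Arr C" "Dom C k = y" "Cod C k = z" for h k y z
    proof -
      have yz: "y \<in> Obj C" "z \<in> Obj C" using that by auto
      note n = nat_transD(1-3)[OF \<phi>] nat_transD(1-3)[OF \<psi>]
      have "Cmp C' (\<phi> z) (Cmp C' (farr (fst \<FF>) k) (farr (fst \<FF>) h)) =
          Cmp C' (farr (fst \<GG>) k) (Cmp C' (\<phi> y) (farr (fst \<FF>) h))"
        by (rule X'.Cmp_cong_right[OF nat_transD(4)[OF \<phi> that(3), unfolded that]]) (simp_all add: n yz that)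
      then show ?thesis by (simp add: F.pres_Cmp n yz that)
    qed
    have C: "Cmp (cat_prod (DObj_add X) D) (t', s') (t, s) = (Cmp (DObj_add X) t' t, Cmp D s' s)"
      by (simp add: cat_prod_def)
    have "(Cmp (DObj_add X) t' t, Cmp D s' s) \<in> hom (cat_prod (DObj_add X) D) (E, \<FF>) (E'', \<HH>)"
      using B.Cmp_in[OF ts ts'] by (simp add: C)
    then show ?thesis
      unfolding C arr(1)[OF ts] arr(1)[OF ts']
      by (subst arr(1)) (auto simp: e sD DiffFun_simps DObj_simps Eval_arr_def DBun_add_def ob
          intro!: interchange simp: fD fD')
  qed
  have "fobj (Eval X X' D) \<in> Obj (cat_prod (DObj_add X) D) \<rightarrow>\<^sub>E Obj (DBun_add X')"
    using obj by (auto simp: Eval_def mk_ftor_def PiE_def)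
  moreover have "farr (Eval X X' D) \<in> Arr (cat_prod (DObj_add X) D) \<rightarrow>\<^sub>E Arr (DBun_add X')"
  proof (rule PiE_I)
    fix x assume x: "x \<in> Arr (cat_prod (DObj_add X) D)"
    obtain t s E \<FF> E' \<GG> where "x = (t, s)" "Dom (cat_prod (DObj_add X) D) x = (E, \<FF>)"
      "Cod (cat_prod (DObj_add X) D) x = (E', \<GG>)" by (metis surj_pair)
    then show "farr (Eval X X' D) x \<in> Arr (DBun_add X')"
      using arr(2)[of t s E \<FF> E' \<GG>] x by (auto simp: hom_def)
  qed (simp add: Eval_def mk_ftor_def)
  moreover have "farr (Eval X X' D) h \<in> hom (DBun_add X') (fobj (Eval X X' D) a) (fobj (Eval X X' D) b)"
    if "h \<in> hom (cat_prod (DObj_add X) D) a b" for a b h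
    using arr(2) that by (cases h, cases a, cases b) blast
  moreover have "farr (Eval X X' D) (Ide (cat_prod (DObj_add X) D) a) = Ide (DBun_add X') (fobj (Eval X X' D) a)"
    if "a \<in> Obj (cat_prod (DObj_add X) D)" for a
    using ide that by (cases a) blast
  moreover have "farr (Eval X X' D) (Cmp (cat_prod (DObj_add X) D) k h) =
      Cmp (DBun_add X') (farr (Eval X X' D) k) (farr (Eval X X' D) h)"
    if "h \<in> hom (cat_prod (DObj_add X) D) a b" "k \<in> hom (cat_prod (DObj_add X) D) b c" for a b c h k
    using cmp that by (cases h, cases k, cases a, cases b, cases c) blast
  ultimately show ?thesis
    unfolding is_functor_def using cB X'.category_DBun by blast
qed

lemma Eval_total:
  assumes D: "subcat_DiffFun D"
  shows "ftor_comp (cat_prod (DObj_add X) D) (total_DBun X') (Eval X X' D) =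
    ftor_comp (cat_prod (DObj_add X) D) (eval_ftor C C')
      (ftor_prod (DObj_add X) D (und_DObj X) (und_DiffFun D))"
proof -
  let ?B = "cat_prod (DObj_add X) D"
  note F = Eval_functor[OF D]
  have OD: "\<And>\<FF>. \<FF> \<in> Obj D \<Longrightarrow> lax_differential X star X' \<FF>"
    and AD: "\<And>s. s \<in> Arr D \<Longrightarrow> s \<in> Arr (DiffFun X star X')"
    using D by (auto simp: subcat_DiffFun_def DiffFun_simps)
  have "fobj (total_DBun X') (fobj (Eval X X' D) x) =
      fobj (eval_ftor C C') (fobj (ftor_prod (DObj_add X) D (und_DObj X) (und_DiffFun D)) x)"
    if x: "x \<in> Obj ?B" for x
  proof -
    obtain E \<FF> where e: "x = (E, \<FF>)" by (cases x)
    have E: "E \<in> Obj (DObj_add X)" and \<FF>: "\<FF> \<in> Obj D" using x by (auto simp: e cat_prod_def)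
    have "fobj (Eval X X' D) x \<in> Obj (DBun_add X')" using F x by (auto simp: is_functor_def)
    moreover have "tot E \<in> Obj C" using E X.additive_bundle_obj[OF differential_bundleD(1)] by (auto simp: DObj_simps)
    moreover have "is_functor C C' (fst \<FF>)" by (rule is_functor_lax[OF OD[OF \<FF>]])
    ultimately show ?thesis using x E \<FF>
      by (simp add: e total_DBun_def mk_ftor_def Eval_def eval_ftor_def ftor_prod_def und_DObj_def und_DiffFun_def
          cat_prod_def Fun_cat_def)
  qed
  moreover have "farr (total_DBun X') (farr (Eval X X' D) x) =
      farr (eval_ftor C C') (farr (ftor_prod (DObj_add X) D (und_DObj X) (und_DiffFun D)) x)"
    if x: "x \<in> Arr ?B" for x
  proof -
    obtain t s where e: "x = (t, s)" by (cases x)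
    have ts: "t \<in> Arr (DObj_add X)" "s \<in> Arr D" using x by (auto simp: e cat_prod_def)
    obtain E E' f g where t: "t = (E, E', f, g)" and f: "additive_bundle_hom C E E' f g"
      using ts(1) by (auto simp: DObj_add_def full_subcat_def DBun_add_def)
    obtain \<FF> \<GG> \<phi> where s: "s = (\<FF>, \<GG>, \<phi>)" and lx: "lax_differential X star X' \<FF>" "lax_differential X star X' \<GG>"
      and \<phi>: "nat_trans C C' (fst \<FF>) (fst \<GG>) \<phi>"
      using AD[OF ts(2)] by (auto simp: DiffFun_def)
    have "farr (Eval X X' D) x \<in> Arr (DBun_add X')" using F x by (auto simp: is_functor_def)
    moreover note X.additive_bundle_homD(1,3)[OF f] is_functor_lax[OF lx(1)] is_functor_lax[OF lx(2)] \<phi>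
    ultimately show ?thesis using x ts
      by (simp add: e t s total_DBun_def mk_ftor_def Eval_def Eval_arr_def eval_ftor_def ftor_prod_def und_DObj_def und_DiffFun_def
          cat_prod_def Fun_cat_def)
  qed
  ultimately show ?thesis
    by (simp add: ftor_comp_def mk_ftor_def cong: restrict_cong)
qed

end

lemma is_functor_full_subcat:
  assumes F: "is_functor C D F" and S: "\<And>a. a \<in> Obj C \<Longrightarrow> fobj F a \<in> S"
  shows "is_functor C (full_subcat D S) F"
proof -
  interpret functorial C D "fobj F" "farr F" by (rule functorial_is_functor[OF F])
  show ?thesis
    using F S category_full_subcat[of D S] unfolding is_functor_def
    by (auto simp: full_subcat_def hom_def PiE_iff)
qed

theorem theorem4p10:
  fixes X :: "('o, 'm) actegory" and X' :: "('p, 'q) actegory" and star :: 'o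
  assumes "tangent_actegory X" and "tangent_actegory X'"
    and "terminal (und X) star"
    and "terminal (und X) (Tobj X W star)"
  shows
    "(\<forall>D \<in> {DiffFun X star X', DiffFun_lin X star X'}.
        is_functor (cat_prod (DObj_add X) D) (DBun_add X') (Eval X X' D) \<and>
        ftor_comp (cat_prod (DObj_add X) D) (total_DBun X') (Eval X X' D) =
        ftor_comp (cat_prod (DObj_add X) D) (eval_ftor (und X) (und X'))
          (ftor_prod (DObj_add X) D (und_DObj X) (und_DiffFun D))) \<and>
     (\<forall>D \<in> {DiffFun_strong X star X', DiffFun_strong_lin X star X'}.
        is_functor (cat_prod (DObj_add X) D) (DObj_add X') (Eval X X' D) \<and>
        ftor_comp (cat_prod (DObj_add X) D) (und_DObj X') (Eval X X' D) =
        ftor_comp (cat_prod (DObj_add X) D) (eval_ftor (und X) (und X'))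
          (ftor_prod (DObj_add X) D (und_DObj X) (und_DiffFun D)))"
proof -
  interpret eval_setting X X' star
    using assms by (simp add: eval_setting_def eval_setting_axioms_def tangent_acteg_iff)
  have "is_functor (cat_prod (DObj_add X) D) (DObj_add X') (Eval X X' D) \<and>
      ftor_comp (cat_prod (DObj_add X) D) (und_DObj X') (Eval X X' D) =
      ftor_comp (cat_prod (DObj_add X) D) (total_DBun X') (Eval X X' D)"
    if D: "D \<in> {DiffFun_strong X star X', DiffFun_strong_lin X star X'}" for D
  proof
    have sub: "subcat_DiffFun D" using D subcat_DiffFuns by auto
    have strong: "strong_differential X star X' \<FF>" if "\<FF> \<in> Obj D" for \<FF>
      using D that by (auto simp: DiffFun_strong_def DiffFun_strong_lin_def full_subcat_def)
    (* E may sit over any terminal object b; F b is isomorphic to F star, which is terminal. *)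
    have "terminal (und X') (base (fobj (Eval X X' D) x))" if x: "x \<in> Obj (cat_prod (DObj_add X) D)" for x
    proof -
      obtain E F \<alpha> where e: "x = (E, (F, \<alpha>))" by (cases x)
      have E: "terminal (und X) (base E)" and st: "strong_differential X star X' (F, \<alpha>)"
        using x strong by (auto simp: e cat_prod_def DObj_simps)
      interpret F: lax X X' F \<alpha> star
        using st by (intro lax_intro) (simp add: strong_differential_def)
      obtain i j where i: "inverse_arrows (und X) i j" "Dom (und X) i = base E" "Cod (und X) i = star"
        using F.terminal_iso[OF E] .
      have "terminal (und X') (fobj F star)" using st by (simp add: strong_differential_def)
      from X'.terminal_if_iso[OF this F.F.pres_inverse[OF i(1)]] have "terminal (und X') (fobj F (base E))"
        using i X.inverse_arrowsD(1)[OF i(1)] by simp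
      then show ?thesis using x by (simp add: e Eval_def mk_ftor_def)
    qed
    then show func: "is_functor (cat_prod (DObj_add X) D) (DObj_add X') (Eval X X' D)"
      unfolding DObj_add_def[of X'] by (intro is_functor_full_subcat[OF Eval_functor[OF sub]]) simp
    have "Obj (DObj_add X') \<subseteq> Obj (DBun_add X')" "Arr (DObj_add X') \<subseteq> Arr (DBun_add X')"
      by (auto simp: DObj_add_def full_subcat_def)
    then have "fobj (und_DObj X') (fobj (Eval X X' D) x) = fobj (total_DBun X') (fobj (Eval X X' D) x)"
      if "x \<in> Obj (cat_prod (DObj_add X) D)" for x
      using func that by (auto simp: is_functor_def und_DObj_def total_DBun_def mk_ftor_def)
    moreover have "farr (und_DObj X') (farr (Eval X X' D) x) = farr (total_DBun X') (farr (Eval X X' D) x)"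
      if "x \<in> Arr (cat_prod (DObj_add X) D)" for x
      using func that \<open>Arr (DObj_add X') \<subseteq> Arr (DBun_add X')\<close>
      by (auto simp: is_functor_def und_DObj_def total_DBun_def mk_ftor_def)
    ultimately show "ftor_comp (cat_prod (DObj_add X) D) (und_DObj X') (Eval X X' D) =
        ftor_comp (cat_prod (DObj_add X) D) (total_DBun X') (Eval X X' D)"
      by (simp add: ftor_comp_def mk_ftor_def cong: restrict_cong)
  qed
  then show ?thesis
    using Eval_functor Eval_total subcat_DiffFuns by auto
qed

end
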